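(* Let $G$ be a homogeneous Garside group with Garside generators $S$, and let $X:=S\cup S^{-1}$. Then $\mathsf{ConjGeo}(G,X)$ is regular, and there is a total ordering of $X$ for which $\mathsf{ConjMinLenSL}(G,X)$ is regular. This holds, in particular, for Artin groups of spherical type.
   Context: A Garside monoid is a finitely generated cancellative monoid $G^+$ in which, for each element, the number of factors in its expressions as a product of non-identity elements is bounded, any two elements have least common multiples and greatest common divisors on the left and on the right, and which contains an element $\Delta$ (the Garside element) whose sets of left divisors and right divisors coincide, are finite, and generate $G^+$. The Garside group $G$ is the group of fractions of $G^+$, i.e. the group defined by the same finite presentation as $G^+$, in which all relations have the form $u=v$ with $u,v$ positive words in the group generators; $G^+$ embeds in $G$. $G$ is homogeneous if $l(u)=l(v)$ for each of these defining relations $u=v$. The set $S$ of Garside generators is the set of non-identity divisors of $\Delta$ in $G^+$, viewed as elements of $G$. Artin groups of spherical (finite) type, i.e. those whose associated Coxeter group is finite, are homogeneous Garside groups. For $w\in X^*$, $l(w)$ is its length and $\pi(w)$ the element of $G$ it represents. For $g\in G$, $|g|$ is the length of a shortest word over $X$ representing $g$, and $|g|_c=\min\{|h| : h\text{ conjugate to }g\text{ in }G\}$. $\mathsf{ConjGeo}(G,X)=\{w\in X^* : l(w)=|\pi(w)|_c\}$. Given a total ordering of $X$, the shortlex ordering on $X^*$ compares words first by length and then, for equal length, lexicographically; $y_g$ denotes the shortlex least word representing $g$, and $\mathsf{ConjMinLenSL}(G,X)=\{y_g : g\in G,\ |g|=|g|_c\}$. A language is regular if it is accepted by a finite state automaton.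 *)

theory Defs
  imports "HOL-Algebra.Divisibility"
begin

section \<open>Presented monoids and groups\<close>

inductive_set pres_cong :: "'a set \<Rightarrow> ('a list \<times> 'a list) set \<Rightarrow> ('a list \<times> 'a list) set"
  for A :: "'a set" and R :: "('a list \<times> 'a list) set"
where
  refl: "u \<in> lists A \<Longrightarrow> (u, u) \<in> pres_cong A R"
| rel: "(u, v) \<in> R \<Longrightarrow> u \<in> lists A \<Longrightarrow> v \<in> lists A \<Longrightarrow> p \<in> lists A \<Longrightarrow> q \<in> lists A
    \<Longrightarrow> (p @ u @ q, p @ v @ q) \<in> pres_cong A R"
| sym: "(u, v) \<in> pres_cong A R \<Longrightarrow> (v, u) \<in> pres_cong A R"
| trans: "(u, v) \<in> pres_cong A R \<Longrightarrow> (v, w) \<in> pres_cong A R \<Longrightarrow> (u, w) \<in> pres_cong A R"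

definition word_class :: "'a set \<Rightarrow> ('a list \<times> 'a list) set \<Rightarrow> 'a list \<Rightarrow> 'a list set" where
  "word_class A R u = pres_cong A R `` {u}"

definition pres_monoid :: "'a set \<Rightarrow> ('a list \<times> 'a list) set \<Rightarrow> 'a list set monoid" where
  "pres_monoid A R =
    \<lparr>carrier = lists A // pres_cong A R,
     mult = (\<lambda>x y. \<Union>u\<in>x. \<Union>v\<in>y. word_class A R (u @ v)),
     one = word_class A R []\<rparr>"

text \<open>The letter \<open>(a, True)\<close> stands for the generator \<open>a\<close> and \<open>(a, False)\<close> for its formal
  inverse. The relations in \<open>R\<close> are between positive words.\<close>

definition pos_word :: "'a list \<Rightarrow> ('a \<times> bool) list" where
  "pos_word u = map (\<lambda>a. (a, True)) u"

definition group_letters :: "'a set \<Rightarrow> ('a \<times> bool) set" where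
  "group_letters A = A \<times> UNIV"

definition group_rels ::
    "'a set \<Rightarrow> ('a list \<times> 'a list) set \<Rightarrow> (('a \<times> bool) list \<times> ('a \<times> bool) list) set" where
  "group_rels A R =
    {(pos_word u, pos_word v) |u v. (u, v) \<in> R} \<union> {([(a, e), (a, \<not> e)], []) |a e. a \<in> A}"

definition pres_group :: "'a set \<Rightarrow> ('a list \<times> 'a list) set \<Rightarrow> ('a \<times> bool) list set monoid" where
  "pres_group A R = pres_monoid (group_letters A) (group_rels A R)"

section \<open>Garside monoids and Garside groups\<close>

text \<open>The library's divisibility \<open>divides\<close> is left divisibility. Divisors, greatest common divisors
  and least common multiples on the right are those of the opposite monoid.\<close>

definition opp_monoid :: "'a monoid \<Rightarrow> 'a monoid" where
  "opp_monoid M = \<lparr>carrier = carrier M, mult = (\<lambda>x y. y \<otimes>\<^bsub>M\<^esub> x), one = \<one>\<^bsub>M\<^esub>\<rparr>"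

definition left_divisors :: "'a monoid \<Rightarrow> 'a \<Rightarrow> 'a set" where
  "left_divisors M x = {d \<in> carrier M. d divides\<^bsub>M\<^esub> x}"

definition right_divisors :: "'a monoid \<Rightarrow> 'a \<Rightarrow> 'a set" where
  "right_divisors M x = left_divisors (opp_monoid M) x"

definition word_prod :: "'a monoid \<Rightarrow> 'a list \<Rightarrow> 'a" where
  "word_prod M w = foldr (\<otimes>\<^bsub>M\<^esub>) w \<one>\<^bsub>M\<^esub>"

definition generates_monoid :: "'a monoid \<Rightarrow> 'a set \<Rightarrow> bool" where
  "generates_monoid M A \<longleftrightarrow> A \<subseteq> carrier M \<and> word_prod M ` lists A = carrier M"

definition has_lcms_gcds :: "'a monoid \<Rightarrow> bool" where
  "has_lcms_gcds M \<longleftrightarrow> (\<forall>x\<in>carrier M. \<forall>y\<in>carrier M.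
     (\<exists>z\<in>carrier M. z lcmof\<^bsub>M\<^esub> x y) \<and> (\<exists>z\<in>carrier M. z gcdof\<^bsub>M\<^esub> x y))"

definition garside_element :: "'a monoid \<Rightarrow> 'a \<Rightarrow> bool" where
  "garside_element M \<Delta> \<longleftrightarrow> \<Delta> \<in> carrier M \<and>
     left_divisors M \<Delta> = right_divisors M \<Delta> \<and>
     finite (left_divisors M \<Delta>) \<and>
     generates_monoid M (left_divisors M \<Delta>)"

definition garside_monoid :: "'a monoid \<Rightarrow> bool" where
  "garside_monoid M \<longleftrightarrow> monoid_cancel M \<and>
     (\<exists>A. finite A \<and> generates_monoid M A) \<and>
     (\<forall>x\<in>carrier M. \<exists>N. \<forall>w\<in>lists (carrier M - {\<one>\<^bsub>M\<^esub>}). word_prod M w = x \<longrightarrow> length w \<le> N) \<and>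
     has_lcms_gcds M \<and> has_lcms_gcds (opp_monoid M) \<and>
     (\<exists>\<Delta>. garside_element M \<Delta>)"

text \<open>Finite presentations with length-preserving relations of a Garside monoid; the corresponding
  group of fractions is \<open>pres_group A R\<close>.\<close>

definition homogeneous_garside_presentation :: "'a set \<Rightarrow> ('a list \<times> 'a list) set \<Rightarrow> bool" where
  "homogeneous_garside_presentation A R \<longleftrightarrow>
     finite A \<and> finite R \<and> R \<subseteq> lists A \<times> lists A \<and>
     garside_monoid (pres_monoid A R) \<and>
     (\<forall>(u, v)\<in>R. length u = length v)"

definition garside_generators ::
    "'a set \<Rightarrow> ('a list \<times> 'a list) set \<Rightarrow> 'a list set \<Rightarrow> ('a \<times> bool) list set set" where
  "garside_generators A R \<Delta> =
     {word_class (group_letters A) (group_rels A R) (pos_word u) |u.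
        u \<in> lists A \<and>
        word_class A R u \<in> left_divisors (pres_monoid A R) \<Delta> - {\<one>\<^bsub>pres_monoid A R\<^esub>}}"

definition garside_alphabet ::
    "'a set \<Rightarrow> ('a list \<times> 'a list) set \<Rightarrow> 'a list set \<Rightarrow> ('a \<times> bool) list set set" where
  "garside_alphabet A R \<Delta> =
     garside_generators A R \<Delta> \<union> m_inv (pres_group A R) ` garside_generators A R \<Delta>"

section \<open>Conjugacy languages\<close>

text \<open>Words over \<open>X\<close> are the lists in \<open>lists X\<close>, where \<open>X\<close> is a generating subset of the carrier of
  \<open>G\<close> closed under inversion; such a word \<open>w\<close> represents \<open>word_prod G w\<close>.\<close>

definition word_len :: "'g monoid \<Rightarrow> 'g set \<Rightarrow> 'g \<Rightarrow> nat" where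
  "word_len G X g = (LEAST n. \<exists>w\<in>lists X. word_prod G w = g \<and> length w = n)"

definition conjugates :: "'g monoid \<Rightarrow> 'g \<Rightarrow> 'g set" where
  "conjugates G g = {k \<otimes>\<^bsub>G\<^esub> g \<otimes>\<^bsub>G\<^esub> inv\<^bsub>G\<^esub> k |k. k \<in> carrier G}"

definition conj_len :: "'g monoid \<Rightarrow> 'g set \<Rightarrow> 'g \<Rightarrow> nat" where
  "conj_len G X g = (LEAST n. \<exists>h\<in>conjugates G g. word_len G X h = n)"

definition ConjGeo :: "'g monoid \<Rightarrow> 'g set \<Rightarrow> 'g list set" where
  "ConjGeo G X = {w \<in> lists X. length w = conj_len G X (word_prod G w)}"

text \<open>\<open>lex\<close> and \<open>lenlex\<close> expect a strict order, while \<open>linear_order_on\<close> is about reflexive ones.\<close>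

definition shortlex :: "('g \<times> 'g) set \<Rightarrow> ('g list \<times> 'g list) set" where
  "shortlex r = lenlex (r - Id)"

definition shortlex_rep :: "'g monoid \<Rightarrow> 'g set \<Rightarrow> ('g \<times> 'g) set \<Rightarrow> 'g \<Rightarrow> 'g list" where
  "shortlex_rep G X r g = (THE w. w \<in> lists X \<and> word_prod G w = g \<and>
     (\<forall>v\<in>lists X. word_prod G v = g \<longrightarrow> v = w \<or> (w, v) \<in> shortlex r))"

definition ConjMinLenSL :: "'g monoid \<Rightarrow> 'g set \<Rightarrow> ('g \<times> 'g) set \<Rightarrow> 'g list set" where
  "ConjMinLenSL G X r =
     {shortlex_rep G X r g |g. g \<in> carrier G \<and> word_len G X g = conj_len G X g}"

text \<open>Acceptance by a complete deterministic automaton; its finitely many states are numbered.\<close>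

definition regular_language :: "'x set \<Rightarrow> 'x list set \<Rightarrow> bool" where
  "regular_language X L \<longleftrightarrow> finite X \<and>
     (\<exists>(Q :: nat set) q\<^sub>0 \<delta> F. finite Q \<and> q\<^sub>0 \<in> Q \<and> (\<forall>q\<in>Q. \<forall>x\<in>X. \<delta> q x \<in> Q) \<and> F \<subseteq> Q \<and>
        L = {w \<in> lists X. foldl \<delta> q\<^sub>0 w \<in> F})"

section \<open>Artin groups\<close>

text \<open>The value \<open>m s t = 0\<close> encodes the label \<open>\<infinity>\<close>, i.e. the absence of a relation.\<close>

definition coxeter_matrix :: "'a set \<Rightarrow> ('a \<Rightarrow> 'a \<Rightarrow> nat) \<Rightarrow> bool" where
  "coxeter_matrix A m \<longleftrightarrow> (\<forall>s\<in>A. m s s = 1) \<and>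
     (\<forall>s\<in>A. \<forall>t\<in>A. m s t = m t s \<and> (s \<noteq> t \<longrightarrow> m s t \<noteq> 1))"

fun alternating :: "'a \<Rightarrow> 'a \<Rightarrow> nat \<Rightarrow> 'a list" where
  "alternating s t 0 = []"
| "alternating s t (Suc n) = s # alternating t s n"

definition artin_rels :: "'a set \<Rightarrow> ('a \<Rightarrow> 'a \<Rightarrow> nat) \<Rightarrow> ('a list \<times> 'a list) set" where
  "artin_rels A m = {(alternating s t (m s t), alternating t s (m s t)) |s t.
     s \<in> A \<and> t \<in> A \<and> s \<noteq> t \<and> m s t \<noteq> 0}"

definition coxeter_rels :: "'a set \<Rightarrow> ('a \<Rightarrow> 'a \<Rightarrow> nat) \<Rightarrow> ('a list \<times> 'a list) set" where
  "coxeter_rels A m = {(concat (replicate (m s t) [s, t]), []) |s t.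
     s \<in> A \<and> t \<in> A \<and> m s t \<noteq> 0}"

definition spherical_type :: "'a set \<Rightarrow> ('a \<Rightarrow> 'a \<Rightarrow> nat) \<Rightarrow> bool" where
  "spherical_type A m \<longleftrightarrow> finite A \<and> coxeter_matrix A m \<and>
     finite (carrier (pres_group A (coxeter_rels A m)))"

end

theory Submission
  imports Defs Complex_Main "HOL-Library.FuncSet"
begin

text \<open>Write \<open>g \<le> h\<close> if \<open>g\<inverse>h\<close> is positive. A word with \<open>p\<close> positive and \<open>q\<close> negative letters
  represents an element \<open>g\<close> with \<open>\<Delta>\<^sup>-\<^sup>q \<le> g \<le> \<Delta>\<^sup>p\<close>, and every such \<open>g\<close> has a word of length at most
  \<open>p + q\<close>. Hence a word is in \<open>ConjGeo\<close> iff no conjugate of \<open>g\<close> improves \<open>p > 0\<close> or \<open>q > 0\<close>; this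
  uses that an improvement of one exponent can always be made without loss in the other. The
  key point is that it can moreover be made with a conjugator that divides \<open>\<Delta>\<^sup>N\<close>, where \<open>N\<close> is
  the length of \<open>\<Delta>\<close>. For a given conjugator the improvement is a divisibility statement,
  decided by the right divisors of bounded length of a positive element that grows with the word,
  and these are computed by a finite automaton. If the letters are ordered by decreasing degree,
  then the shortlex least geodesics are the greedy normal forms, which an automaton recognises
  when it reads words from right to left.

  For an Artin group of spherical type, the finite Coxeter group \<open>W\<close> is a lattice in its weak
  order, and the complement operation of this lattice extends to an action of the Artin monoid
  on \<open>W\<close>, with a cocycle valued in the monoid. Cancellativity and the existence of least common
  multiples are read off from the cocycle; the lift of the longest element is a Garside element.\<close>

section \<open>Bounded conjugators in Garside groups\<close>

text \<open>Homogeneity enters through the additive degree \<open>lam\<close>: it makes the order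
  antisymmetric, provides minimal conjugators, and bounds the length of chains between
  \<open>x \<Delta>^-1\<close> and \<open>x\<close> by a number that does not depend on the element
  that is conjugated. One exponent can be improved without loss in the other because the positive
  conjugators that improve it are closed under meets and under a second operation; the least of them
  is therefore below its own image, and that inequality is the bound on the other exponent. On the
  Artin side, the relation for \<open>s\<close> and \<open>t\<close> shows only that the order of
  \<open>s t\<close> in \<open>W\<close> divides \<open>m s t\<close>. A linear representation shows
  that it is not smaller; the proofs that alternating words are reduced and that the join of two
  generators is the alternating word of length \<open>m s t\<close> rest on this.\<close>

locale garside_group = group G for G :: "'a monoid" (structure) +
  fixes P :: "'a set" and \<Delta> :: 'a and lam :: "'a \<Rightarrow> int"
  assumes P_sub: "P \<subseteq> carrier G"
    and P_one [simp]: "\<one> \<in> P"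
    and P_mult: "x \<in> P \<Longrightarrow> y \<in> P \<Longrightarrow> x \<otimes> y \<in> P"
    and D_P: "\<Delta> \<in> P"
    and D_conj: "x \<in> P \<Longrightarrow> inv \<Delta> \<otimes> x \<otimes> \<Delta> \<in> P" "x \<in> P \<Longrightarrow> \<Delta> \<otimes> x \<otimes> inv \<Delta> \<in> P"
    and lam_mult: "x \<in> carrier G \<Longrightarrow> y \<in> carrier G \<Longrightarrow> lam (x \<otimes> y) = lam x + lam y"
    and lam_pos: "x \<in> P \<Longrightarrow> x \<noteq> \<one> \<Longrightarrow> lam x > 0"
    and P_frac: "g \<in> carrier G \<Longrightarrow> \<exists>n::nat. g \<otimes> \<Delta> [^] n \<in> P"
    and P_join: "x \<in> P \<Longrightarrow> y \<in> P \<Longrightarrow> \<exists>z\<in>P. inv x \<otimes> z \<in> P \<and> inv y \<otimes> z \<in> P \<and>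
        (\<forall>u\<in>P. inv x \<otimes> u \<in> P \<and> inv y \<otimes> u \<in> P \<longrightarrow> inv z \<otimes> u \<in> P)"
    and P_meet: "x \<in> P \<Longrightarrow> y \<in> P \<Longrightarrow> \<exists>z\<in>P. inv z \<otimes> x \<in> P \<and> inv z \<otimes> y \<in> P \<and>
        (\<forall>u\<in>P. inv u \<otimes> x \<in> P \<and> inv u \<otimes> y \<in> P \<longrightarrow> inv u \<otimes> z \<in> P)"
    and P_rjoin: "x \<in> P \<Longrightarrow> y \<in> P \<Longrightarrow> \<exists>z\<in>P. z \<otimes> inv x \<in> P \<and> z \<otimes> inv y \<in> P \<and>
        (\<forall>u\<in>P. u \<otimes> inv x \<in> P \<and> u \<otimes> inv y \<in> P \<longrightarrow> u \<otimes> inv z \<in> P)"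
    and fin: "finite {s \<in> P. inv s \<otimes> \<Delta> \<in> P}"
begin

lemma P_carr [simp, intro]: "x \<in> P \<Longrightarrow> x \<in> carrier G"
  using P_sub by blast

lemma D_carr [simp, intro]: "\<Delta> \<in> carrier G"
  using D_P by simp

section \<open>Powers of \<open>\<Delta>\<close> and conjugation by them\<close>

definition dp :: "int \<Rightarrow> 'a" where "dp k = \<Delta> [^] k"

lemma dp_carr [simp, intro]: "dp k \<in> carrier G" by (simp add: dp_def)
lemma dp_0 [simp]: "dp 0 = \<one>" by (simp add: dp_def)
lemma dp_1: "dp 1 = \<Delta>" by (simp add: dp_def int_pow_1)
lemma dp_mult [simp]: "dp i \<otimes> dp j = dp (i + j)" by (simp add: dp_def int_pow_mult)
lemma dp_inv [simp]: "inv (dp i) = dp (- i)" by (simp add: dp_def int_pow_neg)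
lemma dp_mult_l [simp]: "x \<in> carrier G \<Longrightarrow> dp i \<otimes> (dp j \<otimes> x) = dp (i + j) \<otimes> x"
  by (simp add: m_assoc [symmetric])
lemma dp_nat: "\<Delta> [^] (n::nat) = dp (int n)" by (simp add: dp_def int_pow_int)

lemma inv_l [simp]: "x \<in> carrier G \<Longrightarrow> y \<in> carrier G \<Longrightarrow> inv x \<otimes> (x \<otimes> y) = y"
  by (simp add: m_assoc [symmetric])
lemma inv_r [simp]: "x \<in> carrier G \<Longrightarrow> y \<in> carrier G \<Longrightarrow> x \<otimes> (inv x \<otimes> y) = y"
  by (simp add: m_assoc [symmetric])

lemmas gsimps = m_assoc inv_mult_group

lemma lam_one [simp]: "lam \<one> = 0"
  using lam_mult [of \<one> \<one>] by simp

lemma lam_inv: "x \<in> carrier G \<Longrightarrow> lam (inv x) = - lam x"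
  using lam_mult [of x "inv x"] by simp

lemma lam_nonneg: "x \<in> P \<Longrightarrow> lam x \<ge> 0"
  using lam_pos [of x] by (cases "x = \<one>") auto

lemma P_antisym: "x \<in> P \<Longrightarrow> inv x \<in> P \<Longrightarrow> x = \<one>"
  using lam_pos [of x] lam_nonneg [of "inv x"] lam_inv [of x] by fastforce

lemma dp_conj1: "x \<in> P \<Longrightarrow> dp (int n) \<otimes> (x \<otimes> dp (- int n)) \<in> P"
proof (induction n)
  case (Suc n)
  have "dp 1 \<otimes> (dp (int n) \<otimes> (x \<otimes> dp (- int n))) \<otimes> dp (- 1) \<in> P"
    using D_conj(2) [OF Suc.IH [OF Suc.prems]] dp_inv [of 1] by (simp only: dp_1)
  moreover have "dp 1 \<otimes> (dp (int n) \<otimes> (x \<otimes> dp (- int n))) \<otimes> dp (- 1) =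
      dp (1 + int n) \<otimes> (x \<otimes> dp (- int n + - 1))"
    using Suc.prems by (simp only: m_assoc m_closed dp_carr dp_mult dp_mult_l P_carr)
  ultimately show ?case by (simp add: add.commute)
qed simp

lemma dp_conj2: "x \<in> P \<Longrightarrow> dp (- int n) \<otimes> (x \<otimes> dp (int n)) \<in> P"
proof (induction n)
  case (Suc n)
  have "dp (- 1) \<otimes> (dp (- int n) \<otimes> (x \<otimes> dp (int n))) \<otimes> dp 1 \<in> P"
    using D_conj(1) [OF Suc.IH [OF Suc.prems]] dp_inv [of 1] by (simp only: dp_1)
  moreover have "dp (- 1) \<otimes> (dp (- int n) \<otimes> (x \<otimes> dp (int n))) \<otimes> dp 1 =
      dp (- 1 + - int n) \<otimes> (x \<otimes> dp (int n + 1))"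
    using Suc.prems by (simp only: m_assoc m_closed dp_carr dp_mult dp_mult_l P_carr)
  ultimately show ?case by (simp add: add.commute)
qed simp

lemma dp_conj: "x \<in> P \<Longrightarrow> dp k \<otimes> (x \<otimes> dp (- k)) \<in> P"
  using dp_conj1 [of x "nat k"] dp_conj2 [of x "nat (- k)"] by (cases "k \<ge> 0") auto

text \<open>Conjugation by a power of \<open>\<Delta>\<close> preserves \<open>P\<close>, so such a
  power may change sides in a membership in \<open>P\<close>. Through this the left invariant order
  is also invariant under right multiplication by powers of \<open>\<Delta>\<close>.\<close>

lemma dp_swap:
  assumes [simp]: "z \<in> carrier G"
  shows "dp k \<otimes> z \<in> P \<longleftrightarrow> z \<otimes> dp k \<in> P"
proof
  assume "dp k \<otimes> z \<in> P"
  from dp_conj [OF this, of "- k"] show "z \<otimes> dp k \<in> P" by (simp add: gsimps)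
next
  assume "z \<otimes> dp k \<in> P"
  from dp_conj [OF this, of k] show "dp k \<otimes> z \<in> P" by (simp add: gsimps)
qed

lemma dp_P: "k \<ge> 0 \<Longrightarrow> dp k \<in> P"
proof -
  have "dp (int n) \<in> P" for n
  proof (induction n)
    case (Suc n)
    then show ?case using P_mult [OF D_P Suc] using dp_mult [of 1 "int n"] by (simp add: dp_1)
  qed simp
  moreover assume "k \<ge> 0"
  ultimately show ?thesis by (metis nonneg_int_cases)
qed

section \<open>The left invariant order and its lattice structure\<close>

definition le :: "'a \<Rightarrow> 'a \<Rightarrow> bool" where "le x y \<longleftrightarrow> inv x \<otimes> y \<in> P"

lemma le_refl [simp]: "x \<in> carrier G \<Longrightarrow> le x x"
  by (simp add: le_def)

lemma le_trans:
  assumes "le x y" "le y z" and [simp]: "x \<in> carrier G" "y \<in> carrier G" "z \<in> carrier G"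
  shows "le x z"
  using P_mult [of "inv x \<otimes> y" "inv y \<otimes> z"] assms(1,2) by (simp add: le_def gsimps)

lemma le_antisym:
  assumes "le x y" "le y x" and [simp]: "x \<in> carrier G" "y \<in> carrier G"
  shows "x = y"
proof -
  have "inv x \<otimes> y = \<one>"
    using P_antisym [of "inv x \<otimes> y"] assms(1,2) by (simp add: le_def gsimps)
  then show ?thesis by (metis assms(3,4) inv_r r_one)
qed

lemma le_left [simp]:
  "g \<in> carrier G \<Longrightarrow> x \<in> carrier G \<Longrightarrow> y \<in> carrier G \<Longrightarrow> le (g \<otimes> x) (g \<otimes> y) \<longleftrightarrow> le x y"
  by (simp add: le_def gsimps)

lemma le_dp [simp]:
  assumes [simp]: "x \<in> carrier G" "y \<in> carrier G"
  shows "le (x \<otimes> dp k) (y \<otimes> dp k) \<longleftrightarrow> le x y"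
  using dp_swap [of "inv x \<otimes> y \<otimes> dp k" "- k"] by (simp add: le_def gsimps)

lemma le_dp_shift:
  assumes [simp]: "x \<in> carrier G" "y \<in> carrier G"
  shows "le (x \<otimes> dp k) y \<longleftrightarrow> le x (y \<otimes> dp (- k))"
  using le_dp [of x "y \<otimes> dp (- k)" k] by (simp add: gsimps)

lemma le_one: "x \<in> carrier G \<Longrightarrow> le \<one> x \<longleftrightarrow> x \<in> P"
  by (simp add: le_def)

lemma le_mult: "x \<in> carrier G \<Longrightarrow> p \<in> P \<Longrightarrow> le x (x \<otimes> p)"
  by (simp add: le_def)

lemma lam_mono:
  assumes "le x y" and [simp]: "x \<in> carrier G" "y \<in> carrier G"
  shows "lam x \<le> lam y"
  using lam_nonneg [of "inv x \<otimes> y"] assms(1) by (simp add: le_def lam_mult lam_inv)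

lemma lam_mono_eq:
  assumes "le x y" "lam y \<le> lam x" and [simp]: "x \<in> carrier G" "y \<in> carrier G"
  shows "x = y"
proof -
  have "inv x \<otimes> y = \<one>"
    using lam_pos [of "inv x \<otimes> y"] assms(1,2) by (fastforce simp add: le_def lam_mult lam_inv)
  then show ?thesis by (metis assms(3,4) inv_r r_one)
qed

lemma dp_le: "i \<le> j \<Longrightarrow> le (dp i) (dp j)"
  using dp_P [of "j - i"] by (simp add: le_def)

lemma ge_dp:
  assumes [simp]: "g \<in> carrier G"
  shows "le (dp k) g \<longleftrightarrow> g \<otimes> dp (- k) \<in> P"
  by (simp add: le_def dp_swap)

lemma inv_le_dp:
  assumes [simp]: "g \<in> carrier G"
  shows "le (inv g) (dp k) \<longleftrightarrow> le (dp (- k)) g"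
  by (simp add: ge_dp) (simp add: le_def)

lemma dp_le_inv:
  assumes [simp]: "g \<in> carrier G"
  shows "le (dp k) (inv g) \<longleftrightarrow> le g (dp (- k))"
  using inv_le_dp [of "inv g" "- k"] by simp

lemma ex_dp_lower:
  assumes "g \<in> carrier G"
  shows "\<exists>n::nat. g \<otimes> dp (int n) \<in> P"
  using P_frac [OF assms] by (simp add: dp_nat)

lemma ex_common_shift:
  assumes [simp]: "x \<in> carrier G" "y \<in> carrier G"
  obtains k where "x \<otimes> dp k \<in> P" "y \<otimes> dp k \<in> P"
proof -
  obtain m n where "x \<otimes> dp (int m) \<in> P" "y \<otimes> dp (int n) \<in> P"
    using ex_dp_lower assms by meson
  then have "x \<otimes> dp (int m) \<otimes> dp (int n) \<in> P" "y \<otimes> dp (int n) \<otimes> dp (int m) \<in> P"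
    using P_mult dp_P by simp_all
  then show thesis by (intro that [of "int m + int n"]) (simp_all add: gsimps add.commute)
qed

text \<open>Right multiplication by a power of \<open>\<Delta>\<close> is an automorphism of the
  order, so both elements can be shifted into \<open>P\<close>, where \<open>P_join\<close> applies,
  and the join can be shifted back.\<close>

lemma ex_join:
  assumes [simp]: "x \<in> carrier G" "y \<in> carrier G"
  shows "\<exists>z\<in>carrier G. le x z \<and> le y z \<and> (\<forall>u\<in>carrier G. le x u \<and> le y u \<longrightarrow> le z u)"
proof -
  obtain k where k: "x \<otimes> dp k \<in> P" "y \<otimes> dp k \<in> P" by (rule ex_common_shift [OF assms])
  from P_join [OF this] obtain z where z: "z \<in> P" "le (x \<otimes> dp k) z" "le (y \<otimes> dp k) z"
    "\<And>u. u \<in> P \<Longrightarrow> le (x \<otimes> dp k) u \<Longrightarrow> le (y \<otimes> dp k) u \<Longrightarrow> le z u"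
    by (auto simp: le_def)
  have [simp]: "z \<in> carrier G" using z by simp
  show ?thesis
  proof (intro bexI [of _ "z \<otimes> dp (- k)"] conjI ballI impI)
    show "le x (z \<otimes> dp (- k))" "le y (z \<otimes> dp (- k))" using z(2,3) by (simp_all add: le_dp_shift)
    fix u assume u [simp]: "u \<in> carrier G" and le: "le x u \<and> le y u"
    have "le (x \<otimes> dp k) (u \<otimes> dp k)" "le (y \<otimes> dp k) (u \<otimes> dp k)" using le by simp_all
    moreover have "u \<otimes> dp k \<in> P"
      using le_trans [of \<one> "x \<otimes> dp k" "u \<otimes> dp k"] calculation k by (simp add: le_one)
    ultimately have "le z (u \<otimes> dp k)" using z(4) by blast
    then show "le (z \<otimes> dp (- k)) u" by (simp add: le_dp_shift)
  qed simp
qed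

lemma ex_meet:
  assumes [simp]: "x \<in> carrier G" "y \<in> carrier G"
  shows "\<exists>z\<in>carrier G. le z x \<and> le z y \<and> (\<forall>u\<in>carrier G. le u x \<and> le u y \<longrightarrow> le u z)"
proof -
  obtain k where k: "x \<otimes> dp k \<in> P" "y \<otimes> dp k \<in> P" by (rule ex_common_shift [OF assms])
  from P_meet [OF this] obtain z where z: "z \<in> P" "le z (x \<otimes> dp k)" "le z (y \<otimes> dp k)"
    "\<And>u. u \<in> P \<Longrightarrow> le u (x \<otimes> dp k) \<Longrightarrow> le u (y \<otimes> dp k) \<Longrightarrow> le u z"
    by (auto simp: le_def)
  have [simp]: "z \<in> carrier G" using z by simp
  show ?thesis
  proof (intro bexI [of _ "z \<otimes> dp (- k)"] conjI ballI impI)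
    show "le (z \<otimes> dp (- k)) x" "le (z \<otimes> dp (- k)) y" using z(2,3) by (simp_all add: le_dp_shift)
    fix u assume u [simp]: "u \<in> carrier G" and le: "le u x \<and> le u y"
    have 1: "le (u \<otimes> dp k) (x \<otimes> dp k)" "le (u \<otimes> dp k) (y \<otimes> dp k)" using le by simp_all
    \<comment> \<open>\<open>P_meet\<close> speaks only of positive lower bounds. The join of
      \<open>u \<Delta>^k\<close> with \<open>\<one>\<close> is one: it stays below the two shifted
      elements because these are positive.\<close>
    obtain j where j: "j \<in> carrier G" "le (u \<otimes> dp k) j" "le \<one> j"
        "\<And>v. v \<in> carrier G \<Longrightarrow> le (u \<otimes> dp k) v \<Longrightarrow> le \<one> v \<Longrightarrow> le j v"
      using ex_join [of "u \<otimes> dp k" \<one>] by auto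
    have "le j (x \<otimes> dp k)" "le j (y \<otimes> dp k)" using j(4) 1 k by (simp_all add: le_one)
    then have "le j z" using z(4) j by (simp add: le_one)
    then have "le (u \<otimes> dp k) z" using le_trans [of "u \<otimes> dp k" j z] j by simp
    then show "le u (z \<otimes> dp (- k))" by (simp add: le_dp_shift)
  qed simp
qed

definition meet :: "'a \<Rightarrow> 'a \<Rightarrow> 'a" where
  "meet x y = (SOME z. z \<in> carrier G \<and> le z x \<and> le z y \<and> (\<forall>u\<in>carrier G. le u x \<and> le u y \<longrightarrow> le u z))"

definition join :: "'a \<Rightarrow> 'a \<Rightarrow> 'a" where
  "join x y = (SOME z. z \<in> carrier G \<and> le x z \<and> le y z \<and> (\<forall>u\<in>carrier G. le x u \<and> le y u \<longrightarrow> le z u))"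

context
  fixes x y assumes xy: "x \<in> carrier G" "y \<in> carrier G"
begin

lemma meet_props:
  shows meet_carr [simp, intro]: "meet x y \<in> carrier G" and meet_le1: "le (meet x y) x"
    and meet_le2: "le (meet x y) y"
    and meet_greatest: "u \<in> carrier G \<Longrightarrow> le u x \<Longrightarrow> le u y \<Longrightarrow> le u (meet x y)"
  using someI_ex [OF ex_meet [OF xy, unfolded Bex_def]] unfolding meet_def by blast+

lemma join_props:
  shows join_carr [simp, intro]: "join x y \<in> carrier G" and join_ge1: "le x (join x y)"
    and join_ge2: "le y (join x y)"
    and join_least: "u \<in> carrier G \<Longrightarrow> le x u \<Longrightarrow> le y u \<Longrightarrow> le (join x y) u"
  using someI_ex [OF ex_join [OF xy, unfolded Bex_def]] unfolding join_def by blast+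

end

text \<open>If \<open>m\<^sub>i = (x \<sqinter> \<Delta>\<^sup>i) \<squnion> x\<Delta>\<inverse>\<close> equals \<open>m\<^sub>i\<^sub>+\<^sub>1\<close>, then \<open>m\<^sub>i\<close> has the closure property
  for which \<open>x\<close> is minimal, so \<open>m\<^sub>i = x\<close>; since all \<open>m\<^sub>i\<close> lie between \<open>x\<Delta>\<inverse>\<close> and \<open>x\<close>, this
  happens for some \<open>i \<le> lam \<Delta>\<close>, whatever \<open>g\<close> is.\<close>

lemma bounded_conjugator:
  assumes [simp]: "g \<in> carrier G" and gr: "le (dp r) g" and gp: "le g (dp p)"
    and k [simp]: "k \<in> carrier G" and conj: "le (dp (r + 1)) (inv k \<otimes> g \<otimes> k)"
  shows "\<exists>x\<in>P. le x (dp (lam \<Delta>)) \<and> le (dp (r + 1)) (inv x \<otimes> g \<otimes> x) \<and> le (inv x \<otimes> g \<otimes> x) (dp p)"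
proof -
  \<comment> \<open>\<open>T\<close> turns the wanted inequality
    \<open>\<Delta>^(r+1) \<le> x^-1 g x\<close> into \<open>T x \<le> x\<close>. It is an
    automorphism of the order that commutes with right multiplication by powers of
    \<open>\<Delta>\<close>.\<close>
  define T where "T x = inv g \<otimes> x \<otimes> dp (r + 1)" for x
  have T_carr [simp]: "T x \<in> carrier G" if "x \<in> carrier G" for x using that by (simp add: T_def)
  have T_iff: "le (dp (r + 1)) (inv x \<otimes> g \<otimes> x) \<longleftrightarrow> le (T x) x" if [simp]: "x \<in> carrier G" for x
  proof -
    have "le (dp (r + 1)) (inv x \<otimes> g \<otimes> x) \<longleftrightarrow> dp (- (r + 1)) \<otimes> (inv x \<otimes> g \<otimes> x) \<in> P"
      by (simp add: le_def)
    also have "dp (- (r + 1)) \<otimes> (inv x \<otimes> g \<otimes> x) = inv (T x) \<otimes> x"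
      unfolding T_def by (simp add: gsimps)
    finally show ?thesis by (simp only: le_def)
  qed
  have T_mono: "le (T x) (T y) \<longleftrightarrow> le x y" if [simp]: "x \<in> carrier G" "y \<in> carrier G" for x y
    by (simp add: T_def)
  have T_dp: "T (x \<otimes> dp i) = T x \<otimes> dp i" if [simp]: "x \<in> carrier G" for x i
    by (simp add: T_def gsimps add.commute)
  define C where "C = {x \<in> P. le (T x) x}"
  have "\<exists>x. x \<in> C"
  proof -
    obtain n where n: "k \<otimes> dp (int n) \<in> P" using ex_dp_lower [OF k] by blast
    have "le (T k) k" using conj T_iff by simp
    then show ?thesis using n by (intro exI [of _ "k \<otimes> dp (int n)"]) (simp add: C_def T_dp)
  qed
  then obtain x where x: "x \<in> C" and min: "\<And>y. y \<in> C \<Longrightarrow> nat (lam x) \<le> nat (lam y)"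
    using ex_has_least_nat [of "\<lambda>x. x \<in> C" _ "\<lambda>x. nat (lam x)"] by metis
  have [simp]: "x \<in> P" "le (T x) x" using x by (auto simp: C_def)
  have xc [simp]: "x \<in> carrier G" by simp
  have eqI: "y = x" if "y \<in> C" "le y x" for y
  proof -
    have y: "y \<in> P" using that by (simp add: C_def)
    have "lam x \<le> lam y" using min [OF that(1)] lam_nonneg [OF y] by linarith
    then show ?thesis using lam_mono_eq [OF that(2)] y xc by blast
  qed
  have least: "le x y" if y: "y \<in> C" for y
  proof -
    have [simp]: "y \<in> P" "le (T y) y" using y by (auto simp: C_def)
    have yc [simp]: "y \<in> carrier G" by simp
    let ?z = "meet x y"
    have "le (T ?z) x" using le_trans [of "T ?z" "T x" x] by (simp add: T_mono meet_le1)
    moreover have "le (T ?z) y" using le_trans [of "T ?z" "T y" y] by (simp add: T_mono meet_le2)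
    ultimately have "le (T ?z) ?z" by (simp add: meet_greatest)
    moreover have "?z \<in> P" using meet_greatest [of x y \<one>] by (simp add: le_one)
    ultimately have "?z = x" using eqI [of ?z] by (simp add: C_def meet_le1)
    then show ?thesis using meet_le2 [of x y] by simp
  qed
  \<comment> \<open>The operation \<open>x \<mapsto> g^-1 x \<Delta>^p\<close> maps \<open>C\<close>
    to itself: it commutes with \<open>T\<close>, and \<open>g \<le> \<Delta>^p\<close> keeps the
    result positive. That the least \<open>x\<close> lies below its image says exactly that
    \<open>x^-1 g x \<le> \<Delta>^p\<close>.\<close>
  have "inv g \<otimes> x \<otimes> dp p \<in> C"
  proof -
    have eq: "T (inv g \<otimes> x \<otimes> dp p) = inv g \<otimes> T x \<otimes> dp p"
      by (simp add: T_def gsimps add.commute)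
    have "inv g \<otimes> dp p \<in> P" using gp by (simp add: le_def)
    moreover have "le (inv g \<otimes> dp p) (inv g \<otimes> x \<otimes> dp p)"
      using le_dp [of "inv g" "inv g \<otimes> x" p] by (simp add: le_mult)
    ultimately have "inv g \<otimes> x \<otimes> dp p \<in> P"
      using le_trans [of \<one> "inv g \<otimes> dp p" "inv g \<otimes> x \<otimes> dp p"] by (simp add: le_one)
    then show ?thesis unfolding C_def mem_Collect_eq eq by (simp only: le_dp T_carr le_left m_closed inv_closed assms(1) xc) simp
  qed
  then have "le x (inv g \<otimes> x \<otimes> dp p)" by (rule least)
  then have xp: "le (inv x \<otimes> g \<otimes> x) (dp p)" by (simp add: le_def gsimps)
  define N where "N = nat (lam \<Delta>)"
  have Nl: "int N = lam \<Delta>" using lam_nonneg [OF D_P] by (simp add: N_def)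
  define m where "m i = join (meet x (dp (int i))) (x \<otimes> dp (- 1))" for i
  have m_carr [simp]: "m i \<in> carrier G" for i by (simp add: m_def)
  have x1: "le (x \<otimes> dp (- 1)) x" using dp_P [of 1] by (simp add: le_def gsimps)
  have mx: "le (m i) x" for i
    using x1 by (simp add: m_def join_least meet_le1)
  have m_ge: "le (x \<otimes> dp (- 1)) (m i)" for i
    by (simp add: m_def join_ge2)
  have m_mono: "le (m i) (m (Suc i))" for i
  proof -
    have "le (meet x (dp (int i))) (dp (int (Suc i)))"
      using le_trans [OF meet_le2 [of x "dp (int i)"] dp_le [of "int i" "int (Suc i)"]] by simp
    then have "le (meet x (dp (int i))) (meet x (dp (int (Suc i))))"
      by (simp add: meet_greatest meet_le1)
    then have "le (meet x (dp (int i))) (m (Suc i))"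
      using le_trans [OF _ join_ge1, of "meet x (dp (int i))" "meet x (dp (int (Suc i)))"] by (simp add: m_def)
    then show ?thesis unfolding m_def [of i] using m_ge [of "Suc i"] by (simp add: join_least)
  qed
  \<comment> \<open>The hypothesis \<open>\<Delta>^r \<le> g\<close> in the form needed here:
    \<open>T\<close> carries \<open>\<Delta>^i\<close> below \<open>\<Delta>^(i+1)\<close>. This
    single step up is why \<open>T (m i)\<close> is bounded by \<open>m (Suc i)\<close> and not by
    \<open>m i\<close>.\<close>
  have T1: "le (T \<one>) (dp 1)"
    using gr dp_swap [of "g \<otimes> dp 1" "- r - 1"] by (simp add: ge_dp) (simp add: T_def le_def gsimps)
  have Tdp: "le (T (dp i)) (dp (i + 1))" for i
    using T1 le_dp [of "T \<one>" "dp 1" i] T_dp [of \<one> i] by (simp add: add.commute)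
  have Tm: "le (T (m i)) (m (Suc i))" for i
  proof -
    let ?a = "meet x (dp (int i))"
    have "le (T ?a) x" using le_trans [of "T ?a" "T x" x] by (simp add: T_mono meet_le1)
    moreover have "le (T ?a) (dp (int (Suc i)))"
      using le_trans [of "T ?a" "T (dp (int i))" "dp (int i + 1)"] Tdp [of "int i"]
      by (simp add: T_mono meet_le2 add.commute)
    ultimately have "le (T ?a) (meet x (dp (int (Suc i))))" by (simp add: meet_greatest)
    then have 1: "le (T ?a) (m (Suc i))"
      using le_trans [OF _ join_ge1, of "T ?a" "meet x (dp (int (Suc i)))"] by (simp add: m_def)
    have "le (T (x \<otimes> dp (- 1))) (x \<otimes> dp (- 1))" by (simp add: T_dp)
    then have 2: "le (T (x \<otimes> dp (- 1))) (m (Suc i))"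
      using le_trans [OF _ m_ge] by simp
    \<comment> \<open>The preimage of \<open>m (Suc i)\<close> under \<open>T\<close>. Bounding the
      two parts of the join \<open>m i\<close> by \<open>?u\<close> avoids computing
      \<open>T\<close> of a join.\<close>
    let ?u = "g \<otimes> m (Suc i) \<otimes> dp (- r - 1)"
    have Tu: "T ?u = m (Suc i)" by (simp add: T_def gsimps)
    have "le ?a ?u" "le (x \<otimes> dp (- 1)) ?u"
      using 1 2 T_mono [of ?a ?u] T_mono [of "x \<otimes> dp (- 1)" ?u] by (simp_all add: Tu)
    then have "le (m i) ?u" by (simp add: m_def [of i] join_least)
    then show ?thesis using T_mono [of "m i" ?u] by (simp add: Tu)
  qed
  \<comment> \<open>Otherwise the degrees of \<open>m 0\<close>, ..., \<open>m (Suc N)\<close> would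
    rise \<open>N + 1\<close> times, although all these elements lie between
    \<open>x \<Delta>^-1\<close> and \<open>x\<close>, whose degrees differ by
    \<open>lam \<Delta> = N\<close>.\<close>
  have "\<exists>i\<le>N. m (Suc i) = m i"
  proof (rule ccontr)
    assume neg: "\<not> ?thesis"
    have "lam (m i) \<ge> lam (m 0) + int i" if "i \<le> Suc N" for i using that
    proof (induction i)
      case (Suc i)
      then have "m (Suc i) \<noteq> m i" using neg by auto
      then have "lam (m (Suc i)) > lam (m i)"
        using lam_mono_eq [OF m_mono [of i]] by force
      then show ?case using Suc by auto
    qed simp
    from this [of "Suc N"] have "lam (m (Suc N)) \<ge> lam (m 0) + lam \<Delta> + 1" by (simp add: Nl)
    moreover have "lam (m (Suc N)) \<le> lam x" using lam_mono [OF mx] by simp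
    moreover have "lam (x \<otimes> dp (- 1)) \<le> lam (m 0)" using lam_mono [OF m_ge] by simp
    moreover have "lam (x \<otimes> dp (- 1)) = lam x - lam \<Delta>"
      using dp_inv [of 1] lam_inv [of "dp 1"] by (simp add: lam_mult dp_1)
    ultimately show False by linarith
  qed
  then obtain i where i: "i \<le> N" "m (Suc i) = m i" by blast
  have "le \<one> (meet x (dp (int i)))" using dp_P [of "int i"] by (simp add: meet_greatest le_one)
  then have "le \<one> (m i)" using le_trans [OF _ join_ge1, of \<one> "meet x (dp (int i))"] by (simp add: m_def)
  then have "m i \<in> C" using Tm [of i] i(2) by (simp add: C_def le_one)
  then have mi: "m i = x" by (rule eqI) (rule mx)
  obtain n0 where n0: "inv x \<otimes> dp (int n0) \<in> P" using ex_dp_lower [of "inv x"] by auto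
  \<comment> \<open>Since \<open>x = m i\<close> is a join, it suffices to bound its parts: one is
    below \<open>\<Delta>^i\<close>, and \<open>x \<Delta>^-1 \<le> \<Delta>^n\<close> follows from
    \<open>x \<le> \<Delta>^(n+1)\<close>. Starting from any power above \<open>x\<close>, this
    descends to \<open>\<Delta>^i\<close>.\<close>
  have down: "le x (dp (int n))" if "n \<ge> i" "le x (dp (int (Suc n)))" for n
  proof -
    have "le (meet x (dp (int i))) (dp (int n))"
      using le_trans [OF meet_le2 [of x "dp (int i)"] dp_le [of "int i" "int n"]] that by simp
    moreover have "le (x \<otimes> dp (- 1)) (dp (int n))"
      using that(2) by (simp add: le_dp_shift add.commute)
    ultimately have "le (m i) (dp (int n))" by (simp add: m_def join_least)
    then show ?thesis by (simp add: mi)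
  qed
  have top: "le x (dp (int (i + n0)))"
    using le_trans [OF _ dp_le, of x "int n0" "int (i + n0)"] n0 by (simp add: le_def)
  have "le x (dp (int (i + n)))" if "n \<le> n0" for n
    using that top
  proof (induction rule: inc_induct)
    case (step k)
    then show ?case using down [of "i + k"] by simp
  qed
  from this [of 0] have "le x (dp (int i))" by simp
  then have "le x (dp (lam \<Delta>))" using le_trans [OF _ dp_le, of x "int i" "lam \<Delta>"] i(1) Nl by simp
  moreover have "le (dp (r + 1)) (inv x \<otimes> g \<otimes> x)" by (simp add: T_iff)
  ultimately show ?thesis using xp \<open>x \<in> P\<close> by blast
qed

end

section \<open>Regular languages\<close>

text \<open>A function on words whose value at \<open>w @ [x]\<close> is computed from its value at
  \<open>w\<close> is an automaton. The values actually taken become the states, which makes them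
  closed under \<open>st\<close>; an injection into the natural numbers supplies the
  numbering.\<close>

lemma regular_languageI:
  assumes X: "finite X" and fin: "finite Q" and Q: "\<And>w. w \<in> lists X \<Longrightarrow> f w \<in> Q"
    and step: "\<And>w x. w \<in> lists X \<Longrightarrow> x \<in> X \<Longrightarrow> f (w @ [x]) = st (f w) x"
    and L: "L = {w \<in> lists X. f w \<in> F}"
  shows "regular_language X L"
proof -
  define R where "R = f ` lists X"
  have finR: "finite R" using fin Q by (auto simp: R_def intro: finite_subset)
  obtain h :: "'b \<Rightarrow> nat" where h: "inj_on h R"
    using finR finite_imp_inj_to_nat_seg by metis
  define \<delta> where "\<delta> n x = h (st (inv_into R h n) x)" for n x
  have fold: "foldl \<delta> (h (f [])) w = h (f w)" if "w \<in> lists X" for w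
    using that
  proof (induction w rule: rev_induct)
    case (snoc x w)
    then have w: "w \<in> lists X" "x \<in> X" by auto
    have "inv_into R h (h (f w)) = f w" using h w by (simp add: R_def)
    then show ?case using snoc w step by (simp add: \<delta>_def)
  qed simp
  show ?thesis unfolding regular_language_def
  proof (intro conjI exI)
    show "finite (h ` R)" using finR by simp
    show "h (f []) \<in> h ` R" by (auto simp: R_def)
    show "\<forall>q\<in>h ` R. \<forall>x\<in>X. \<delta> q x \<in> h ` R"
    proof (intro ballI)
      fix q x assume "q \<in> h ` R" "x \<in> X"
      then obtain w where "w \<in> lists X" "q = h (f w)" by (auto simp: R_def)
      then have "\<delta> q x = h (f (w @ [x]))" "w @ [x] \<in> lists X"
        using h \<open>x \<in> X\<close> step by (auto simp: \<delta>_def R_def)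
      then show "\<delta> q x \<in> h ` R" unfolding R_def by blast
    qed
    show "h ` (R \<inter> F) \<subseteq> h ` R" by auto
    show "L = {w \<in> lists X. foldl \<delta> (h (f [])) w \<in> h ` (R \<inter> F)}"
      unfolding L
    proof (intro Collect_cong conj_cong refl)
      fix w assume w: "w \<in> lists X"
      show "f w \<in> F \<longleftrightarrow> foldl \<delta> (h (f [])) w \<in> h ` (R \<inter> F)"
        unfolding fold [OF w] using inj_on_image_mem_iff [OF h, of "f w" "R \<inter> F"] w by (simp add: R_def)
    qed simp
  qed fact
qed

text \<open>Here the state is determined from right to left. The automaton, which reads from left to
  right, keeps as its state the whole function that the letters read so far induce on the finite set
  of values; this function is applied to \<open>f []\<close> at the end.\<close>

lemma regular_language_consI:
  assumes X: "finite X" and fin: "finite Q" and Q: "\<And>w. w \<in> lists X \<Longrightarrow> f w \<in> Q"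
    and step: "\<And>w x. w \<in> lists X \<Longrightarrow> x \<in> X \<Longrightarrow> f (x # w) = st x (f w)"
    and L: "L = {w \<in> lists X. f w \<in> F}"
  shows "regular_language X L"
proof -
  define R where "R = f ` lists X"
  have finR: "finite R" using fin Q by (auto simp: R_def intro: finite_subset)
  have st: "st x q \<in> R" if "x \<in> X" "q \<in> R" for x q
  proof -
    obtain w where w: "w \<in> lists X" "q = f w" using \<open>q \<in> R\<close> unfolding R_def by blast
    have "st x q = f (x # w)" unfolding w(2) by (rule step [OF w(1) that(1), symmetric])
    moreover have "x # w \<in> lists X" using w(1) that(1) by simp
    ultimately show ?thesis unfolding R_def by blast
  qed
  have foldr: "foldr st w q \<in> R" if "w \<in> lists X" "q \<in> R" for w q
    using that by (induction w) (auto intro: st)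
  have f: "f w = foldr st w (f [])" if "w \<in> lists X" for w
    using that by (induction w) (simp_all add: step)
  have nil: "f [] \<in> R" by (auto simp: R_def)
  show ?thesis
  proof (rule regular_languageI [where f = "\<lambda>w. restrict (foldr st w) R" and Q = "R \<rightarrow>\<^sub>E R"
        and st = "\<lambda>t x. restrict (\<lambda>q. t (st x q)) R" and F = "{t. t (f []) \<in> F}"])
    show "finite X" by fact
    show "finite (R \<rightarrow>\<^sub>E R)" using finR by (simp add: finite_PiE)
    show "restrict (foldr st w) R \<in> R \<rightarrow>\<^sub>E R" if "w \<in> lists X" for w
      using that foldr by auto
    show "restrict (foldr st (w @ [x])) R = restrict (\<lambda>q. restrict (foldr st w) R (st x q)) R"
      if "w \<in> lists X" "x \<in> X" for w x
      using that st by auto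
    show "L = {w \<in> lists X. restrict (foldr st w) R \<in> {t. t (f []) \<in> F}}"
      unfolding L
    proof (intro Collect_cong conj_cong refl)
      fix w assume "w \<in> lists X"
      then show "f w \<in> F \<longleftrightarrow> restrict (foldr st w) R \<in> {t. t (f []) \<in> F}"
        using f [of w] nil by simp
    qed simp
  qed
qed

lemma regular_languageE:
  assumes "regular_language X L"
  obtains Q q0 \<delta> F where "finite X" "finite Q" "q0 \<in> (Q :: nat set)" "\<forall>q\<in>Q. \<forall>x\<in>X. \<delta> q x \<in> Q"
      "L = {w \<in> lists X. foldl \<delta> q0 w \<in> F}"
  using assms unfolding regular_language_def by (elim conjE exE) (rule that)

lemma regular_language_Int:
  assumes "regular_language X L" "regular_language X L'"
  shows "regular_language X (L \<inter> L')"
proof -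
  obtain Q :: "nat set" and q0 \<delta> F where 1: "finite X" "finite Q" "q0 \<in> Q" "\<forall>q\<in>Q. \<forall>x\<in>X. \<delta> q x \<in> Q"
      "L = {w \<in> lists X. foldl \<delta> q0 w \<in> F}"
    using assms(1) by (rule regular_languageE) (rule that)
  obtain Q' :: "nat set" and q0' \<delta>' F' where 2: "finite Q'" "q0' \<in> Q'" "\<forall>q\<in>Q'. \<forall>x\<in>X. \<delta>' q x \<in> Q'"
      "L' = {w \<in> lists X. foldl \<delta>' q0' w \<in> F'}"
    using assms(2) by (rule regular_languageE) (rule that)
  have fold: "foldl \<delta> q0 w \<in> Q" if "w \<in> lists X" for w
    using that by (induction w rule: rev_induct) (use 1(3,4) in auto)
  have fold': "foldl \<delta>' q0' w \<in> Q'" if "w \<in> lists X" for w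
    using that by (induction w rule: rev_induct) (use 2(2,3) in auto)
  show ?thesis
  proof (rule regular_languageI [where f = "\<lambda>w. (foldl \<delta> q0 w, foldl \<delta>' q0' w)" and Q = "Q \<times> Q'"
        and st = "\<lambda>(q, q') x. (\<delta> q x, \<delta>' q' x)" and F = "F \<times> F'"])
    show "L \<inter> L' = {w \<in> lists X. (foldl \<delta> q0 w, foldl \<delta>' q0' w) \<in> F \<times> F'}"
      unfolding 1(5) 2(4) by auto
  qed (simp_all add: 1(1,2) 2(1) fold fold')
qed

text \<open>Formal inversion of words is a map of this kind; it exchanges positive and negative
  letters and so reduces upper exponents to lower ones.\<close>

lemma regular_language_rev_map:
  assumes "regular_language X L" and j: "\<And>x. x \<in> X \<Longrightarrow> j x \<in> X"
  shows "regular_language X {w \<in> lists X. rev (map j w) \<in> L}"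
proof -
  obtain Q :: "nat set" and q0 \<delta> F where 1: "finite X" "finite Q" "q0 \<in> Q" "\<forall>q\<in>Q. \<forall>x\<in>X. \<delta> q x \<in> Q"
      "L = {w \<in> lists X. foldl \<delta> q0 w \<in> F}"
    using assms(1) by (rule regular_languageE) (rule that)
  have fold: "foldl \<delta> q0 w \<in> Q" if "w \<in> lists X" for w
    using that by (induction w rule: rev_induct) (use 1(3,4) in auto)
  have rm: "rev (map j w) \<in> lists X" if "w \<in> lists X" for w
    using that j by (induction w) auto
  show ?thesis
  proof (rule regular_language_consI [where f = "\<lambda>w. foldl \<delta> q0 (rev (map j w))" and Q = Q
        and st = "\<lambda>x q. \<delta> q (j x)" and F = F])
    show "{w \<in> lists X. rev (map j w) \<in> L} = {w \<in> lists X. foldl \<delta> q0 (rev (map j w)) \<in> F}"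
      unfolding 1(5) using rm by blast
    show "foldl \<delta> q0 (rev (map j w)) \<in> Q" if "w \<in> lists X" for w
      using fold rm that by blast
  qed (simp_all add: 1(1,2))
qed

section \<open>Conjugacy languages of Garside groups\<close>

lemma word_prod_Nil [simp]: "word_prod M [] = \<one>\<^bsub>M\<^esub>"
  by (simp add: word_prod_def)

lemma word_prod_Cons [simp]: "word_prod M (x # w) = x \<otimes>\<^bsub>M\<^esub> word_prod M w"
  by (simp add: word_prod_def)

context
  fixes G :: "'a monoid" (structure)
  assumes G: "monoid G"
begin

interpretation monoid G by (rule G)

lemma word_prod_carr: "w \<in> lists (carrier G) \<Longrightarrow> word_prod G w \<in> carrier G"
  by (induction w) auto

lemma word_prod_append:
  "u \<in> lists (carrier G) \<Longrightarrow> v \<in> lists (carrier G) \<Longrightarrow> word_prod G (u @ v) = word_prod G u \<otimes> word_prod G v"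
  by (induction u) (auto simp: m_assoc word_prod_carr in_listsI)

end

context garside_group
begin

lemmas word_prod_closed [simp, intro] = word_prod_carr [OF monoid_axioms]

definition S :: "'a set" where "S = {s \<in> P. s \<noteq> \<one> \<and> inv s \<otimes> \<Delta> \<in> P}"

definition X :: "'a set" where "X = S \<union> m_inv G ` S"

lemma P_inv_iff: "x \<in> P \<Longrightarrow> inv x \<in> P \<longleftrightarrow> x = \<one>"
  using P_antisym by auto

lemma X_carr [simp, intro]: "x \<in> X \<Longrightarrow> x \<in> carrier G"
  by (auto simp: X_def S_def)

lemma listsX_carr [simp, intro]: "w \<in> lists X \<Longrightarrow> w \<in> lists (carrier G)"
  by auto

lemma finite_X [simp]: "finite X"
proof -
  have "finite S" using fin by (rule finite_subset [rotated]) (auto simp: S_def)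
  then show ?thesis by (simp add: X_def)
qed

lemma X_not_one: "x \<in> X \<Longrightarrow> x \<noteq> \<one>"
  by (auto simp: X_def S_def) (metis P_carr inv_inv inv_one)

lemma X_P_iff: "x \<in> carrier G \<Longrightarrow> x \<in> X \<and> x \<in> P \<longleftrightarrow> x \<noteq> \<one> \<and> le \<one> x \<and> le x (dp 1)"
  by (auto simp: X_def S_def le_def dp_1 P_inv_iff)

lemma X_notP_iff:
  assumes [simp]: "x \<in> carrier G"
  shows "x \<in> X \<and> x \<notin> P \<longleftrightarrow> x \<noteq> \<one> \<and> le (dp (- 1)) x \<and> le x \<one>"
proof -
  have "x \<in> X \<and> x \<notin> P \<longleftrightarrow> inv x \<in> S"
    using P_inv_iff [of "inv x"] by (force simp: X_def S_def P_inv_iff)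
  also have "\<dots> \<longleftrightarrow> inv x \<noteq> \<one> \<and> inv x \<in> P \<and> x \<otimes> dp 1 \<in> P"
    by (auto simp: S_def dp_1)
  also have "\<dots> \<longleftrightarrow> x \<noteq> \<one> \<and> le (dp (- 1)) x \<and> le x \<one>"
    by (auto simp: ge_dp) (auto simp: le_def)
  finally show ?thesis .
qed

lemma inv_X: "x \<in> X \<Longrightarrow> inv x \<in> X"
  by (auto simp: X_def S_def image_iff)

lemma inv_X_P: "x \<in> X \<Longrightarrow> inv x \<in> P \<longleftrightarrow> x \<notin> P"
  using X_not_one [of x] by (auto simp: X_def S_def P_inv_iff)

section \<open>Words over \<open>X\<close> and the exponents of \<open>\<Delta>\<close> that bound
  them\<close>

definition pc :: "'a list \<Rightarrow> nat" where "pc w = length (filter (\<lambda>x. x \<in> P) w)"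
definition nc :: "'a list \<Rightarrow> nat" where "nc w = length (filter (\<lambda>x. x \<notin> P) w)"

lemma pc_nc_simps [simp]:
  "pc [] = 0" "nc [] = 0"
  "pc (x # w) = (if x \<in> P then Suc (pc w) else pc w)"
  "nc (x # w) = (if x \<in> P then nc w else Suc (nc w))"
  "pc (v @ w) = pc v + pc w" "nc (v @ w) = nc v + nc w"
  by (simp_all add: pc_def nc_def)

lemma pc_add_nc: "pc w + nc w = length w"
  by (induction w) auto

lemma le_mult_dp:
  assumes "le (dp i) x" "le x (dp j)" "le (dp k) g" "le g (dp l)"
    and [simp]: "x \<in> carrier G" "g \<in> carrier G"
  shows "le (dp (i + k)) (x \<otimes> g)" "le (x \<otimes> g) (dp (j + l))"
proof -
  have "le (dp i \<otimes> dp k) (x \<otimes> dp k)" "le (x \<otimes> dp k) (x \<otimes> g)"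
    using assms by (simp_all del: dp_mult)
  then show "le (dp (i + k)) (x \<otimes> g)" using le_trans [of "dp i \<otimes> dp k" "x \<otimes> dp k" "x \<otimes> g"] by simp
  have "le (x \<otimes> g) (x \<otimes> dp l)" "le (x \<otimes> dp l) (dp j \<otimes> dp l)"
    using assms by (simp_all del: dp_mult)
  then show "le (x \<otimes> g) (dp (j + l))" using le_trans [of "x \<otimes> g" "x \<otimes> dp l" "dp j \<otimes> dp l"] by simp
qed

lemma word_bounds:
  assumes "w \<in> lists X"
  shows "le (dp (- int (nc w))) (word_prod G w)" "le (word_prod G w) (dp (int (pc w)))"
  using assms
proof (induction w)
  case (Cons x w)
  have xc [simp]: "x \<in> carrier G" "word_prod G w \<in> carrier G" using Cons by auto
  { case 1
    show ?case
    proof (cases "x \<in> P")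
      case True
      then show ?thesis using X_P_iff [of x] le_mult_dp(1) [of 0 x 1 "- int (nc w)"] Cons by simp
    next
      case False
      then show ?thesis using X_notP_iff [of x] le_mult_dp(1) [of "- 1" x 0 "- int (nc w)"] Cons by simp
    qed
  next
    case 2
    show ?case
    proof (cases "x \<in> P")
      case True
      then show ?thesis using X_P_iff [of x] le_mult_dp(2) [of 0 x 1 _ _ "int (pc w)"] Cons by simp
    next
      case False
      then show ?thesis using X_notP_iff [of x] le_mult_dp(2) [of "- 1" x 0 _ _ "int (pc w)"] Cons by simp
    qed
  }
qed simp_all

text \<open>If \<open>\<Delta>^-q \<le> g\<close>, then \<open>g \<Delta>^q\<close> is positive and
  this is its largest left divisor that also divides \<open>\<Delta>\<close>: the first factor of
  its left greedy normal form.\<close>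

definition hd_simple :: "int \<Rightarrow> 'a \<Rightarrow> 'a" where "hd_simple q g = meet (dp 1) (g \<otimes> dp q)"

lemma hd_simple_carr [simp, intro]: "g \<in> carrier G \<Longrightarrow> hd_simple q g \<in> carrier G"
  by (simp add: hd_simple_def)

text \<open>The upper exponent drops because \<open>g \<Delta>^(1-p)\<close> is below both
  \<open>\<Delta>\<close> and \<open>g \<Delta>^q\<close>, hence below the head \<open>x\<close>;
  here \<open>1 - p \<le> q\<close> is used. The lower exponent is kept because \<open>x\<close> is
  below \<open>g \<Delta>^q\<close>.\<close>

lemma hd_pos:
  assumes [simp]: "g \<in> carrier G" and b: "le (dp (- q)) g" "le g (dp p)" and p: "p > 0" "q \<ge> 0"
  defines "x \<equiv> hd_simple q g"
  shows "le \<one> x" "le x (dp 1)" "le (dp (- q)) (inv x \<otimes> g)" "le (inv x \<otimes> g) (dp (p - 1))"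
proof -
  have xc [simp]: "x \<in> carrier G" by (simp add: x_def)
  have gq: "le \<one> (g \<otimes> dp q)" using b(1) le_dp_shift [of \<one> g "- q"] by simp
  show "le \<one> x" using gq dp_P [of 1] by (simp add: x_def hd_simple_def meet_greatest le_one)
  show "le x (dp 1)" by (simp add: x_def hd_simple_def meet_le1)
  have "le x (g \<otimes> dp q)" by (simp add: x_def hd_simple_def meet_le2)
  then have "le (x \<otimes> dp (- q)) g" by (simp add: le_dp_shift)
  then show "le (dp (- q)) (inv x \<otimes> g)" using le_left [of x "dp (- q)" "inv x \<otimes> g"] by simp
  have "le (g \<otimes> dp (1 - p)) (dp 1)" using b(2) by (simp add: le_dp_shift)
  moreover have "le (g \<otimes> dp (1 - p)) (g \<otimes> dp q)" using dp_le [of "1 - p" q] p by simp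
  ultimately have "le (g \<otimes> dp (1 - p)) x" by (simp add: x_def hd_simple_def meet_greatest)
  then have "le g (x \<otimes> dp (p - 1))" by (simp add: le_dp_shift)
  then show "le (inv x \<otimes> g) (dp (p - 1))" using le_left [of x "inv x \<otimes> g" "dp (p - 1)"] by simp
qed

text \<open>The case in which positive letters are used up: the head, multiplied by
  \<open>\<Delta>^-1\<close>, becomes a negative letter. Now \<open>g \<Delta>\<close> is the common
  lower bound of \<open>\<Delta>\<close> and \<open>g \<Delta>^q\<close>, which gives
  \<open>g \<le> x\<close>, while the lower exponent rises by one.\<close>

lemma hd_neg:
  assumes [simp]: "g \<in> carrier G" and b: "le (dp (- q)) g" "le g \<one>" and q: "q > 0"
  defines "x \<equiv> hd_simple q g \<otimes> dp (- 1)"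
  shows "le (dp (- 1)) x" "le x \<one>" "le (dp (1 - q)) (inv x \<otimes> g)" "le (inv x \<otimes> g) \<one>"
proof -
  have xc [simp]: "x \<in> carrier G" by (simp add: x_def)
  have gq: "le \<one> (g \<otimes> dp q)" using b(1) le_dp_shift [of \<one> g "- q"] by simp
  have "le \<one> (hd_simple q g)" using gq dp_P [of 1] by (simp add: hd_simple_def meet_greatest le_one)
  then show "le (dp (- 1)) x" using le_dp [of \<one> "hd_simple q g" "- 1"] by (simp add: x_def)
  have "le (hd_simple q g) (dp 1)" by (simp add: hd_simple_def meet_le1)
  then show "le x \<one>" by (simp add: x_def le_dp_shift)
  have "le (hd_simple q g) (g \<otimes> dp q)" by (simp add: hd_simple_def meet_le2)
  then have "le (x \<otimes> dp (1 - q)) g" by (simp add: x_def le_dp_shift gsimps)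
  then show "le (dp (1 - q)) (inv x \<otimes> g)" using le_left [of x "dp (1 - q)" "inv x \<otimes> g"] by simp
  have "le (g \<otimes> dp 1) (dp 1)" using b(2) le_dp [of g \<one> 1] by simp
  moreover have "le (g \<otimes> dp 1) (g \<otimes> dp q)" using dp_le [of 1 q] q by simp
  ultimately have "le (g \<otimes> dp 1) (hd_simple q g)" by (simp add: hd_simple_def meet_greatest)
  then have "le g x" by (simp add: x_def le_dp_shift)
  then show "le (inv x \<otimes> g) \<one>" using le_left [of x "inv x \<otimes> g" \<one>] by simp
qed

definition greedy_hd :: "nat \<Rightarrow> nat \<Rightarrow> 'a \<Rightarrow> 'a" where
  "greedy_hd p q g = (if p > 0 then hd_simple (int q) g else hd_simple (int q) g \<otimes> dp (- 1))"

lemma greedy_hd_props: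
  assumes [simp]: "g \<in> carrier G" and b: "le (dp (- int q)) g" "le g (dp (int p))" and pos: "p + q > 0"
  defines "x \<equiv> greedy_hd p q g"
  shows "x \<in> carrier G" "x \<noteq> \<one> \<Longrightarrow> x \<in> X" "x \<noteq> \<one> \<Longrightarrow> x \<in> P \<longleftrightarrow> p > 0"
    "le (dp (- int (if p > 0 then q else q - 1))) (inv x \<otimes> g)" "le (inv x \<otimes> g) (dp (int (p - 1)))"
proof -
  show [simp]: "x \<in> carrier G" by (simp add: x_def greedy_hd_def)
  consider "p > 0" | "p = 0" "q > 0" using pos by linarith
  then have "(x \<noteq> \<one> \<longrightarrow> x \<in> X \<and> (x \<in> P \<longleftrightarrow> p > 0)) \<and>
    le (dp (- int (if p > 0 then q else q - 1))) (inv x \<otimes> g) \<and> le (inv x \<otimes> g) (dp (int (p - 1)))"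
  proof cases
    case 1
    then show ?thesis
      using hd_pos [of g "int q" "int p"] b X_P_iff [of x] by (simp add: x_def greedy_hd_def of_nat_diff)
  next
    case 2
    then show ?thesis
      using hd_neg [of g "int q"] b X_notP_iff [of x] by (simp add: x_def greedy_hd_def of_nat_diff)
  qed
  then show "x \<noteq> \<one> \<Longrightarrow> x \<in> X" "x \<noteq> \<one> \<Longrightarrow> x \<in> P \<longleftrightarrow> p > 0"
    "le (dp (- int (if p > 0 then q else q - 1))) (inv x \<otimes> g)" "le (inv x \<otimes> g) (dp (int (p - 1)))"
    by blast+
qed

lemma dp_between_one: "g \<in> carrier G \<Longrightarrow> le \<one> g \<Longrightarrow> le g \<one> \<Longrightarrow> g = \<one>"
  by (rule le_antisym) auto

text \<open>Induction on \<open>p + q\<close>, splitting off greedy heads. A head may be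
  \<open>\<one>\<close>, which is not a letter; it is then dropped, so the length is only bounded by
  \<open>p + q\<close>.\<close>

lemma ex_word:
  assumes "g \<in> carrier G" "le (dp (- int q)) g" "le g (dp (int p))"
  shows "\<exists>w\<in>lists X. word_prod G w = g \<and> length w \<le> p + q"
  using assms
proof (induction "p + q" arbitrary: p q g)
  case 0
  then show ?case using dp_between_one [of g] by (intro bexI [of _ "[]"]) auto
next
  case (Suc n)
  let ?x = "greedy_hd p q g"
  have "p + q > 0" using Suc.hyps(2) by linarith
  note hp = greedy_hd_props [OF Suc.prems this]
  have [simp]: "g \<in> carrier G" "?x \<in> carrier G" using Suc hp by auto
  have "\<exists>w\<in>lists X. word_prod G w = inv ?x \<otimes> g \<and> length w \<le> n"
  proof (cases "p > 0")
    case True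
    then have n: "n = (p - 1) + q" using Suc.hyps(2) by simp
    show ?thesis unfolding n using Suc.hyps(1) [OF n, of "inv ?x \<otimes> g"] hp True by simp
  next
    case False
    then have n: "n = p + (q - 1)" using Suc.hyps(2) by simp
    show ?thesis unfolding n using Suc.hyps(1) [OF n, of "inv ?x \<otimes> g"] hp False by simp
  qed
  then obtain w where w: "w \<in> lists X" "word_prod G w = inv ?x \<otimes> g" "length w \<le> n" by blast
  show ?case
  proof (cases "?x = \<one>")
    case True
    then show ?thesis using w Suc by (intro bexI [of _ w]) auto
  next
    case False
    then show ?thesis using w Suc hp by (intro bexI [of _ "?x # w"]) auto
  qed
qed

lemma ex_bounds:
  assumes [simp]: "g \<in> carrier G"
  obtains p q :: nat where "le (dp (- int q)) g" "le g (dp (int p))"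
proof -
  obtain q where "g \<otimes> dp (int q) \<in> P" using ex_dp_lower [of g] by auto
  moreover obtain p where "inv g \<otimes> dp (int p) \<in> P" using ex_dp_lower [of "inv g"] by auto
  ultimately show thesis by (intro that [of q p]) (simp_all add: ge_dp, simp add: le_def)
qed

section \<open>Word length and conjugacy length\<close>

lemma word_len_attained:
  assumes "g \<in> carrier G"
  obtains w where "w \<in> lists X" "word_prod G w = g" "length w = word_len G X g"
proof -
  have "\<exists>n. \<exists>w\<in>lists X. word_prod G w = g \<and> length w = n"
    using ex_word [OF assms] ex_bounds [OF assms] by metis
  from LeastI_ex [OF this] show thesis unfolding word_len_def [symmetric] by (elim bexE conjE) (rule that)
qed

lemma word_len_le: "w \<in> lists X \<Longrightarrow> word_len G X (word_prod G w) \<le> length w"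
  unfolding word_len_def by (rule Least_le) blast

lemma word_len_le_iff:
  assumes "g \<in> carrier G"
  shows "word_len G X g \<le> n \<longleftrightarrow> (\<exists>p q::nat. p + q \<le> n \<and> le (dp (- int q)) g \<and> le g (dp (int p)))"
proof
  assume *: "word_len G X g \<le> n"
  obtain w where w: "w \<in> lists X" "word_prod G w = g" "length w = word_len G X g"
    using word_len_attained [OF assms] .
  show "\<exists>p q::nat. p + q \<le> n \<and> le (dp (- int q)) g \<and> le g (dp (int p))"
    using word_bounds [OF w(1)] pc_add_nc [of w] w * by (intro exI [of _ "pc w"] exI [of _ "nc w"]) simp
next
  assume "\<exists>p q::nat. p + q \<le> n \<and> le (dp (- int q)) g \<and> le g (dp (int p))"
  then obtain p q where "p + q \<le> n" and b: "le (dp (- int q)) g" "le g (dp (int p))" by blast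
  then show "word_len G X g \<le> n" using ex_word [OF assms b] word_len_le by fastforce
qed

lemma conj_len_attained:
  assumes "g \<in> carrier G"
  obtains h where "h \<in> conjugates G g" "word_len G X h = conj_len G X g"
proof -
  have "g \<in> conjugates G g" using assms by (auto simp: conjugates_def intro: exI [of _ \<one>])
  then have "\<exists>n. \<exists>h\<in>conjugates G g. word_len G X h = n" by blast
  from LeastI_ex [OF this] show thesis unfolding conj_len_def [symmetric] by (elim bexE) (rule that)
qed

lemma conj_len_le: "h \<in> conjugates G g \<Longrightarrow> conj_len G X g \<le> word_len G X h"
  unfolding conj_len_def by (rule Least_le) blast

lemma conjugates_self: "g \<in> carrier G \<Longrightarrow> g \<in> conjugates G g"
  by (auto simp: conjugates_def intro: exI [of _ \<one>])

lemma conjugatesE: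
  assumes "h \<in> conjugates G g" "g \<in> carrier G"
  obtains k where "k \<in> carrier G" "h = inv k \<otimes> g \<otimes> k"
  using assms unfolding conjugates_def by clarsimp (metis inv_closed inv_inv)

lemma conjugatesI: "k \<in> carrier G \<Longrightarrow> g \<in> carrier G \<Longrightarrow> inv k \<otimes> g \<otimes> k \<in> conjugates G g"
  unfolding conjugates_def by (intro CollectI exI [of _ "inv k"]) simp

lemma ConjGeo_iff_min:
  assumes w: "w \<in> lists X"
  shows "w \<in> ConjGeo G X \<longleftrightarrow> (\<forall>h\<in>conjugates G (word_prod G w). length w \<le> word_len G X h)"
proof -
  let ?g = "word_prod G w"
  have [simp]: "?g \<in> carrier G" using w by auto
  have "conj_len G X ?g \<le> length w"
    using conj_len_le [OF conjugates_self [of ?g]] word_len_le [OF w] by simp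
  moreover obtain h where "h \<in> conjugates G ?g" "word_len G X h = conj_len G X ?g"
    using conj_len_attained [of ?g] by auto
  moreover have "\<forall>h\<in>conjugates G ?g. conj_len G X ?g \<le> word_len G X h" using conj_len_le by blast
  ultimately show ?thesis using w unfolding ConjGeo_def by fastforce
qed

definition inf_max :: "'a list set" where
  "inf_max = {w \<in> lists X. nc w = 0 \<or>
     (\<forall>k\<in>carrier G. \<not> le (dp (1 - int (nc w))) (inv k \<otimes> word_prod G w \<otimes> k))}"

definition winv :: "'a list \<Rightarrow> 'a list" where "winv w = rev (map (m_inv G) w)"

lemma winv_lists: "w \<in> lists X \<Longrightarrow> winv w \<in> lists X"
  using inv_X by (induction w) (auto simp: winv_def)

lemma nc_winv: "w \<in> lists X \<Longrightarrow> nc (winv w) = pc w"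
  by (induction w) (auto simp: winv_def inv_X_P)

lemma prod_winv: "w \<in> lists X \<Longrightarrow> word_prod G (winv w) = inv (word_prod G w)"
proof (induction w)
  case (Cons x w)
  then have "winv w \<in> lists X" using winv_lists by auto
  then show ?case using Cons by (simp add: winv_def word_prod_append [OF monoid_axioms] inv_mult_group)
qed (simp add: winv_def)

text \<open>A shorter conjugate must beat \<open>pc w\<close> or \<open>nc w\<close>, since the
  length is their sum. Conversely, \<open>bounded_conjugator\<close> improves one of the two and
  preserves the bound for the other, so that the conjugate is shorter; for \<open>pc w\<close> it is
  applied to the inverse of the element, where the two exponents change roles.\<close>

lemma ConjGeo_eq: "ConjGeo G X = inf_max \<inter> {w \<in> lists X. winv w \<in> inf_max}"
proof -
  have "w \<in> ConjGeo G X \<longleftrightarrow> w \<in> inf_max \<and> winv w \<in> inf_max" if w: "w \<in> lists X" for w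
  proof -
    let ?g = "word_prod G w" and ?p = "int (pc w)" and ?q = "int (nc w)"
    have gc [simp]: "?g \<in> carrier G" using w by auto
    note b = word_bounds [OF w]
    have inv_conj: "inv k \<otimes> inv ?g \<otimes> k = inv (inv k \<otimes> ?g \<otimes> k)" if "k \<in> carrier G" for k
      using that by (simp add: gsimps)
    have sup: "winv w \<in> inf_max \<longleftrightarrow> pc w = 0 \<or> (\<forall>k\<in>carrier G. \<not> le (inv k \<otimes> ?g \<otimes> k) (dp (?p - 1)))"
      using w winv_lists [OF w] by (simp add: inf_max_def nc_winv prod_winv inv_conj dp_le_inv)
    show ?thesis
    proof
      assume L: "w \<in> ConjGeo G X"
      then have min: "length w \<le> word_len G X h" if "h \<in> conjugates G ?g" for h
        using that w by (simp add: ConjGeo_iff_min)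
      have no: False if "k \<in> carrier G" "le (dp (- int q)) (inv k \<otimes> ?g \<otimes> k)"
          "le (inv k \<otimes> ?g \<otimes> k) (dp (int p))" "p + q < length w" for p q k
      proof -
        let ?h = "inv k \<otimes> ?g \<otimes> k"
        have "?h \<in> carrier G" using that by simp
        then have "word_len G X ?h \<le> p + q" using that(2,3) word_len_le_iff [of ?h "p + q"] by blast
        then show False using min [of ?h] conjugatesI [of k ?g] that by simp
      qed
      have "w \<in> inf_max"
      proof (rule ccontr)
        assume "w \<notin> inf_max"
        then obtain k where k: "nc w > 0" "k \<in> carrier G" "le (dp (1 - ?q)) (inv k \<otimes> ?g \<otimes> k)"
          using w by (auto simp: inf_max_def)
        obtain x where x: "x \<in> P" "le (dp (1 - ?q)) (inv x \<otimes> ?g \<otimes> x)" "le (inv x \<otimes> ?g \<otimes> x) (dp ?p)"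
          using bounded_conjugator [of ?g "- ?q" ?p k] b k by (auto simp: add.commute)
        have "length w > 0" using k(1) pc_add_nc [of w] by linarith
        then show False using no [of x "nc w - 1" "pc w"] x k(1) pc_add_nc [of w] by (simp add: of_nat_diff)
      qed
      moreover have "winv w \<in> inf_max"
      proof (rule ccontr)
        assume "winv w \<notin> inf_max"
        then obtain k where k: "pc w > 0" "k \<in> carrier G" "le (inv k \<otimes> ?g \<otimes> k) (dp (?p - 1))"
          using sup by auto
        have "le (dp (- ?p)) (inv ?g)" "le (inv ?g) (dp ?q)"
          using b by (simp_all add: dp_le_inv inv_le_dp)
        moreover have "le (dp (- ?p + 1)) (inv k \<otimes> inv ?g \<otimes> k)"
          using k by (simp add: inv_conj dp_le_inv)
        ultimately obtain x where x: "x \<in> P" "le (dp (- ?p + 1)) (inv x \<otimes> inv ?g \<otimes> x)"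
            "le (inv x \<otimes> inv ?g \<otimes> x) (dp ?q)"
          using bounded_conjugator [of "inv ?g" "- ?p" ?q k] k(2) by auto
        have "le (inv x \<otimes> ?g \<otimes> x) (dp (?p - 1))" "le (dp (- ?q)) (inv x \<otimes> ?g \<otimes> x)"
          using x by (simp_all add: inv_conj dp_le_inv inv_le_dp)
        moreover have "length w > 0" using k(1) pc_add_nc [of w] by linarith
        ultimately show False using no [of x "nc w" "pc w - 1"] x(1) k(1) pc_add_nc [of w] by (simp add: of_nat_diff)
      qed
      ultimately show "w \<in> inf_max \<and> winv w \<in> inf_max" by blast
    next
      assume *: "w \<in> inf_max \<and> winv w \<in> inf_max"
      show "w \<in> ConjGeo G X"
        unfolding ConjGeo_iff_min [OF w]
      proof (rule ballI, rule ccontr)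
        fix h assume "h \<in> conjugates G ?g" and len: "\<not> length w \<le> word_len G X h"
        then obtain k where k: "k \<in> carrier G" "h = inv k \<otimes> ?g \<otimes> k" using conjugatesE [OF _ gc] by blast
        then have hc [simp]: "h \<in> carrier G" by simp
        obtain p q where pq: "p + q \<le> word_len G X h" "le (dp (- int q)) h" "le h (dp (int p))"
          using word_len_le_iff [of h "word_len G X h"] by auto
        then consider "p < pc w" | "q < nc w" using len pc_add_nc [of w] by linarith
        then show False
        proof cases
          case 1
          then have "le h (dp (?p - 1))" using le_trans [OF pq(3) dp_le [of "int p" "?p - 1"]] by simp
          then show False using * sup 1 k by auto
        next
          case 2
          then have "le (dp (1 - ?q)) h" using le_trans [OF dp_le [of "1 - ?q" "- int q"] pq(2)] by simp
          then show False using * 2 k by (auto simp: inf_max_def)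
        qed
      qed
    qed
  qed
  moreover have "ConjGeo G X \<subseteq> lists X" "inf_max \<subseteq> lists X"
    by (auto simp: inf_max_def ConjGeo_def)
  ultimately show ?thesis by blast
qed

section \<open>An automaton for \<open>inf_max\<close>\<close>

definition \<tau> :: "int \<Rightarrow> 'a \<Rightarrow> 'a" where "\<tau> q d = dp (- q) \<otimes> (d \<otimes> dp q)"

lemma \<tau>_carr [simp, intro]: "d \<in> carrier G \<Longrightarrow> \<tau> q d \<in> carrier G"
  by (simp add: \<tau>_def)

lemma \<tau>_P: "d \<in> P \<Longrightarrow> \<tau> q d \<in> P"
  using dp_conj [of d "- q"] by (simp add: \<tau>_def)

lemma \<tau>_Suc: "d \<in> carrier G \<Longrightarrow> \<tau> (q + 1) d = \<tau> 1 (\<tau> q d)"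
  by (simp add: \<tau>_def gsimps add.commute)

lemma \<tau>_le_dp:
  assumes [simp]: "d \<in> carrier G"
  shows "le (\<tau> q d) (dp k) \<longleftrightarrow> le d (dp k)"
proof -
  have "le (\<tau> q d) (dp k) \<longleftrightarrow> le (dp (- q) \<otimes> (d \<otimes> dp q)) (dp (- q) \<otimes> (dp k \<otimes> dp q))"
    by (simp add: \<tau>_def del: le_left)
  also have "\<dots> \<longleftrightarrow> le d (dp k)" by (simp only: le_left le_dp dp_carr m_closed assms)
  finally show ?thesis .
qed

text \<open>\<open>lam \<Delta>\<close> bounds the exponent of the conjugators; the extra
  \<open>1\<close> pays for raising the lower exponent by one. The divisor tested in
  \<open>inf_max_iff\<close> is \<open>\<Delta>^bound\<close> times the inverse of a shifted
  conjugator.\<close>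

definition bound :: int where "bound = lam \<Delta> + 1"

definition D :: "'a set" where "D = {d \<in> P. le d (dp bound)}"

lemma bound_pos: "bound \<ge> 1"
  using lam_nonneg [OF D_P] by (simp add: bound_def)

lemma D_subP: "d \<in> D \<Longrightarrow> d \<in> P" by (simp add: D_def)

lemma finite_D: "finite D"
proof -
  have "D \<subseteq> word_prod G ` {w. set w \<subseteq> X \<and> length w \<le> nat bound}"
  proof
    fix d assume d: "d \<in> D"
    then have "\<exists>w\<in>lists X. word_prod G w = d \<and> length w \<le> nat bound + 0"
      using bound_pos by (intro ex_word) (auto simp: D_def le_one)
    then show "d \<in> word_prod G ` {w. set w \<subseteq> X \<and> length w \<le> nat bound}" by force
  qed
  then show ?thesis by (rule finite_subset) (simp add: finite_lists_length_le)
qed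

lemma \<tau>_D: "d \<in> D \<Longrightarrow> \<tau> q d \<in> D"
  by (simp add: D_def \<tau>_P \<tau>_le_dp)

definition letter_simple :: "'a \<Rightarrow> 'a" where "letter_simple x = (if x \<in> P then x else x \<otimes> dp 1)"

lemma letter_simple:
  assumes "x \<in> X"
  shows "letter_simple x \<in> P" "letter_simple x \<in> D"
proof -
  have xc [simp]: "x \<in> carrier G" using assms by simp
  have 1: "letter_simple x \<in> P \<and> le (letter_simple x) (dp 1)"
  proof (cases "x \<in> P")
    case True
    then show ?thesis using X_P_iff [of x] assms by (simp add: letter_simple_def)
  next
    case False
    then show ?thesis using X_notP_iff [of x] assms le_dp [of x \<one> 1]
      by (simp add: letter_simple_def ge_dp)
  qed
  then show "letter_simple x \<in> P" by blast
  then show "letter_simple x \<in> D"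
    using 1 le_trans [of "letter_simple x" "dp 1" "dp bound"] dp_le [of 1 bound] bound_pos by (simp add: D_def)
qed

text \<open>The numerator of \<open>w\<close>: every negative letter is
  \<open>letter_simple x\<close> times \<open>\<Delta>^-1\<close>, and all these powers are
  collected at the right end, so that \<open>w\<close> represents \<open>num w\<close> times
  \<open>\<Delta>^-(nc w)\<close>.\<close>

definition num :: "'a list \<Rightarrow> 'a" where "num w = word_prod G w \<otimes> dp (int (nc w))"

lemma num_P: "w \<in> lists X \<Longrightarrow> num w \<in> P"
  using word_bounds(1) [of w] by (simp add: num_def ge_dp)

text \<open>A new letter stands behind the collected power \<open>\<Delta>^-q\<close>; moving the
  power past it conjugates its simple part, which is where \<open>\<tau>\<close> comes from.\<close>

lemma num_snoc:
  assumes "w \<in> lists X" "x \<in> X"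
  shows "num (w @ [x]) = num w \<otimes> \<tau> (int (nc w)) (letter_simple x)"
proof -
  have [simp]: "x \<in> carrier G" "word_prod G w \<in> carrier G" using assms by auto
  have "word_prod G (w @ [x]) = word_prod G w \<otimes> x"
    using assms by (subst word_prod_append [OF monoid_axioms]) auto
  then show ?thesis
    by (simp add: num_def \<tau>_def letter_simple_def gsimps add.commute)
qed

text \<open>If \<open>l\<close> is the least common left multiple of \<open>e\<close> and
  \<open>c\<close>, then \<open>e\<close> right divides \<open>z c\<close> iff
  \<open>f = l c^-1\<close> right divides \<open>z\<close>. This \<open>f\<close> is again in
  \<open>D\<close>, because \<open>\<Delta>^bound c\<close> is a common left multiple of
  \<open>e\<close> and \<open>c\<close>. So the right divisors in \<open>D\<close> of a growing
  product can be updated letter by letter.\<close>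

lemma right_divides_step:
  assumes z: "z \<in> P" and c: "c \<in> P" and e: "e \<in> D"
  shows "z \<otimes> c \<otimes> inv e \<in> P \<longleftrightarrow> (\<exists>f\<in>D. z \<otimes> inv f \<in> P \<and> f \<otimes> c \<otimes> inv e \<in> P)"
proof
  assume zc: "z \<otimes> c \<otimes> inv e \<in> P"
  have [simp]: "z \<in> carrier G" "c \<in> carrier G" "e \<in> P" "e \<in> carrier G" using z c e by (auto simp: D_subP)
  obtain l where l: "l \<in> P" "l \<otimes> inv e \<in> P" "l \<otimes> inv c \<in> P"
      "\<And>u. u \<in> P \<Longrightarrow> u \<otimes> inv e \<in> P \<Longrightarrow> u \<otimes> inv c \<in> P \<Longrightarrow> u \<otimes> inv l \<in> P"
    using P_rjoin [of e c] c by auto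
  have [simp]: "l \<in> carrier G" using l by simp
  have "z \<otimes> c \<otimes> inv l \<in> P" using l(4) [of "z \<otimes> c"] zc z P_mult [OF z c] by (simp add: gsimps)
  then have zf: "z \<otimes> inv (l \<otimes> inv c) \<in> P" by (simp add: gsimps)
  have "dp bound \<otimes> c \<otimes> inv l \<in> P"
  proof (rule l(4))
    show "dp bound \<otimes> c \<in> P" using P_mult dp_P bound_pos c by simp
    have "inv e \<otimes> dp bound \<in> P" using e by (simp add: D_def le_def)
    then have "dp bound \<otimes> inv e \<in> P" by (simp add: dp_swap)
    then have "dp bound \<otimes> (c \<otimes> dp (- bound)) \<otimes> (dp bound \<otimes> inv e) \<in> P"
      by (rule P_mult [OF dp_conj [OF c]])
    then show "dp bound \<otimes> c \<otimes> inv e \<in> P" by (simp add: gsimps)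
    show "dp bound \<otimes> c \<otimes> inv c \<in> P" using dp_P bound_pos by (simp add: gsimps)
  qed
  then have "inv (l \<otimes> inv c) \<otimes> dp bound \<in> P"
    using dp_swap [of "c \<otimes> inv l" bound] by (simp add: gsimps)
  then have "l \<otimes> inv c \<in> D" using l(3) by (simp add: D_def le_def)
  moreover have "l \<otimes> inv c \<otimes> c \<otimes> inv e \<in> P" using l(2) by (simp add: gsimps)
  ultimately show "\<exists>f\<in>D. z \<otimes> inv f \<in> P \<and> f \<otimes> c \<otimes> inv e \<in> P" using zf by blast
next
  assume "\<exists>f\<in>D. z \<otimes> inv f \<in> P \<and> f \<otimes> c \<otimes> inv e \<in> P"
  then obtain f where f: "f \<in> D" "z \<otimes> inv f \<in> P" "f \<otimes> c \<otimes> inv e \<in> P" by blast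
  then have "z \<otimes> inv f \<otimes> (f \<otimes> c \<otimes> inv e) \<in> P" using P_mult by blast
  moreover have "z \<in> carrier G" "c \<in> carrier G" "e \<in> carrier G" "f \<in> carrier G" using z c e f(1) by (auto simp: D_subP)
  ultimately show "z \<otimes> c \<otimes> inv e \<in> P" by (simp add: gsimps)
qed

definition rdivs :: "'a list \<Rightarrow> ('a \<times> 'a) set" where
  "rdivs w = {(y, e) \<in> D \<times> D. y \<otimes> num w \<otimes> inv e \<in> P}"

lemma rdivs_snoc:
  assumes "w \<in> lists X" "x \<in> X"
  shows "rdivs (w @ [x]) = {(y, e) \<in> D \<times> D.
    \<exists>f\<in>D. (y, f) \<in> rdivs w \<and> f \<otimes> \<tau> (int (nc w)) (letter_simple x) \<otimes> inv e \<in> P}"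
proof -
  have "y \<otimes> num (w @ [x]) \<otimes> inv e \<in> P \<longleftrightarrow>
     (\<exists>f\<in>D. y \<otimes> num w \<otimes> inv f \<in> P \<and> f \<otimes> \<tau> (int (nc w)) (letter_simple x) \<otimes> inv e \<in> P)"
    if "y \<in> D" "e \<in> D" for y e
  proof -
    have P: "y \<otimes> num w \<in> P" "\<tau> (int (nc w)) (letter_simple x) \<in> P" "num w \<in> P"
      using that num_P assms letter_simple \<tau>_P P_mult D_subP by auto
    then have "num w \<in> carrier G" "letter_simple x \<in> carrier G" "y \<in> carrier G"
      using that letter_simple assms D_subP by auto
    then have "y \<otimes> num (w @ [x]) = y \<otimes> num w \<otimes> \<tau> (int (nc w)) (letter_simple x)"
      using assms by (simp add: num_snoc gsimps)
    then show ?thesis using right_divides_step [OF P(1,2) that(2)] by simp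
  qed
  then show ?thesis unfolding rdivs_def by auto
qed

text \<open>Powers of \<open>\<Delta>\<close> make the factors positive: \<open>x^-1\<close> becomes
  \<open>\<Delta>^N x^-1\<close> with \<open>N = lam \<Delta>\<close>, and the factor
  \<open>x\<close> on the right, moved across the collected power, becomes the inverse of a divisor.
  Raising the exponent is thus a right divisibility between positive elements, to be tested for
  finitely many \<open>x\<close>.\<close>

lemma inf_max_iff:
  assumes w: "w \<in> lists X"
  shows "w \<in> inf_max \<longleftrightarrow> nc w = 0 \<or> (\<forall>x\<in>D. le x (dp (lam \<Delta>)) \<longrightarrow>
     (dp (lam \<Delta>) \<otimes> inv x, dp bound \<otimes> inv (\<tau> (int (nc w)) x)) \<notin> rdivs w)"
proof -
  let ?q = "int (nc w)" and ?g = "word_prod G w" and ?N = "lam \<Delta>"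
  have gc [simp]: "?g \<in> carrier G" using w by auto
  have key: "(dp ?N \<otimes> inv x, dp bound \<otimes> inv (\<tau> ?q x)) \<in> rdivs w \<longleftrightarrow> le (dp (1 - ?q)) (inv x \<otimes> ?g \<otimes> x)"
    if x: "x \<in> D" "le x (dp ?N)" for x
  proof -
    have [simp]: "x \<in> P" "x \<in> carrier G" using x by (auto simp: D_subP)
    have "dp ?N \<otimes> inv x \<in> P" using x(2) by (simp add: le_def dp_swap)
    moreover have "inv (dp ?N \<otimes> inv x) \<otimes> dp bound \<in> P"
      using P_mult [of x "dp 1"] dp_P by (simp add: gsimps bound_def)
    ultimately have y: "dp ?N \<otimes> inv x \<in> D" by (simp add: D_def le_def)
    have "\<tau> ?q x \<in> D" using x by (simp add: \<tau>_D)
    then have \<tau>P: "\<tau> ?q x \<in> P" and "dp bound \<otimes> inv (\<tau> ?q x) \<in> P" by (simp_all add: D_def le_def dp_swap)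
    moreover have "inv (dp bound \<otimes> inv (\<tau> ?q x)) \<otimes> dp bound \<in> P"
      using \<tau>P by (simp add: gsimps)
    ultimately have e: "dp bound \<otimes> inv (\<tau> ?q x) \<in> D" by (simp add: D_def le_def)
    have "dp ?N \<otimes> inv x \<otimes> num w \<otimes> inv (dp bound \<otimes> inv (\<tau> ?q x)) =
        dp ?N \<otimes> (inv x \<otimes> ?g \<otimes> x \<otimes> dp (?q - 1) \<otimes> dp (- ?N))"
      by (simp add: num_def \<tau>_def gsimps bound_def diff_diff_eq add.commute)
    also have "\<dots> \<in> P \<longleftrightarrow> inv x \<otimes> ?g \<otimes> x \<otimes> dp (?q - 1) \<in> P"
      using dp_swap [of "inv x \<otimes> ?g \<otimes> x \<otimes> dp (?q - 1) \<otimes> dp (- ?N)" ?N] by (simp add: gsimps)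
    also have "\<dots> \<longleftrightarrow> le (dp (1 - ?q)) (inv x \<otimes> ?g \<otimes> x)" by (simp add: ge_dp)
    finally show ?thesis using y e by (simp add: rdivs_def)
  qed
  have "(\<exists>k\<in>carrier G. le (dp (1 - ?q)) (inv k \<otimes> ?g \<otimes> k)) \<longleftrightarrow>
      (\<exists>x\<in>D. le x (dp ?N) \<and> le (dp (1 - ?q)) (inv x \<otimes> ?g \<otimes> x))"
  proof
    assume "\<exists>k\<in>carrier G. le (dp (1 - ?q)) (inv k \<otimes> ?g \<otimes> k)"
    then obtain k where k: "k \<in> carrier G" "le (dp (- ?q + 1)) (inv k \<otimes> ?g \<otimes> k)" by (auto simp: add.commute)
    obtain x where x: "x \<in> P" "le x (dp ?N)" "le (dp (- ?q + 1)) (inv x \<otimes> ?g \<otimes> x)"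
      using bounded_conjugator [OF gc word_bounds [OF w] k] by blast
    then have "le x (dp bound)" using le_trans [of x "dp ?N" "dp bound"] dp_le [of ?N bound] by (simp add: bound_def)
    then have "x \<in> D" using x by (simp add: D_def)
    then show "\<exists>x\<in>D. le x (dp ?N) \<and> le (dp (1 - ?q)) (inv x \<otimes> ?g \<otimes> x)"
      using x by (intro bexI [of _ x]) (simp_all add: add.commute)
  qed (auto dest: D_subP)
  then show ?thesis using w key unfolding inf_max_def by blast
qed

text \<open>A state records whether a negative letter has been read, the restriction to \<open>D\<close> of
  conjugation by \<open>\<Delta>\<close> to the number of negative letters, and the right divisors in \<open>D\<close> of the
  products \<open>y \<cdot> num w\<close> with \<open>y \<in> D\<close>.\<close>

lemma regular_inf_max: "regular_language X inf_max"
proof (rule regular_languageI)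
  let ?f = "\<lambda>w. (nc w = 0, restrict (\<tau> (int (nc w))) D, rdivs w)"
  let ?st = "\<lambda>(z, t, E) x. (z \<and> x \<in> P, if x \<in> P then t else restrict (\<lambda>d. \<tau> 1 (t d)) D,
      {(y, e) \<in> D \<times> D. \<exists>f\<in>D. (y, f) \<in> E \<and> f \<otimes> t (letter_simple x) \<otimes> inv e \<in> P})"
  let ?F = "{(z, t, E). z \<or> (\<forall>x\<in>D. le x (dp (lam \<Delta>)) \<longrightarrow>
      (dp (lam \<Delta>) \<otimes> inv x, dp bound \<otimes> inv (t x)) \<notin> E)}"
  show "finite ((UNIV :: bool set) \<times> (D \<rightarrow>\<^sub>E D) \<times> Pow (D \<times> D))"
    using finite_D by (simp add: finite_PiE)
  show "?f w \<in> (UNIV :: bool set) \<times> (D \<rightarrow>\<^sub>E D) \<times> Pow (D \<times> D)" if "w \<in> lists X" for w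
    by (auto simp: \<tau>_D rdivs_def)
  show "?f (w @ [x]) = ?st (?f w) x" if "w \<in> lists X" "x \<in> X" for w x
    using that letter_simple(2) [of x] \<tau>_Suc [of _ "int (nc w)"]
    by (auto simp: rdivs_snoc fun_eq_iff restrict_def add.commute D_subP)
  show "inf_max = {w \<in> lists X. ?f w \<in> ?F}"
  proof -
    have "w \<in> inf_max \<longleftrightarrow> ?f w \<in> ?F" if "w \<in> lists X" for w
      unfolding inf_max_iff [OF that] by simp
    moreover have "inf_max \<subseteq> lists X" by (auto simp: inf_max_def)
    ultimately show ?thesis by blast
  qed
qed simp

theorem regular_ConjGeo: "regular_language X (ConjGeo G X)"
  unfolding ConjGeo_eq winv_def
  by (intro regular_language_Int regular_language_rev_map regular_inf_max inv_X)

section \<open>The greedy normal form\<close>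

primrec greedy :: "'a list \<Rightarrow> bool" where
  "greedy [] \<longleftrightarrow> True"
| "greedy (x # w) \<longleftrightarrow> greedy w \<and> x = greedy_hd (pc (x # w)) (nc (x # w)) (word_prod G (x # w))"

text \<open>An element \<open>u\<close> below \<open>\<Delta>\<close> and \<open>x b\<close> is also
  below \<open>x \<Delta>\<close>, so \<open>x^-1 u\<close> is below \<open>\<Delta>\<close> and
  \<open>b\<close>. Hence the head of a product depends on \<open>b\<close> only through the head of
  \<open>b\<close>, which makes heads computable from right to left with finitely many
  states.\<close>

lemma meet_mult_meet:
  assumes x: "x \<in> P" and [simp]: "b \<in> carrier G"
  shows "meet (dp 1) (x \<otimes> b) = meet (dp 1) (x \<otimes> meet (dp 1) b)"
proof -
  have [simp]: "x \<in> carrier G" using x by simp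
  let ?u = "meet (dp 1) (x \<otimes> b)" and ?v = "meet (dp 1) (x \<otimes> meet (dp 1) b)"
  have "le ?u (x \<otimes> dp 1)"
    using le_trans [of ?u "dp 1" "x \<otimes> dp 1"] x le_dp [of \<one> x 1] by (simp add: meet_le1 le_one)
  then have "le (inv x \<otimes> ?u) (dp 1)" using le_left [of x "inv x \<otimes> ?u" "dp 1"] by simp
  moreover have "le ?u (x \<otimes> b)" by (simp add: meet_le2)
  then have "le (inv x \<otimes> ?u) b" using le_left [of x "inv x \<otimes> ?u" b] by simp
  ultimately have "le (inv x \<otimes> ?u) (meet (dp 1) b)" by (simp add: meet_greatest)
  then have "le ?u (x \<otimes> meet (dp 1) b)" using le_left [of x "inv x \<otimes> ?u" "meet (dp 1) b"] by simp
  then have 1: "le ?u ?v" by (simp add: meet_greatest meet_le1)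
  have "le ?v (x \<otimes> b)"
    using le_trans [of ?v "x \<otimes> meet (dp 1) b" "x \<otimes> b"] by (simp add: meet_le2)
  then have "le ?v ?u" by (simp add: meet_greatest meet_le1)
  then show ?thesis using 1 by (intro le_antisym) auto
qed

lemma meet_\<tau>:
  assumes [simp]: "b \<in> carrier G"
  shows "meet (dp 1) (\<tau> q b) = \<tau> q (meet (dp 1) b)"
proof (rule le_antisym)
  have le\<tau>: "le (\<tau> r x) (\<tau> r y) \<longleftrightarrow> le x y" if "x \<in> carrier G" "y \<in> carrier G" for r x y
    using that by (simp add: \<tau>_def)
  have inv\<tau>: "\<tau> r (\<tau> (- r) x) = x" if "x \<in> carrier G" for r x
    using that by (simp add: \<tau>_def gsimps)
  show "le (\<tau> q (meet (dp 1) b)) (meet (dp 1) (\<tau> q b))"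
    by (simp add: meet_greatest \<tau>_le_dp meet_le1 meet_le2 le\<tau>)
  let ?u = "meet (dp 1) (\<tau> q b)"
  have "le (\<tau> q (\<tau> (- q) ?u)) (\<tau> q b)" by (simp only: inv\<tau> meet_carr dp_carr \<tau>_carr assms meet_le2)
  then have "le (\<tau> (- q) ?u) b" by (simp add: le\<tau>)
  then have "le (\<tau> (- q) ?u) (meet (dp 1) b)" by (simp add: meet_greatest \<tau>_le_dp meet_le1)
  then have "le (\<tau> q (\<tau> (- q) ?u)) (\<tau> q (meet (dp 1) b))" by (simp add: le\<tau>)
  then show "le ?u (\<tau> q (meet (dp 1) b))" by (simp only: inv\<tau> meet_carr dp_carr \<tau>_carr assms)
qed auto

definition hdw :: "'a list \<Rightarrow> 'a" where "hdw w = meet (dp 1) (num w)"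

lemma hdw_Cons:
  assumes "w \<in> lists X" "x \<in> X"
  shows "hdw (x # w) = meet (dp 1) (letter_simple x \<otimes> (if x \<in> P then hdw w else \<tau> 1 (hdw w)))"
proof -
  have [simp]: "x \<in> carrier G" "word_prod G w \<in> carrier G" "letter_simple x \<in> P" "num w \<in> carrier G"
    using assms letter_simple num_P [of w] by auto
  have "num (x # w) = letter_simple x \<otimes> (if x \<in> P then num w else \<tau> 1 (num w))"
    by (simp add: num_def letter_simple_def \<tau>_def gsimps add.commute)
  then show ?thesis
    using meet_mult_meet [of "letter_simple x" "num w"] meet_mult_meet [of "letter_simple x" "\<tau> 1 (num w)"]
      meet_\<tau> [of "num w" 1] by (cases "x \<in> P") (simp_all only: hdw_def if_True if_False \<tau>_carr \<open>num w \<in> carrier G\<close> \<open>letter_simple x \<in> P\<close>)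
qed

text \<open>The condition on \<open>pc w\<close> appears because the head is positive as long as
  positive letters are left, so a negative letter can be greedy only if no positive letter
  follows.\<close>

lemma greedy_Cons:
  assumes "w \<in> lists X" "x \<in> X"
  shows "greedy (x # w) \<longleftrightarrow> greedy w \<and> (x \<in> P \<or> pc w = 0) \<and> letter_simple x = hdw (x # w)"
proof -
  have xc [simp]: "x \<in> carrier G" "word_prod G w \<in> carrier G" using assms by auto
  let ?h = "hdw (x # w)"
  have h: "hd_simple (int (nc (x # w))) (word_prod G (x # w)) = ?h"
    by (simp add: hd_simple_def hdw_def num_def)
  have [simp]: "?h \<in> carrier G" by (simp add: hdw_def num_def)
  show ?thesis
  proof (cases "x \<in> P")
    case True
    then show ?thesis using h by (auto simp: greedy_hd_def letter_simple_def)
  next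
    case False
    have P: "?h \<in> P" 
    proof -
      have "num (x # w) \<in> P" using num_P [of "x # w"] assms by auto
      then show ?thesis using dp_P [of 1] meet_greatest [of "dp 1" "num (x # w)" \<one>] by (simp add: hdw_def le_one)
    qed
    have eq: "x = ?h \<otimes> dp (- 1) \<longleftrightarrow> x \<otimes> dp 1 = ?h"
    proof
      assume "x \<otimes> dp 1 = ?h"
      then have "?h \<otimes> dp (- 1) = x \<otimes> dp 1 \<otimes> dp (- 1)" by simp
      then show "x = ?h \<otimes> dp (- 1)" by (simp add: gsimps)
    next
      assume "x = ?h \<otimes> dp (- 1)"
      then have "x \<otimes> dp 1 = ?h \<otimes> dp (- 1) \<otimes> dp 1" by simp
      then show "x \<otimes> dp 1 = ?h" by (simp add: gsimps)
    qed
    show ?thesis using False h P eq by (auto simp: greedy_hd_def letter_simple_def)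
  qed
qed

lemma hdw_D: "w \<in> lists X \<Longrightarrow> hdw w \<in> D"
proof -
  assume w: "w \<in> lists X"
  then have [simp]: "num w \<in> P" "num w \<in> carrier G" using num_P by auto
  have "le \<one> (hdw w)" using dp_P [of 1] by (simp add: hdw_def meet_greatest le_one)
  moreover have "le (hdw w) (dp bound)"
    using le_trans [of "hdw w" "dp 1" "dp bound"] dp_le [of 1 bound] bound_pos by (simp add: hdw_def meet_le1)
  ultimately show ?thesis by (simp add: D_def le_one hdw_def)
qed

lemma regular_greedy: "regular_language X {w \<in> lists X. greedy w}"
proof (rule regular_language_consI)
  let ?f = "\<lambda>w. (greedy w, pc w = 0, hdw w)"
  let ?h = "\<lambda>x h. meet (dp 1) (letter_simple x \<otimes> (if x \<in> P then h else \<tau> 1 h))"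
  let ?st = "\<lambda>x (gr, z, h). (gr \<and> (x \<in> P \<or> z) \<and> letter_simple x = ?h x h, z \<and> x \<notin> P, ?h x h)"
  show "finite ((UNIV :: bool set) \<times> (UNIV :: bool set) \<times> D)" using finite_D by simp
  show "?f w \<in> UNIV \<times> UNIV \<times> D" if "w \<in> lists X" for w using that hdw_D by simp
  show "?f (x # w) = ?st x (?f w)" if "w \<in> lists X" "x \<in> X" for w x
    using greedy_Cons [OF that] hdw_Cons [OF that] by (simp del: greedy.simps)
  show "{w \<in> lists X. greedy w} = {w \<in> lists X. ?f w \<in> {(gr, z, h). gr}}" by simp
qed simp

text \<open>Upper and lower exponents can be mixed: \<open>(p, nc w)\<close> and
  \<open>(pc w, q)\<close> also bound the element, so neither sum is smaller than the length. Hence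
  all geodesics for an element have the same numbers of positive and negative letters.\<close>

lemma geodesic_counts:
  assumes w: "w \<in> lists X" and geo: "length w = word_len G X (word_prod G w)"
    and b: "le (dp (- int q)) (word_prod G w)" "le (word_prod G w) (dp (int p))"
    and pq: "p + q \<le> length w"
  shows "pc w = p" "nc w = q"
proof -
  have gc: "word_prod G w \<in> carrier G" using w by auto
  have no: "length w \<le> p' + q'" if "le (dp (- int q')) (word_prod G w)" "le (word_prod G w) (dp (int p'))" for p' q'
    using word_len_le_iff [OF gc, of "p' + q'"] that geo by auto
  have "length w \<le> p + nc w" "length w \<le> pc w + q"
    using no b word_bounds [OF w] by blast+
  then show "pc w = p" "nc w = q" using pq pc_add_nc [of w] by linarith+
qed

lemma word_len_mult:
  assumes "x \<in> X" "g \<in> carrier G"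
  shows "word_len G X (x \<otimes> g) \<le> Suc (word_len G X g)"
proof -
  obtain w where "w \<in> lists X" "word_prod G w = g" "length w = word_len G X g"
    using word_len_attained [OF assms(2)] .
  then show ?thesis using word_len_le [of "x # w"] assms by auto
qed

lemma geodesic_tl:
  assumes "x # w \<in> lists X" and geo: "length (x # w) = word_len G X (word_prod G (x # w))"
  shows "length w = word_len G X (word_prod G w)"
  using assms word_len_mult [of x "word_prod G w"] word_len_le [of w] by force

lemma greedy_hd_greatest:
  assumes [simp]: "g \<in> carrier G" and x: "x \<in> X"
    and b: "if x \<in> P then p > 0 \<and> le (dp (- int q)) (inv x \<otimes> g)
      else p = 0 \<and> le (dp (1 - int q)) (inv x \<otimes> g)"
  shows "le x (greedy_hd p q g)"
proof -
  have xc [simp]: "x \<in> carrier G" using x by simp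
  show ?thesis
  proof (cases "x \<in> P")
    case True
    have "le (x \<otimes> dp (- int q)) g" using b True le_left [of x "dp (- int q)" "inv x \<otimes> g"] by simp
    then have "le x (g \<otimes> dp (int q))" by (simp add: le_dp_shift)
    moreover have "le x (dp 1)" using X_P_iff [of x] x True by simp
    ultimately show ?thesis using True b by (simp add: greedy_hd_def hd_simple_def meet_greatest)
  next
    case False
    have "le (x \<otimes> dp (1 - int q)) g" using b False le_left [of x "dp (1 - int q)" "inv x \<otimes> g"] by simp
    then have "le x (g \<otimes> dp (int q - 1))" by (simp add: le_dp_shift)
    then have "le (x \<otimes> dp 1) (g \<otimes> dp (int q - 1) \<otimes> dp 1)" by (simp del: dp_mult)
    then have "le (x \<otimes> dp 1) (g \<otimes> dp (int q))" by (simp add: gsimps)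
    moreover have "le (x \<otimes> dp 1) (dp 1)" using X_notP_iff [of x] x False le_dp [of x \<one> 1] by simp
    ultimately have "le (x \<otimes> dp 1) (hd_simple (int q) g)" by (simp add: hd_simple_def meet_greatest)
    then show ?thesis using False b by (simp add: greedy_hd_def le_dp_shift)
  qed
qed

text \<open>Let \<open>y\<close> be the first letter of a competing geodesic. If \<open>y\<close> is
  positive, or no positive letters are left, then \<open>y \<le> x\<close> because \<open>x\<close>
  is the greatest possible head, so \<open>y\<close> has smaller degree unless \<open>y = x\<close>.
  Otherwise \<open>y\<close> is negative and has negative degree, whereas \<open>x\<close> is
  positive. Decreasing degree therefore puts \<open>x\<close> before \<open>y\<close>.\<close>

lemma greedy_shortlex_least:
  assumes r: "\<And>x y. x \<in> X \<Longrightarrow> y \<in> X \<Longrightarrow> lam y < lam x \<Longrightarrow> (x, y) \<in> r"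
    and "w \<in> lists X" "length w = word_len G X (word_prod G w)" "greedy w"
    and "v \<in> lists X" "word_prod G v = word_prod G w"
  shows "v = w \<or> (w, v) \<in> shortlex r"
  using assms(2-)
proof (induction w arbitrary: v rule: list.induct)
  case Nil
  then show ?case by (cases v) (auto simp: shortlex_def)
next
  case (Cons x w)
  let ?g = "word_prod G (x # w)"
  have gc [simp]: "x \<in> carrier G" "word_prod G w \<in> carrier G" using Cons.prems(1) by auto
  have "length (x # w) \<le> length v" using Cons.prems word_len_le [of v] by simp
  then consider "length (x # w) < length v" | "length (x # w) = length v" by linarith
  then show ?case
  proof cases
    case 1
    then show ?thesis by (simp add: shortlex_def lenlex_conv)
  next
    case 2
    then obtain y u where v: "v = y # u" by (cases v) auto
    have yu: "y \<in> X" "u \<in> lists X" using Cons.prems v by auto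
    have uc [simp]: "y \<in> carrier G" "word_prod G u \<in> carrier G" using yu by auto
    have cnt: "pc v = pc (x # w)" "nc v = nc (x # w)"
    proof -
      have "le (dp (- int (nc v))) ?g" "le ?g (dp (int (pc v)))"
        unfolding Cons.prems(5) [symmetric] by (rule word_bounds [OF Cons.prems(4)])+
      then show "pc v = pc (x # w)" "nc v = nc (x # w)"
        using geodesic_counts [of "x # w" "nc v" "pc v"] Cons.prems 2 pc_add_nc [of v] by auto
    qed
    have x: "x = greedy_hd (pc v) (nc v) ?g" using Cons.prems cnt by simp
    have "inv y \<otimes> ?g = word_prod G u" using Cons.prems(5) v by (metis uc inv_l word_prod_Cons)
    then have cand: "le y x" if "y \<in> P \<or> pc v = 0"
      using greedy_hd_greatest [of ?g y "pc v" "nc v"] yu word_bounds [of u] v that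
      by (subst x) auto
    have "y = x \<or> lam y < lam x"
    proof (cases "y \<in> P \<or> pc v = 0")
      case True
      then show ?thesis using cand lam_mono_eq [of y x] by force
    next
      case False
      have xX: "x \<in> X" using Cons.prems(1) by simp
      have "x \<in> P"
      proof (rule ccontr)
        assume "x \<notin> P"
        moreover have "hd_simple (int (nc v)) ?g = x" using x False by (simp add: greedy_hd_def)
        moreover have "num (x # w) \<in> P" by (rule num_P) (rule Cons.prems(1))
        then have "le \<one> (hd_simple (int (nc v)) ?g)"
          using dp_P [of 1] cnt by (simp only: hd_simple_def num_def) (simp add: meet_greatest le_one)
        ultimately show False by (simp add: le_one)
      qed
      then have "lam x > 0" using lam_pos X_not_one [OF xX] by blast
      moreover have "lam (inv y) > 0"
        using lam_pos [of "inv y"] X_not_one [OF inv_X [OF yu(1)]] inv_X_P [OF yu(1)] False by blast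
      ultimately show ?thesis by (simp add: lam_inv)
    qed
    then show ?thesis
    proof
      assume "lam y < lam x"
      then have "(x, y) \<in> r - Id" using r [of x y] yu Cons.prems by auto
      then show ?thesis using 2 by (simp add: v shortlex_def lenlex_conv)
    next
      assume y: "y = x"
      have "word_prod G u = word_prod G w"
        using Cons.prems(5) v y by (metis gc uc inv_l word_prod_Cons)
      then have "u = w \<or> (w, u) \<in> shortlex r"
        using Cons.IH [of u] Cons.prems yu geodesic_tl [of x w] by auto
      then show ?thesis using v y by (auto simp: shortlex_def Cons_lenlex_iff)
    qed
  qed
qed

lemma ex_greedy:
  assumes "g \<in> carrier G"
  shows "\<exists>w\<in>lists X. word_prod G w = g \<and> length w = word_len G X g \<and> greedy w"
  using assms
proof (induction "word_len G X g" arbitrary: g)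
  case 0
  then obtain w where "w \<in> lists X" "word_prod G w = g" "length w = 0"
    using word_len_attained [of g] by metis
  then show ?case using 0 by (intro bexI [of _ "[]"]) auto
next
  case (Suc n)
  note gc [simp] = \<open>g \<in> carrier G\<close>
  obtain p q where pq: "p + q \<le> Suc n" and b: "le (dp (- int q)) g" "le g (dp (int p))"
    using word_len_le_iff [of g "Suc n"] Suc by auto
  have len: "Suc n \<le> p' + q'" if "le (dp (- int q')) g" "le g (dp (int p'))" for p' q'
    using word_len_le_iff [of g "p' + q'"] that Suc(2) by auto
  have sum: "p + q = Suc n" using len [OF b] pq by simp
  let ?x = "greedy_hd p q g"
  have pos: "p + q > 0" using sum by simp
  note hp = greedy_hd_props [OF gc b pos]
  have xc [simp]: "?x \<in> carrier G" by (rule hp(1))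
  define p' q' where "p' = p - 1" and "q' = (if p > 0 then q else q - 1)"
  have sum': "p' + q' = n" using sum by (auto simp: p'_def q'_def)
  have b': "le (dp (- int q')) (inv ?x \<otimes> g)" "le (inv ?x \<otimes> g) (dp (int p'))"
    using hp(4,5) by (simp_all add: p'_def q'_def)
  have ne: "?x \<noteq> \<one>"
  proof
    assume "?x = \<one>"
    then have "le (dp (- int q')) g" "le g (dp (int p'))" using b' by simp_all
    then show False using len [of q' p'] sum' by simp
  qed
  have xX: "?x \<in> X" and xP: "?x \<in> P \<longleftrightarrow> p > 0" using hp ne by blast+
  have "word_len G X (inv ?x \<otimes> g) \<le> n"
    using word_len_le_iff [of "inv ?x \<otimes> g" n] b' sum' by auto
  moreover have "Suc n \<le> Suc (word_len G X (inv ?x \<otimes> g))"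
    using word_len_mult [OF xX, of "inv ?x \<otimes> g"] Suc(2) by simp
  ultimately have n: "n = word_len G X (inv ?x \<otimes> g)" by simp
  then obtain w where w: "w \<in> lists X" "word_prod G w = inv ?x \<otimes> g"
      "length w = word_len G X (inv ?x \<otimes> g)" "greedy w"
    using Suc.hyps(1) [OF n m_closed [OF inv_closed [OF xc] gc]] by blast
  have "pc w = p'" "nc w = q'"
    using geodesic_counts [of w q' p'] w b' sum' n by simp_all
  then have "pc (?x # w) = p" "nc (?x # w) = q"
    using sum xP by (auto simp: p'_def q'_def)
  moreover have g: "word_prod G (?x # w) = g" using w by simp
  ultimately have "greedy (?x # w)" using w(4) by (simp only: greedy.simps)
  then show ?case using w xX g n Suc(2) by (intro bexI [of _ "?x # w"]) auto
qed

text \<open>A greedy word need not be geodesic: \<open>s \<Delta>^-1\<close> is greedy for every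
  \<open>s\<close> in \<open>S\<close>, although it equals a single negative letter if
  \<open>s\<close> differs from \<open>\<Delta>\<close>. The length condition comes from
  \<open>ConjGeo\<close>, whose words are in particular geodesic.\<close>

lemma ConjMinLenSL_eq:
  assumes lin: "linear_order_on X r"
    and r: "\<And>x y. x \<in> X \<Longrightarrow> y \<in> X \<Longrightarrow> lam y < lam x \<Longrightarrow> (x, y) \<in> r"
  shows "ConjMinLenSL G X r = ConjGeo G X \<inter> {w \<in> lists X. greedy w}"
proof -
  have "trans (r - Id)"
    using lin by (simp add: linear_order_on_def partial_order_on_def preorder_on_def trans_diff_Id)
  then have "(w, w) \<in> lenlex (r - Id)" if "(w, v) \<in> shortlex r" "(v, w) \<in> shortlex r" for v w
    using that transD [OF lenlex_transI] unfolding shortlex_def by blast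
  then have asym: "(v, w) \<notin> shortlex r" if "(w, v) \<in> shortlex r" for v w
    using that lenlex_irreflexive [of "r - Id"] by auto
  have rep: "shortlex_rep G X r (word_prod G w) = w"
    if w: "w \<in> lists X" "length w = word_len G X (word_prod G w)" "greedy w" for w
    unfolding shortlex_rep_def
  proof (rule the_equality)
    show "w \<in> lists X \<and> word_prod G w = word_prod G w \<and>
      (\<forall>v\<in>lists X. word_prod G v = word_prod G w \<longrightarrow> v = w \<or> (w, v) \<in> shortlex r)"
      using greedy_shortlex_least [OF r w] w(1) by blast
    fix u assume "u \<in> lists X \<and> word_prod G u = word_prod G w \<and>
      (\<forall>v\<in>lists X. word_prod G v = word_prod G w \<longrightarrow> v = u \<or> (u, v) \<in> shortlex r)"
    then show "u = w" using greedy_shortlex_least [OF r w, of u] w(1) asym by blast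
  qed
  show ?thesis
  proof (intro equalityI subsetI)
    fix u assume "u \<in> ConjMinLenSL G X r"
    then obtain g where g: "g \<in> carrier G" "word_len G X g = conj_len G X g" "u = shortlex_rep G X r g"
      unfolding ConjMinLenSL_def by blast
    obtain w where "w \<in> lists X" "word_prod G w = g" "length w = word_len G X g" "greedy w"
      using ex_greedy [OF g(1)] by blast
    then show "u \<in> ConjGeo G X \<inter> {w \<in> lists X. greedy w}"
      using rep [of w] g by (simp add: ConjGeo_def)
  next
    fix w assume w: "w \<in> ConjGeo G X \<inter> {w \<in> lists X. greedy w}"
    then have wX: "w \<in> lists X" and len: "length w = conj_len G X (word_prod G w)" and "greedy w"
      by (auto simp: ConjGeo_def)
    have gc: "word_prod G w \<in> carrier G" using wX by auto
    have "conj_len G X (word_prod G w) \<le> word_len G X (word_prod G w)"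
      by (rule conj_len_le [OF conjugates_self [OF gc]])
    then have geo: "length w = word_len G X (word_prod G w)" using word_len_le [OF wX] len by simp
    show "w \<in> ConjMinLenSL G X r"
      unfolding ConjMinLenSL_def using rep [OF wX geo \<open>greedy w\<close>] gc len geo by force
  qed
qed

text \<open>Ties in degree are broken by an arbitrary injection into the natural numbers. This is
  harmless: the first letter of a greedy geodesic and a different first letter of a competing
  geodesic never have equal degree.\<close>

lemma ex_letter_order:
  "\<exists>r. linear_order_on X r \<and> (\<forall>x\<in>X. \<forall>y\<in>X. lam y < lam x \<longrightarrow> (x, y) \<in> r)"
proof -
  obtain h :: "'a \<Rightarrow> nat" where h: "inj_on h X" using finite_X finite_imp_inj_to_nat_seg by metis
  define r where "r = {(x, y) \<in> X \<times> X. lam y < lam x \<or> lam x = lam y \<and> h x \<le> h y}"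
  have "linear_order_on X r"
    unfolding linear_order_on_def partial_order_on_def preorder_on_def
  proof (intro conjI)
    show "refl_on X r" by (auto simp: refl_on_def r_def)
    show "trans r" by (auto simp: trans_def r_def)
    show "antisym r" using h by (auto simp: antisym_def r_def inj_on_def)
    show "total_on X r" by (auto simp: total_on_def r_def)
  qed (auto simp: r_def)
  then show ?thesis by (intro exI [of _ r]) (auto simp: r_def)
qed

theorem regular_ConjMinLenSL:
  "\<exists>r. linear_order_on X r \<and> regular_language X (ConjMinLenSL G X r)"
proof -
  obtain r where "linear_order_on X r" "\<And>x y. x \<in> X \<Longrightarrow> y \<in> X \<Longrightarrow> lam y < lam x \<Longrightarrow> (x, y) \<in> r"
    using ex_letter_order by blast
  then show ?thesis
    using regular_language_Int [OF regular_ConjGeo regular_greedy] ConjMinLenSL_eq [of r] by auto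
qed

end

section \<open>Presentations\<close>

text \<open>With these rules \<open>auto\<close> would replace \<open>u \<in> lists A\<close> by a statement about \<open>set u\<close>, which
  conditional rewriting with premises \<open>u \<in> lists A\<close> then fails to discharge.\<close>

declare in_listsD [rule del] in_listsI [rule del]

lemma concat_in_lists: "ws \<in> lists (lists A) \<Longrightarrow> concat ws \<in> lists A"
  by (induction ws) auto

locale presentation =
  fixes A :: "'a set" and R :: "('a list \<times> 'a list) set"
begin

abbreviation eqv :: "'a list \<Rightarrow> 'a list \<Rightarrow> bool" (infix "\<approx>" 50) where
  "u \<approx> v \<equiv> (u, v) \<in> pres_cong A R"

abbreviation cls :: "'a list \<Rightarrow> 'a list set" where "cls \<equiv> word_class A R"

abbreviation M :: "'a list set monoid" where "M \<equiv> pres_monoid A R"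

lemma eqv_lists: "u \<approx> v \<Longrightarrow> u \<in> lists A \<and> v \<in> lists A"
  by (induction rule: pres_cong.induct) auto

lemma eqv_refl [simp]: "u \<in> lists A \<Longrightarrow> u \<approx> u" by (rule pres_cong.refl)
lemma eqv_sym: "u \<approx> v \<Longrightarrow> v \<approx> u" by (rule pres_cong.sym)
lemma eqv_trans [trans]: "u \<approx> v \<Longrightarrow> v \<approx> w \<Longrightarrow> u \<approx> w" by (rule pres_cong.trans)

lemma eqv_append_left: "u \<approx> v \<Longrightarrow> p \<in> lists A \<Longrightarrow> p @ u \<approx> p @ v"
proof (induction rule: pres_cong.induct)
  case (rel u v p' q)
  then show ?case using pres_cong.rel [of u v R A "p @ p'" q] by simp
qed (auto intro: pres_cong.intros)

lemma eqv_append_right: "u \<approx> v \<Longrightarrow> q \<in> lists A \<Longrightarrow> u @ q \<approx> v @ q"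
proof (induction rule: pres_cong.induct)
  case (rel u v p q')
  then show ?case using pres_cong.rel [of u v R A p "q' @ q"] by simp
qed (auto intro: pres_cong.intros)

lemma eqv_append: "u \<approx> v \<Longrightarrow> u' \<approx> v' \<Longrightarrow> u @ u' \<approx> v @ v'"
  using eqv_append_left [of u' v' u] eqv_append_right [of u v v'] eqv_lists by (meson eqv_trans)

lemma eqv_Cons: "u \<approx> v \<Longrightarrow> a \<in> A \<Longrightarrow> a # u \<approx> a # v"
  using eqv_append_left [of u v "[a]"] by simp

lemma eqv_rel: "(u, v) \<in> R \<Longrightarrow> u \<in> lists A \<Longrightarrow> v \<in> lists A \<Longrightarrow> u \<approx> v"
  using pres_cong.rel [of u v R A "[]" "[]"] by simp

lemma equiv_eqv: "equiv (lists A) (pres_cong A R)"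
  by (rule equivI) (auto simp: refl_on_def sym_def trans_def intro: eqv_sym eqv_trans dest: eqv_lists)

lemma cls_eq_iff: "u \<in> lists A \<Longrightarrow> v \<in> lists A \<Longrightarrow> cls u = cls v \<longleftrightarrow> u \<approx> v"
  unfolding word_class_def using eq_equiv_class_iff [OF equiv_eqv] by blast

lemma mem_cls [simp]: "v \<in> cls u \<longleftrightarrow> u \<approx> v"
  by (simp add: word_class_def)

lemma carrier_M: "carrier M = cls ` lists A"
  by (auto simp: pres_monoid_def quotient_def word_class_def)

lemma cls_carrier [simp, intro]: "u \<in> lists A \<Longrightarrow> cls u \<in> carrier M"
  by (simp add: carrier_M)

lemma one_M: "\<one>\<^bsub>M\<^esub> = cls []"
  by (simp add: pres_monoid_def)

lemma mult_M:
  assumes "u \<in> lists A" "v \<in> lists A"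
  shows "cls u \<otimes>\<^bsub>M\<^esub> cls v = cls (u @ v)"
proof -
  have "cls (u' @ v') = cls (u @ v)" if "u' \<in> cls u" "v' \<in> cls v" for u' v'
    using that eqv_append [of u u' v v'] eqv_lists by (metis cls_eq_iff eqv_sym mem_cls)
  then have "(\<Union>u'\<in>cls u. \<Union>v'\<in>cls v. cls (u' @ v')) = (\<Union>u'\<in>cls u. \<Union>v'\<in>cls v. cls (u @ v))"
    by (intro SUP_cong refl) simp_all
  moreover have "cls u \<noteq> {}" "cls v \<noteq> {}" using assms eqv_refl mem_cls by blast+
  ultimately show ?thesis by (simp add: pres_monoid_def)
qed

lemma monoid_M: "monoid M"
proof (rule monoidI)
  show "x \<otimes>\<^bsub>M\<^esub> y \<in> carrier M" if "x \<in> carrier M" "y \<in> carrier M" for x y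
    using that by (auto simp: carrier_M mult_M)
  show "\<one>\<^bsub>M\<^esub> \<in> carrier M" by (auto simp: carrier_M one_M)
  show "x \<otimes>\<^bsub>M\<^esub> y \<otimes>\<^bsub>M\<^esub> z = x \<otimes>\<^bsub>M\<^esub> (y \<otimes>\<^bsub>M\<^esub> z)"
    if "x \<in> carrier M" "y \<in> carrier M" "z \<in> carrier M" for x y z
    using that by (auto simp: carrier_M mult_M)
  show "\<one>\<^bsub>M\<^esub> \<otimes>\<^bsub>M\<^esub> x = x" "x \<otimes>\<^bsub>M\<^esub> \<one>\<^bsub>M\<^esub> = x" if "x \<in> carrier M" for x
    using that by (auto simp: carrier_M mult_M one_M)
qed

section \<open>Divisibility and cancellation in terms of words\<close>

definition ldvd :: "'a list \<Rightarrow> 'a list \<Rightarrow> bool" where "ldvd u v \<longleftrightarrow> (\<exists>z\<in>lists A. v \<approx> u @ z)"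
definition rdvd :: "'a list \<Rightarrow> 'a list \<Rightarrow> bool" where "rdvd u v \<longleftrightarrow> (\<exists>z\<in>lists A. v \<approx> z @ u)"

lemma divides_M: "u \<in> lists A \<Longrightarrow> v \<in> lists A \<Longrightarrow> cls u divides\<^bsub>M\<^esub> cls v \<longleftrightarrow> ldvd u v"
  by (auto simp: factor_def carrier_M ldvd_def mult_M cls_eq_iff)

lemma divides_opp: "u \<in> lists A \<Longrightarrow> v \<in> lists A \<Longrightarrow> cls u divides\<^bsub>opp_monoid M\<^esub> cls v \<longleftrightarrow> rdvd u v"
  by (auto simp: factor_def carrier_M rdvd_def mult_M cls_eq_iff opp_monoid_def)

lemma opp_carrier [simp]: "carrier (opp_monoid M) = carrier M"
  by (simp add: opp_monoid_def)

lemma ex_carrier_iff: "(\<exists>x\<in>carrier M. Q x) \<longleftrightarrow> (\<exists>u\<in>lists A. Q (cls u))"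
  by (auto simp: carrier_M)

lemma all_carrier_iff: "(\<forall>x\<in>carrier M. Q x) \<longleftrightarrow> (\<forall>u\<in>lists A. Q (cls u))"
  by (auto simp: carrier_M)

definition is_lcm :: "('a list \<Rightarrow> 'a list \<Rightarrow> bool) \<Rightarrow> 'a list \<Rightarrow> 'a list \<Rightarrow> 'a list \<Rightarrow> bool" where
  "is_lcm dv z x y \<longleftrightarrow> dv x z \<and> dv y z \<and> (\<forall>u\<in>lists A. dv x u \<and> dv y u \<longrightarrow> dv z u)"

definition is_gcd :: "('a list \<Rightarrow> 'a list \<Rightarrow> bool) \<Rightarrow> 'a list \<Rightarrow> 'a list \<Rightarrow> 'a list \<Rightarrow> bool" where
  "is_gcd dv z x y \<longleftrightarrow> dv z x \<and> dv z y \<and> (\<forall>u\<in>lists A. dv u x \<and> dv u y \<longrightarrow> dv u z)"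

lemma has_lcms_gcds_M: "has_lcms_gcds M \<longleftrightarrow> (\<forall>x\<in>lists A. \<forall>y\<in>lists A.
    (\<exists>z\<in>lists A. is_lcm ldvd z x y) \<and> (\<exists>z\<in>lists A. is_gcd ldvd z x y))"
  unfolding has_lcms_gcds_def islcm_def isgcd_def ex_carrier_iff all_carrier_iff
  by (simp add: divides_M is_lcm_def is_gcd_def cong: ball_cong bex_cong)

lemma has_lcms_gcds_opp: "has_lcms_gcds (opp_monoid M) \<longleftrightarrow> (\<forall>x\<in>lists A. \<forall>y\<in>lists A.
    (\<exists>z\<in>lists A. is_lcm rdvd z x y) \<and> (\<exists>z\<in>lists A. is_gcd rdvd z x y))"
  unfolding has_lcms_gcds_def islcm_def isgcd_def opp_carrier ex_carrier_iff all_carrier_iff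
  by (simp add: divides_opp is_lcm_def is_gcd_def cong: ball_cong bex_cong)

lemma monoid_cancel_M_iff: "monoid_cancel M \<longleftrightarrow>
    (\<forall>u\<in>lists A. \<forall>v\<in>lists A. \<forall>w\<in>lists A. (w @ u \<approx> w @ v \<longrightarrow> u \<approx> v) \<and> (u @ w \<approx> v @ w \<longrightarrow> u \<approx> v))"
  (is "_ \<longleftrightarrow> ?R")
proof
  assume "monoid_cancel M"
  then interpret monoid_cancel M .
  show ?R
  proof (intro ballI conjI impI)
    fix u v w assume [simp]: "u \<in> lists A" "v \<in> lists A" "w \<in> lists A"
    { assume "w @ u \<approx> w @ v"
      then have "cls w \<otimes>\<^bsub>M\<^esub> cls u = cls w \<otimes>\<^bsub>M\<^esub> cls v" by (simp add: mult_M cls_eq_iff)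
      then show "u \<approx> v" using l_cancel [of "cls w" "cls u" "cls v"] by (simp add: cls_eq_iff) }
    { assume "u @ w \<approx> v @ w"
      then have "cls u \<otimes>\<^bsub>M\<^esub> cls w = cls v \<otimes>\<^bsub>M\<^esub> cls w" by (simp add: mult_M cls_eq_iff)
      then show "u \<approx> v" using r_cancel [of "cls u" "cls w" "cls v"] by (simp add: cls_eq_iff) }
  qed
next
  assume r: ?R
  interpret monoid M by (rule monoid_M)
  show "monoid_cancel M"
  proof (rule monoid_cancelI)
    fix a b c
    assume "a \<in> carrier M" "b \<in> carrier M" "c \<in> carrier M"
    then obtain u v w where abc: "a = cls u" "b = cls v" "c = cls w" "u \<in> lists A" "v \<in> lists A" "w \<in> lists A"
      by (auto simp: carrier_M)
    { assume "c \<otimes>\<^bsub>M\<^esub> a = c \<otimes>\<^bsub>M\<^esub> b"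
      then have "w @ u \<approx> w @ v" using abc(4-6) by (simp add: abc(1-3) mult_M cls_eq_iff)
      then have "u \<approx> v" using r abc(4-6) by blast
      then show "a = b" using abc(4-6) by (simp add: abc(1-3) cls_eq_iff) }
    { assume "a \<otimes>\<^bsub>M\<^esub> c = b \<otimes>\<^bsub>M\<^esub> c"
      then have "u @ w \<approx> v @ w" using abc(4-6) by (simp add: abc(1-3) mult_M cls_eq_iff)
      then have "u \<approx> v" using r abc(4-6) by blast
      then show "a = b" using abc(4-6) by (simp add: abc(1-3) cls_eq_iff) }
  qed
qed

lemma word_prod_cls: "ws \<in> lists (lists A) \<Longrightarrow> word_prod M (map cls ws) = cls (concat ws)"
  by (induction ws) (auto simp: word_prod_def one_M mult_M concat_in_lists)

end

section \<open>The group given by a presentation\<close>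

lemma pos_word_simps [simp]: "pos_word [] = []" "pos_word (a # u) = (a, True) # pos_word u"
  "pos_word (u @ v) = pos_word u @ pos_word v"
  by (simp_all add: pos_word_def)

lemma pos_word_lists [simp]: "pos_word u \<in> lists (group_letters A) \<longleftrightarrow> u \<in> lists A"
  by (induction u) (auto simp: group_letters_def)

context presentation
begin

interpretation grp: presentation "group_letters A" "group_rels A R" .

definition word_inv :: "('a \<times> bool) list \<Rightarrow> ('a \<times> bool) list" where
  "word_inv w = rev (map (\<lambda>(a, e). (a, \<not> e)) w)"

lemma word_inv_lists: "w \<in> lists (group_letters A) \<Longrightarrow> word_inv w \<in> lists (group_letters A)"
  by (induction w) (auto simp: word_inv_def group_letters_def)

lemma word_inv_inv [simp]: "word_inv (word_inv w) = w"
  by (induction w) (auto simp: word_inv_def)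

lemma cancel_letter: "a \<in> A \<Longrightarrow> grp.eqv [(a, e), (a, \<not> e)] []"
  by (rule grp.eqv_rel) (auto simp: group_rels_def group_letters_def)

lemma word_inv_right: "w \<in> lists (group_letters A) \<Longrightarrow> grp.eqv (w @ word_inv w) []"
proof (induction w)
  case (Cons x w)
  obtain a e where x: "x = (a, e)" by fastforce
  have a: "a \<in> A" using Cons x by (auto simp: group_letters_def)
  have l: "[x] \<in> lists (group_letters A)" "[(a, \<not> e)] \<in> lists (group_letters A)"
    using a x by (auto simp: group_letters_def)
  have "grp.eqv ([x] @ (w @ word_inv w) @ [(a, \<not> e)]) ([x] @ [] @ [(a, \<not> e)])"
    using Cons l by (intro grp.eqv_append_left grp.eqv_append_right) auto
  moreover have "[x] @ (w @ word_inv w) @ [(a, \<not> e)] = (x # w) @ word_inv (x # w)"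
    by (simp add: word_inv_def x)
  moreover have "grp.eqv ([x] @ [] @ [(a, \<not> e)]) []" using cancel_letter [OF a, of e] x by simp
  ultimately show ?case by (simp only:) (rule grp.eqv_trans)
qed (simp add: word_inv_def)

lemma group_pres_group: "group (pres_group A R)"
proof -
  interpret monoid "pres_group A R" unfolding pres_group_def by (rule grp.monoid_M)
  show ?thesis
  proof (rule groupI)
    fix x assume "x \<in> carrier (pres_group A R)"
    then obtain w where w: "w \<in> lists (group_letters A)" "x = grp.cls w"
      by (auto simp: pres_group_def grp.carrier_M)
    have "grp.cls (word_inv w) \<otimes>\<^bsub>pres_group A R\<^esub> x = \<one>\<^bsub>pres_group A R\<^esub>"
      unfolding pres_group_def using w word_inv_lists [OF w(1)] word_inv_right [OF word_inv_lists [OF w(1)]]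
      by (simp add: grp.mult_M grp.one_M grp.cls_eq_iff)
    then show "\<exists>y\<in>carrier (pres_group A R). y \<otimes>\<^bsub>pres_group A R\<^esub> x = \<one>\<^bsub>pres_group A R\<^esub>"
      using word_inv_lists [OF w(1)] by (auto simp: pres_group_def intro!: bexI)
  qed (auto simp: m_assoc)
qed

lemma pos_word_eqv: "u \<approx> v \<Longrightarrow> grp.eqv (pos_word u) (pos_word v)"
proof (induction rule: pres_cong.induct)
  case (rel u v p q)
  have "grp.eqv (pos_word p @ pos_word u @ pos_word q) (pos_word p @ pos_word v @ pos_word q)"
    using rel by (intro pres_cong.rel) (auto simp: group_rels_def)
  then show ?case by simp
qed (auto intro: pres_cong.intros)

definition degree :: "('a \<times> bool) list \<Rightarrow> int" where
  "degree w = (\<Sum>(a, e)\<leftarrow>w. if e then 1 else - 1)"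

lemma degree_simps [simp]: "degree [] = 0" "degree (x # w) = (if snd x then 1 else - 1) + degree w"
  "degree (u @ v) = degree u + degree v" "degree (pos_word w') = int (length w')"
proof -
  show "degree (pos_word w') = int (length w')" by (induction w') (simp_all add: degree_def)
qed (simp_all add: degree_def split_beta)

end

locale homogeneous_presentation = presentation +
  assumes hom: "(u, v) \<in> R \<Longrightarrow> length u = length v"
begin

interpretation grp: presentation "group_letters A" "group_rels A R" .

lemma eqv_length: "u \<approx> v \<Longrightarrow> length u = length v"
  by (induction rule: pres_cong.induct) (auto dest: hom)

text \<open>Positive relations preserve the exponent sum by homogeneity, the cancellation relations
  because their two letters contribute opposite signs. This gives the degree \<open>deg\<close> on
  the group.\<close>

lemma eqv_degree: "grp.eqv u v \<Longrightarrow> degree u = degree v"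
  by (induction rule: pres_cong.induct) (auto simp: group_rels_def dest: hom)

end

locale garside_presentation = homogeneous_presentation A R
  for A :: "'a set" and R +
  fixes \<Delta> :: "'a list set"
  assumes gm: "garside_monoid M" and ge: "garside_element M \<Delta>"
begin

interpretation grp: presentation "group_letters A" "group_rels A R" .

lemma cancel_left: "w @ u \<approx> w @ v \<Longrightarrow> u \<approx> v"
  and cancel_right: "u @ w \<approx> v @ w \<Longrightarrow> u \<approx> v"
proof -
  have c: "monoid_cancel M" using gm by (simp add: garside_monoid_def)
  show "w @ u \<approx> w @ v \<Longrightarrow> u \<approx> v" using c eqv_lists [of "w @ u" "w @ v"] unfolding monoid_cancel_M_iff by auto
  show "u @ w \<approx> v @ w \<Longrightarrow> u \<approx> v" using c eqv_lists [of "u @ w" "v @ w"] unfolding monoid_cancel_M_iff by auto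
qed

section \<open>Divisors of \<open>\<Delta>\<close> and conjugation by
  \<open>\<Delta>\<close>\<close>

definition dw :: "'a list" where "dw = (SOME u. u \<in> lists A \<and> \<Delta> = cls u)"

lemma dw: "dw \<in> lists A" "cls dw = \<Delta>"
proof -
  have "\<exists>u. u \<in> lists A \<and> \<Delta> = cls u" using ge by (auto simp: garside_element_def carrier_M)
  from someI_ex [OF this] show "dw \<in> lists A" "cls dw = \<Delta>" unfolding dw_def by (blast, metis (mono_tags, lifting))
qed

lemma left_divisors_D: "left_divisors M \<Delta> = {cls u |u. u \<in> lists A \<and> ldvd u dw}"
proof -
  have "left_divisors M (cls dw) = {cls u |u. u \<in> lists A \<and> ldvd u dw}"
    using dw(1) by (auto simp: left_divisors_def carrier_M divides_M)
  then show ?thesis by (simp only: dw(2))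
qed

lemma right_divisors_D: "right_divisors M \<Delta> = {cls u |u. u \<in> lists A \<and> rdvd u dw}"
proof -
  have "right_divisors M (cls dw) = {cls u |u. u \<in> lists A \<and> rdvd u dw}"
    using dw(1) by (auto simp: right_divisors_def left_divisors_def carrier_M divides_opp)
  then show ?thesis by (simp only: dw(2))
qed

lemma dvd_cong: "u \<approx> u' \<Longrightarrow> ldvd u v \<longleftrightarrow> ldvd u' v" "u \<approx> u' \<Longrightarrow> rdvd u v \<longleftrightarrow> rdvd u' v"
  unfolding ldvd_def rdvd_def
  by (meson eqv_append_left eqv_append_right eqv_sym eqv_trans)+

lemma ldvd_iff_rdvd: "u \<in> lists A \<Longrightarrow> ldvd u dw \<longleftrightarrow> rdvd u dw"
proof -
  assume u: "u \<in> lists A"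
  have "left_divisors M \<Delta> = right_divisors M \<Delta>" using ge by (simp add: garside_element_def)
  moreover have "ldvd u dw \<longleftrightarrow> cls u \<in> left_divisors M \<Delta>" "rdvd u dw \<longleftrightarrow> cls u \<in> right_divisors M \<Delta>"
  proof -
    have "(\<exists>v. cls u = cls v \<and> v \<in> lists A \<and> Q v) \<longleftrightarrow> Q u" if "\<And>v. u \<approx> v \<Longrightarrow> Q u \<longleftrightarrow> Q v" for Q
      using that u by (metis cls_eq_iff)
    from this [of "\<lambda>v. ldvd v dw"] this [of "\<lambda>v. rdvd v dw"]
    show "ldvd u dw \<longleftrightarrow> cls u \<in> left_divisors M \<Delta>" "rdvd u dw \<longleftrightarrow> cls u \<in> right_divisors M \<Delta>"
      unfolding left_divisors_D right_divisors_D using dvd_cong by simp_all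
  qed
  ultimately show ?thesis by simp
qed

text \<open>By homogeneity a letter that is a product of divisors of \<open>\<Delta>\<close> is one of the factors.\<close>

lemma letter_ldvd: "a \<in> A \<Longrightarrow> ldvd [a] dw"
proof -
  assume a: "a \<in> A"
  have "word_prod M ` lists (left_divisors M \<Delta>) = carrier M"
    using ge unfolding garside_element_def generates_monoid_def by blast
  then obtain ds where ds: "ds \<in> lists (left_divisors M \<Delta>)" "word_prod M ds = cls [a]"
    using a by (metis (no_types, lifting) cls_carrier image_iff lists.Cons lists.Nil)
  have "\<exists>ws\<in>lists {u \<in> lists A. ldvd u dw}. ds = map cls ws"
    using ds(1)
  proof (induction ds)
    case (Cons d ds)
    then obtain ws u where "ws \<in> lists {u \<in> lists A. ldvd u dw}" "ds = map cls ws" "d = cls u"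
      "u \<in> lists A" "ldvd u dw" by (auto simp: left_divisors_D)
    then show ?case by (intro bexI [of _ "u # ws"]) auto
  qed auto
  then obtain ws where ws: "ws \<in> lists {u \<in> lists A. ldvd u dw}" "ds = map cls ws" by blast
  have ll: "ws \<in> lists (lists A)" using ws(1) by (induction ws) auto
  then have "cls (concat ws) = cls [a]" using ds(2) word_prod_cls [of ws] by (simp only: ws(2))
  moreover have "concat ws \<in> lists A" using ll by (rule concat_in_lists)
  ultimately have "concat ws \<approx> [a]" using a by (simp add: cls_eq_iff)
  with ws(1) show "ldvd [a] dw"
  proof (induction ws)
    case Nil
    then show ?case using eqv_length by fastforce
  next
    case (Cons u ws)
    show ?case
    proof (cases "u = []")
      case False
      moreover have "length u + length (concat ws) = 1" using eqv_length [OF Cons.prems] by simp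
      ultimately have "concat ws = []" by (cases u) auto
      then have "u \<approx> [a]" using Cons.prems by (simp del: concat_eq_Nil_conv)
      then show ?thesis using dvd_cong(1) Cons.hyps by auto
    qed (use Cons in auto)
  qed
qed

text \<open>If \<open>\<Delta> = a b\<close>, then the right divisor \<open>b\<close> of
  \<open>\<Delta>\<close> is also a left divisor, \<open>\<Delta> = b c\<close>, and
  \<open>a \<Delta> = a b c = \<Delta> c\<close>. This is repeated letter by letter.\<close>

lemma ex_D_left: "x \<in> lists A \<Longrightarrow> \<exists>y\<in>lists A. x @ dw \<approx> dw @ y"
proof (induction x)
  case (Cons a x)
  then obtain y where y: "y \<in> lists A" "x @ dw \<approx> dw @ y" by auto
  have a: "a \<in> A" using Cons by auto
  obtain b where b: "b \<in> lists A" "dw \<approx> [a] @ b" using letter_ldvd [OF a] by (auto simp: ldvd_def)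
  then have "rdvd b dw" using a by (auto simp: rdvd_def intro!: bexI [of _ "[a]"])
  then obtain c where c: "c \<in> lists A" "dw \<approx> b @ c" using ldvd_iff_rdvd [OF b(1)] by (auto simp: ldvd_def)
  have "(a # x) @ dw \<approx> [a] @ dw @ y" using eqv_append_left [OF y(2), of "[a]"] a by simp
  also have "[a] @ dw @ y \<approx> [a] @ (b @ c) @ y"
    using c y a by (intro eqv_append_left eqv_append_right) auto
  also have "[a] @ (b @ c) @ y = ([a] @ b) @ c @ y" by simp
  also have "\<dots> \<approx> dw @ c @ y" using b c y by (intro eqv_append_right eqv_sym [OF b(2)]) auto
  finally show ?case using c y by (intro bexI [of _ "c @ y"]) auto
qed (use dw(1) in \<open>auto intro!: bexI [of _ "[]"]\<close>)

lemma ex_D_right: "x \<in> lists A \<Longrightarrow> \<exists>y\<in>lists A. dw @ x \<approx> y @ dw"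
proof (induction x rule: rev_induct)
  case (snoc a x)
  then obtain y where y: "y \<in> lists A" "dw @ x \<approx> y @ dw" by auto
  have a: "a \<in> A" using snoc by auto
  have "rdvd [a] dw" using letter_ldvd [OF a] ldvd_iff_rdvd [of "[a]"] a by auto
  then obtain b where b: "b \<in> lists A" "dw \<approx> b @ [a]" by (auto simp: rdvd_def)
  then have "ldvd b dw" using a by (auto simp: ldvd_def intro!: bexI [of _ "[a]"])
  then obtain c where c: "c \<in> lists A" "dw \<approx> c @ b" using ldvd_iff_rdvd [OF b(1)] by (auto simp: rdvd_def)
  have "dw @ x @ [a] \<approx> y @ dw @ [a]" using eqv_append_right [OF y(2), of "[a]"] a by simp
  also have "y @ dw @ [a] \<approx> y @ (c @ b) @ [a]"
    using c y a by (intro eqv_append_left eqv_append_right) auto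
  also have "y @ (c @ b) @ [a] = (y @ c) @ b @ [a]" by simp
  also have "\<dots> \<approx> (y @ c) @ dw" using b c y by (intro eqv_append_left eqv_sym [OF b(2)]) auto
  finally show ?case using c y by (intro bexI [of _ "y @ c"]) auto
qed (use dw(1) in \<open>auto intro!: bexI [of _ "[]"]\<close>)

subsection \<open>The monoid embeds into the group\<close>

definition tau :: "'a list \<Rightarrow> 'a list" where "tau x = (SOME y. y \<in> lists A \<and> x @ dw \<approx> dw @ y)"

lemma tau: assumes "x \<in> lists A" shows "tau x \<in> lists A" "x @ dw \<approx> dw @ tau x"
  using someI_ex [OF ex_D_left [OF assms, unfolded Bex_def]] unfolding tau_def by blast+

definition compl :: "'a \<Rightarrow> 'a list" where "compl a = (SOME y. y \<in> lists A \<and> dw \<approx> a # y)"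

lemma compl: assumes "a \<in> A" shows "compl a \<in> lists A" "dw \<approx> a # compl a"
proof -
  have "\<exists>y. y \<in> lists A \<and> dw \<approx> a # y" using letter_ldvd [OF assms] by (auto simp: ldvd_def)
  from someI_ex [OF this] show "compl a \<in> lists A" "dw \<approx> a # compl a" unfolding compl_def by blast+
qed

text \<open>A pair \<open>(x, n)\<close> stands for the fraction \<open>x \<Delta>\<^sup>-\<^sup>n\<close>; the group acts on
  the fractions by left multiplication.\<close>

definition dpow :: "nat \<Rightarrow> 'a list" where "dpow n = concat (replicate n dw)"

lemma dpow_lists [simp]: "dpow n \<in> lists A"
  using dw(1) by (induction n) (auto simp: dpow_def)

lemma dpow_add: "dpow (m + n) = dpow m @ dpow n"
  by (simp add: dpow_def replicate_add)

lemma dpow_Suc: "dpow (Suc n) = dw @ dpow n" "dpow (Suc n) = dpow n @ dw"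
  using dpow_add [of n 1] by (simp_all add: dpow_def)

text \<open>Cross multiplication decides \<open>x \<Delta>^-n = y \<Delta>^-k\<close> because all
  denominators are powers of the same element and commute with each other.\<close>

definition frac_eq :: "'a list \<times> nat \<Rightarrow> 'a list \<times> nat \<Rightarrow> bool" where
  "frac_eq z z' \<longleftrightarrow> fst z @ dpow (snd z') \<approx> fst z' @ dpow (snd z)"

lemma frac_eq_refl: "fst z \<in> lists A \<Longrightarrow> frac_eq z z"
  by (simp add: frac_eq_def)

lemma frac_eq_sym: "frac_eq z z' \<Longrightarrow> frac_eq z' z"
  by (auto simp: frac_eq_def intro: eqv_sym)

lemma frac_eq_trans: "frac_eq z z' \<Longrightarrow> frac_eq z' z'' \<Longrightarrow> frac_eq z z''"
proof -
  obtain x n y k w j where z: "z = (x, n)" "z' = (y, k)" "z'' = (w, j)" by (metis prod.exhaust)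
  assume "frac_eq z z'" "frac_eq z' z''"
  then have 1: "x @ dpow k \<approx> y @ dpow n" and 2: "y @ dpow j \<approx> w @ dpow k" by (simp_all add: z frac_eq_def)
  have comm: "dpow m @ dpow m' = dpow m' @ dpow m" for m m' by (simp add: add.commute flip: dpow_add)
  have "(x @ dpow k) @ dpow j \<approx> (y @ dpow n) @ dpow j" using 1 by (intro eqv_append_right) auto
  also have "(y @ dpow n) @ dpow j = (y @ dpow j) @ dpow n" using comm [of n j] by simp
  also have "\<dots> \<approx> (w @ dpow k) @ dpow n" using 2 by (intro eqv_append_right) auto
  finally have "(x @ dpow j) @ dpow k \<approx> (w @ dpow n) @ dpow k" using comm [of k j] comm [of k n] by simp
  then have "x @ dpow j \<approx> w @ dpow n" by (rule cancel_right)
  then show ?thesis by (simp add: z frac_eq_def)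
qed

text \<open>The inverse letter is computed by \<open>a^-1 = compl a \<Delta>^-1\<close> and
  \<open>\<Delta>^-1 x = tau x \<Delta>^-1\<close>, which raises the exponent of the denominator by
  one.\<close>

fun act1 :: "'a \<times> bool \<Rightarrow> 'a list \<times> nat \<Rightarrow> 'a list \<times> nat" where
  "act1 (a, True) (x, n) = (a # x, n)"
| "act1 (a, False) (x, n) = (compl a @ tau x, Suc n)"

definition act :: "('a \<times> bool) list \<Rightarrow> 'a list \<times> nat \<Rightarrow> 'a list \<times> nat" where
  "act w z = foldr act1 w z"

lemma act_simps [simp]: "act [] z = z" "act (l # w) z = act1 l (act w z)" "act (u @ v) z = act u (act v z)"
  by (simp_all add: act_def)

lemma act1_valid: "l \<in> group_letters A \<Longrightarrow> fst z \<in> lists A \<Longrightarrow> fst (act1 l z) \<in> lists A"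
  by (cases "(l, z)" rule: act1.cases) (auto simp: group_letters_def compl tau)

lemma act_valid: "w \<in> lists (group_letters A) \<Longrightarrow> fst z \<in> lists A \<Longrightarrow> fst (act w z) \<in> lists A"
  by (induction w) (auto simp: act1_valid)

lemma tau_dpow: "x \<in> lists A \<Longrightarrow> dw @ tau x @ dpow k \<approx> (x @ dpow k) @ dw"
proof -
  assume x: "x \<in> lists A"
  have "(dw @ tau x) @ dpow k \<approx> (x @ dw) @ dpow k"
    using tau(2) [OF x] by (intro eqv_append_right eqv_sym [OF tau(2) [OF x]]) auto
  then show ?thesis using dpow_Suc [of k] by simp
qed

lemma act1_cong:
  assumes l: "l \<in> group_letters A" and v: "fst z \<in> lists A" "fst z' \<in> lists A" and eq: "frac_eq z z'"
  shows "frac_eq (act1 l z) (act1 l z')"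
proof -
  obtain a e x n y k where z: "l = (a, e)" "z = (x, n)" "z' = (y, k)" by (metis prod.exhaust)
  have a: "a \<in> A" using l z by (simp add: group_letters_def)
  have 1: "x @ dpow k \<approx> y @ dpow n" using eq by (simp add: z frac_eq_def)
  show ?thesis
  proof (cases e)
    case True
    then show ?thesis using eqv_Cons [OF 1 a] by (simp add: z frac_eq_def)
  next
    case False
    have "dw @ tau x @ dpow (Suc k) \<approx> (x @ dpow (Suc k)) @ dw" using tau_dpow v z by simp
    also have "(x @ dpow (Suc k)) @ dw = (x @ dpow k) @ dw @ dw" by (simp add: dpow_Suc(2))
    also have "\<dots> \<approx> (y @ dpow n) @ dw @ dw" using dw(1) by (intro eqv_append_right 1) auto
    also have "(y @ dpow n) @ dw @ dw = (y @ dpow (Suc n)) @ dw" by (simp add: dpow_Suc(2))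
    also have "\<dots> \<approx> dw @ tau y @ dpow (Suc n)" using tau_dpow v z by (auto intro: eqv_sym)
    finally have "tau x @ dpow (Suc k) \<approx> tau y @ dpow (Suc n)" by (rule cancel_left)
    then show ?thesis using eqv_append_left [of _ _ "compl a"] compl [OF a] False
      by (simp add: z frac_eq_def)
  qed
qed

lemma act_cong:
  assumes "w \<in> lists (group_letters A)" "fst z \<in> lists A" "fst z' \<in> lists A" "frac_eq z z'"
  shows "frac_eq (act w z) (act w z')"
  using assms by (induction w) (auto intro: act1_cong act_valid)

lemma act_pos: "act (pos_word u) (x, n) = (u @ x, n)"
  by (induction u) auto

lemma act_cancel:
  assumes a: "a \<in> A" and x: "x \<in> lists A"
  shows "frac_eq (act1 (a, e) (act1 (a, \<not> e) (x, n))) (x, n)"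
proof (cases e)
  case True
  have "((a # compl a) @ tau x) @ dpow n \<approx> (dw @ tau x) @ dpow n"
    by (intro eqv_append_right eqv_sym [OF compl(2) [OF a]]) (auto simp: tau x)
  also have "(dw @ tau x) @ dpow n \<approx> (x @ dw) @ dpow n"
    by (intro eqv_append_right eqv_sym [OF tau(2) [OF x]]) auto
  finally show ?thesis using True by (simp add: frac_eq_def dpow_Suc(1))
next
  case False
  have ax: "a # x \<in> lists A" using a x by auto
  have "(a # compl a) @ tau (a # x) \<approx> dw @ tau (a # x)"
    by (intro eqv_append_right eqv_sym [OF compl(2) [OF a]]) (rule tau(1) [OF ax])
  also have "dw @ tau (a # x) \<approx> (a # x) @ dw" by (rule eqv_sym [OF tau(2) [OF ax]])
  finally have "[a] @ compl a @ tau (a # x) \<approx> [a] @ x @ dw" by simp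
  then have "compl a @ tau (a # x) \<approx> x @ dw" by (rule cancel_left)
  then have "(compl a @ tau (a # x)) @ dpow n \<approx> (x @ dw) @ dpow n" by (intro eqv_append_right) auto
  then show ?thesis using False by (simp add: frac_eq_def dpow_Suc(1))
qed

lemma act_eqv: "grp.eqv u v \<Longrightarrow> fst z \<in> lists A \<Longrightarrow> frac_eq (act u z) (act v z)"
proof (induction arbitrary: z rule: pres_cong.induct)
  case (refl u)
  then show ?case by (intro frac_eq_refl act_valid)
next
  case (rel u v p q)
  obtain x n where xn: "act q z = (x, n)" "x \<in> lists A"
    using act_valid [of q z] rel by (metis fst_conv prod.exhaust)
  have "frac_eq (act u (x, n)) (act v (x, n))"
  proof -
    from rel(1) consider u' v' where "u = pos_word u'" "v = pos_word v'" "(u', v') \<in> R"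
      | a e where "u = [(a, e), (a, \<not> e)]" "v = []" "a \<in> A" by (auto simp: group_rels_def)
    then show ?thesis
    proof cases
      case 1
      then have "u' \<approx> v'" using rel by (intro eqv_rel) auto
      then show ?thesis using xn by (simp add: 1 act_pos frac_eq_def eqv_append_right)
    qed (use act_cancel xn in auto)
  qed
  then show ?case using rel xn act_valid [of u "(x, n)"] act_valid [of v "(x, n)"] by (auto intro: act_cong)
next
  case (sym u v)
  then show ?case by (intro frac_eq_sym [OF sym.IH])
next
  case (trans u v w)
  then show ?case by (intro frac_eq_trans [OF trans.IH])
qed

text \<open>Words equal in the group act equally on the trivial fraction, and a positive word takes
  it to the fraction with itself as numerator and trivial denominator.\<close>

lemma pos_word_inj:
  assumes "grp.eqv (pos_word u) (pos_word v)"
  shows "u \<approx> v"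
  using act_eqv [OF assms, of "([], 0)"] by (simp add: act_pos frac_eq_def dpow_def)

end

section \<open>Garside presentations\<close>

context presentation
begin

interpretation grp: presentation "group_letters A" "group_rels A R" .

definition emb :: "'a list \<Rightarrow> ('a \<times> bool) list set" where
  "emb u = word_class (group_letters A) (group_rels A R) (pos_word u)"

definition pos_part :: "('a \<times> bool) list set set" where "pos_part = emb ` lists A"

definition deg :: "('a \<times> bool) list set \<Rightarrow> int" where
  "deg g = degree (SOME w. w \<in> lists (group_letters A) \<and>
     g = word_class (group_letters A) (group_rels A R) w)"

end

context garside_presentation
begin

interpretation grp: presentation "group_letters A" "group_rels A R" .

interpretation G: group "pres_group A R" by (rule group_pres_group)

abbreviation G where "G \<equiv> pres_group A R"

lemma carrier_G: "carrier G = grp.cls ` lists (group_letters A)"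
  by (simp add: pres_group_def grp.carrier_M)

lemma emb_carrier [simp, intro]: "u \<in> lists A \<Longrightarrow> emb u \<in> carrier G"
  by (simp add: carrier_G emb_def)

lemma emb_mult: "u \<in> lists A \<Longrightarrow> v \<in> lists A \<Longrightarrow> emb u \<otimes>\<^bsub>G\<^esub> emb v = emb (u @ v)"
  by (simp add: pres_group_def emb_def grp.mult_M)

lemma emb_Nil: "\<one>\<^bsub>G\<^esub> = emb []"
  by (simp add: pres_group_def emb_def grp.one_M)

lemma emb_eq_iff: "u \<in> lists A \<Longrightarrow> v \<in> lists A \<Longrightarrow> emb u = emb v \<longleftrightarrow> u \<approx> v"
  using pos_word_inj pos_word_eqv by (auto simp: emb_def grp.cls_eq_iff)

lemma deg_cls:
  assumes "w \<in> lists (group_letters A)"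
  shows "deg (grp.cls w) = degree w"
proof -
  have "\<exists>v. v \<in> lists (group_letters A) \<and> grp.cls w = grp.cls v" using assms by blast
  from someI_ex [OF this]
  have v: "(SOME v. v \<in> lists (group_letters A) \<and> grp.cls w = grp.cls v) \<in> lists (group_letters A)"
    "grp.eqv w (SOME v. v \<in> lists (group_letters A) \<and> grp.cls w = grp.cls v)"
    using assms by (auto simp: grp.cls_eq_iff)
  show ?thesis unfolding deg_def using eqv_degree [OF v(2)] by simp
qed

lemma deg_emb: "u \<in> lists A \<Longrightarrow> deg (emb u) = int (length u)"
  by (simp add: emb_def deg_cls)

lemma inv_emb_mult:
  assumes "u \<in> lists A" "v \<in> lists A"
  shows "inv\<^bsub>G\<^esub> (emb u) \<otimes>\<^bsub>G\<^esub> emb v \<in> pos_part \<longleftrightarrow> ldvd u v"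
proof -
  have "inv\<^bsub>G\<^esub> (emb u) \<otimes>\<^bsub>G\<^esub> emb v = emb z \<longleftrightarrow> v \<approx> u @ z" if "z \<in> lists A" for z
    using G.inv_solve_left' [of "emb z" "emb u" "emb v"] assms that by (simp add: emb_mult emb_eq_iff)
  then show ?thesis by (auto simp: pos_part_def ldvd_def)
qed

lemma emb_mult_inv:
  assumes "u \<in> lists A" "v \<in> lists A"
  shows "emb v \<otimes>\<^bsub>G\<^esub> inv\<^bsub>G\<^esub> (emb u) \<in> pos_part \<longleftrightarrow> rdvd u v"
proof -
  have "emb v \<otimes>\<^bsub>G\<^esub> inv\<^bsub>G\<^esub> (emb u) = emb z \<longleftrightarrow> v \<approx> z @ u" if "z \<in> lists A" for z
    using G.inv_solve_right' [of "emb z" "emb v" "emb u"] assms that by (auto simp: emb_mult emb_eq_iff)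
  then show ?thesis by (auto simp: pos_part_def rdvd_def)
qed

lemma cls_letter:
  assumes "a \<in> A"
  shows "grp.cls [(a, True)] = emb [a]" "grp.cls [(a, False)] = inv\<^bsub>G\<^esub> (emb [a])"
proof -
  have l: "[(a, False)] \<in> lists (group_letters A)" "[(a, True)] \<in> lists (group_letters A)"
    using assms by (auto simp: group_letters_def)
  show "grp.cls [(a, True)] = emb [a]" by (simp add: emb_def)
  have "grp.cls [(a, False)] \<otimes>\<^bsub>G\<^esub> emb [a] = \<one>\<^bsub>G\<^esub>"
    using l cancel_letter [OF assms, of False]
    by (simp add: emb_def pres_group_def grp.mult_M grp.one_M grp.cls_eq_iff)
  then show "grp.cls [(a, False)] = inv\<^bsub>G\<^esub> (emb [a])"
    using l assms by (intro G.inv_equality [symmetric]) (auto simp: carrier_G emb_def)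
qed

lemma D_conj_left: "u \<in> lists A \<Longrightarrow> \<exists>y\<in>lists A. emb u \<otimes>\<^bsub>G\<^esub> emb dw = emb dw \<otimes>\<^bsub>G\<^esub> emb y"
  using ex_D_left [of u] dw(1) by (auto simp: emb_mult emb_eq_iff)

lemma D_conj_right: "u \<in> lists A \<Longrightarrow> \<exists>y\<in>lists A. emb dw \<otimes>\<^bsub>G\<^esub> emb u = emb y \<otimes>\<^bsub>G\<^esub> emb dw"
  using ex_D_right [of u] dw(1) by (auto simp: emb_mult emb_eq_iff)

text \<open>Each inverse letter costs one more factor \<open>\<Delta>\<close>: with
  \<open>u \<Delta> = \<Delta> y\<close> and \<open>\<Delta> = a b\<close>, the product
  \<open>a^-1 u \<Delta>\<close> is the positive element \<open>b y\<close>.\<close>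

lemma fraction:
  assumes "w \<in> lists (group_letters A)"
  shows "\<exists>n::nat. \<exists>u\<in>lists A. grp.cls w \<otimes>\<^bsub>G\<^esub> emb dw [^]\<^bsub>G\<^esub> n = emb u"
  using assms
proof (induction w rule: list.induct)
  case Nil
  have "grp.cls [] \<otimes>\<^bsub>G\<^esub> emb dw [^]\<^bsub>G\<^esub> (0::nat) = emb []"
    using G.one_closed by (simp add: emb_Nil emb_def)
  then show ?case by blast
next
  case (Cons x w)
  obtain a e where x: "x = (a, e)" by fastforce
  have a: "a \<in> A" and wl: "w \<in> lists (group_letters A)" and xl: "[x] \<in> lists (group_letters A)"
    using Cons.prems x by (auto simp: group_letters_def)
  obtain n u where u: "u \<in> lists A" "grp.cls w \<otimes>\<^bsub>G\<^esub> emb dw [^]\<^bsub>G\<^esub> (n::nat) = emb u"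
    using Cons.IH [OF wl] by blast
  have [simp]: "grp.cls w \<in> carrier G" "grp.cls [x] \<in> carrier G" "emb dw \<in> carrier G" "emb u \<in> carrier G" "emb [a] \<in> carrier G"
    using wl xl dw(1) u(1) a by (simp_all only: carrier_G imageI emb_carrier [unfolded carrier_G] Cons_in_lists_iff lists.Nil simp_thms)
  have cons: "grp.cls (x # w) = grp.cls [x] \<otimes>\<^bsub>G\<^esub> grp.cls w"
    using grp.mult_M [OF xl wl] by (simp add: pres_group_def)
  have eq: "grp.cls (x # w) \<otimes>\<^bsub>G\<^esub> emb dw [^]\<^bsub>G\<^esub> n = grp.cls [x] \<otimes>\<^bsub>G\<^esub> emb u"
    by (simp add: cons G.m_assoc u(2))
  show ?case
  proof (cases e)
    case True
    then have "grp.cls (x # w) \<otimes>\<^bsub>G\<^esub> emb dw [^]\<^bsub>G\<^esub> n = emb (a # u)"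
      using eq a u(1) emb_mult [of "[a]" u] by (simp add: x cls_letter)
    then show ?thesis using a u(1) by (metis Cons_in_lists_iff)
  next
    case False
    obtain y where y: "y \<in> lists A" "emb u \<otimes>\<^bsub>G\<^esub> emb dw = emb dw \<otimes>\<^bsub>G\<^esub> emb y"
      using D_conj_left [OF u(1)] by blast
    obtain b where b: "b \<in> lists A" "dw \<approx> [a] @ b" using letter_ldvd [OF a] by (auto simp: ldvd_def)
    have ab: "[a] @ b \<in> lists A" using a b(1) by simp
    then have "emb dw = emb [a] \<otimes>\<^bsub>G\<^esub> emb b"
      using b a dw(1) emb_eq_iff [OF dw(1) ab] emb_mult [of "[a]" b] by simp
    then have dwb: "inv\<^bsub>G\<^esub> (emb [a]) \<otimes>\<^bsub>G\<^esub> emb dw = emb b"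
      using b(1) G.inv_solve_left' [of "emb b" "emb [a]" "emb dw"] by simp
    have "grp.cls (x # w) \<otimes>\<^bsub>G\<^esub> emb dw [^]\<^bsub>G\<^esub> Suc n = grp.cls (x # w) \<otimes>\<^bsub>G\<^esub> emb dw [^]\<^bsub>G\<^esub> n \<otimes>\<^bsub>G\<^esub> emb dw"
      by (simp add: cons G.m_assoc)
    also have "\<dots> = inv\<^bsub>G\<^esub> (emb [a]) \<otimes>\<^bsub>G\<^esub> (emb u \<otimes>\<^bsub>G\<^esub> emb dw)"
      unfolding eq using a False by (simp add: x cls_letter G.m_assoc)
    also have "\<dots> = emb (b @ y)"
      using y b(1) dwb by (simp add: G.m_assoc [symmetric] emb_mult)
    finally show ?thesis using b(1) y(1) by (meson append_in_lists_conv)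
  qed
qed

sublocale garside: garside_group G pos_part "emb dw" deg
proof unfold_locales
  fix x y
  show "pos_part \<subseteq> carrier G" by (auto simp: pos_part_def)
  show "\<one>\<^bsub>G\<^esub> \<in> pos_part" by (auto simp: pos_part_def emb_Nil)
  show "emb dw \<in> pos_part" using dw(1) by (auto simp: pos_part_def)
  show "\<exists>n::nat. g \<otimes>\<^bsub>G\<^esub> emb dw [^]\<^bsub>G\<^esub> n \<in> pos_part" if "g \<in> carrier G" for g
  proof -
    from that obtain w where w: "w \<in> lists (group_letters A)" "g = grp.cls w" unfolding carrier_G by (rule imageE)
    from fraction [OF w(1)] show ?thesis unfolding w(2) pos_part_def by blast
  qed
  show "deg (x \<otimes>\<^bsub>G\<^esub> y) = deg x + deg y" if xy: "x \<in> carrier G" "y \<in> carrier G"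
  proof -
    obtain u v where uv: "u \<in> lists (group_letters A)" "v \<in> lists (group_letters A)" "x = grp.cls u" "y = grp.cls v"
      using xy unfolding carrier_G by blast
    have "x \<otimes>\<^bsub>G\<^esub> y = grp.cls (u @ v)" using uv by (simp add: pres_group_def grp.mult_M)
    then show ?thesis using uv by (simp add: deg_cls)
  qed
  show "finite {s \<in> pos_part. inv\<^bsub>G\<^esub> s \<otimes>\<^bsub>G\<^esub> emb dw \<in> pos_part}"
  proof -
    let ?f = "\<lambda>c. emb (SOME u. u \<in> lists A \<and> c = cls u)"
    have f: "?f (cls u) = emb u" if "u \<in> lists A" for u
    proof -
      have "\<exists>v. v \<in> lists A \<and> cls u = cls v" using that by blast
      from someI_ex [OF this] show ?thesis using that by (metis (mono_tags, lifting) emb_eq_iff cls_eq_iff)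
    qed
    have "{s \<in> pos_part. inv\<^bsub>G\<^esub> s \<otimes>\<^bsub>G\<^esub> emb dw \<in> pos_part} \<subseteq> ?f ` left_divisors M \<Delta>"
    proof
      fix s assume s: "s \<in> {s \<in> pos_part. inv\<^bsub>G\<^esub> s \<otimes>\<^bsub>G\<^esub> emb dw \<in> pos_part}"
      then obtain u where u: "u \<in> lists A" "s = emb u" by (auto simp: pos_part_def)
      then have "ldvd u dw" using s dw(1) by (simp add: inv_emb_mult)
      then have "cls u \<in> left_divisors M \<Delta>" using u by (auto simp: left_divisors_D)
      then show "s \<in> ?f ` left_divisors M \<Delta>" using f [OF u(1)] u(2) by force
    qed
    moreover have "finite (left_divisors M \<Delta>)" using ge unfolding garside_element_def by blast
    ultimately show ?thesis by (meson finite_imageI finite_subset)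
  qed
next
  fix x assume "x \<in> pos_part"
  then obtain u where u: "u \<in> lists A" "x = emb u" by (auto simp: pos_part_def)
  have [simp]: "emb dw \<in> carrier G" "emb u \<in> carrier G" using u dw(1) by auto
  show "deg x > 0" if "x \<noteq> \<one>\<^bsub>G\<^esub>" using that u by (auto simp: deg_emb emb_Nil)
  obtain y where "y \<in> lists A" "emb u \<otimes>\<^bsub>G\<^esub> emb dw = emb dw \<otimes>\<^bsub>G\<^esub> emb y"
    using D_conj_left [OF u(1)] by blast
  then have "inv\<^bsub>G\<^esub> (emb dw) \<otimes>\<^bsub>G\<^esub> x \<otimes>\<^bsub>G\<^esub> emb dw = emb y"
    by (simp add: u(2) G.m_assoc G.inv_solve_left')
  then show "inv\<^bsub>G\<^esub> (emb dw) \<otimes>\<^bsub>G\<^esub> x \<otimes>\<^bsub>G\<^esub> emb dw \<in> pos_part"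
    using \<open>y \<in> lists A\<close> by (simp add: pos_part_def)
  obtain z where z: "z \<in> lists A" "emb dw \<otimes>\<^bsub>G\<^esub> emb u = emb z \<otimes>\<^bsub>G\<^esub> emb dw"
    using D_conj_right [OF u(1)] by blast
  have "emb dw \<otimes>\<^bsub>G\<^esub> x \<otimes>\<^bsub>G\<^esub> inv\<^bsub>G\<^esub> (emb dw) = emb z"
    using z by (simp add: u(2) G.inv_solve_right')
  then show "emb dw \<otimes>\<^bsub>G\<^esub> x \<otimes>\<^bsub>G\<^esub> inv\<^bsub>G\<^esub> (emb dw) \<in> pos_part"
    using z(1) by (simp add: pos_part_def)
next
  fix x y assume "x \<in> pos_part" "y \<in> pos_part"
  then obtain u v where u: "u \<in> lists A" "x = emb u" and v: "v \<in> lists A" "y = emb v"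
    by (auto simp: pos_part_def)
  show "x \<otimes>\<^bsub>G\<^esub> y \<in> pos_part" using u v by (auto simp: pos_part_def emb_mult)
  have L: "has_lcms_gcds M" "has_lcms_gcds (opp_monoid M)" using gm by (simp_all add: garside_monoid_def)
  obtain j where j: "j \<in> lists A" "is_lcm ldvd j u v"
    using L(1) u v by (auto simp: has_lcms_gcds_M)
  show "\<exists>z\<in>pos_part. inv\<^bsub>G\<^esub> x \<otimes>\<^bsub>G\<^esub> z \<in> pos_part \<and> inv\<^bsub>G\<^esub> y \<otimes>\<^bsub>G\<^esub> z \<in> pos_part \<and>
     (\<forall>t\<in>pos_part. inv\<^bsub>G\<^esub> x \<otimes>\<^bsub>G\<^esub> t \<in> pos_part \<and> inv\<^bsub>G\<^esub> y \<otimes>\<^bsub>G\<^esub> t \<in> pos_part \<longrightarrow> inv\<^bsub>G\<^esub> z \<otimes>\<^bsub>G\<^esub> t \<in> pos_part)"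
  proof (intro bexI [of _ "emb j"] conjI ballI impI)
    fix t assume "t \<in> pos_part"
    then obtain c where "c \<in> lists A" "t = emb c" by (auto simp: pos_part_def)
    moreover assume "inv\<^bsub>G\<^esub> x \<otimes>\<^bsub>G\<^esub> t \<in> pos_part \<and> inv\<^bsub>G\<^esub> y \<otimes>\<^bsub>G\<^esub> t \<in> pos_part"
    ultimately show "inv\<^bsub>G\<^esub> (emb j) \<otimes>\<^bsub>G\<^esub> t \<in> pos_part" using u v j by (simp add: inv_emb_mult is_lcm_def)
  qed (use u v j in \<open>simp_all add: inv_emb_mult is_lcm_def, simp add: pos_part_def\<close>)
  obtain m where m: "m \<in> lists A" "is_gcd ldvd m u v"
    using L(1) u v by (auto simp: has_lcms_gcds_M)
  show "\<exists>z\<in>pos_part. inv\<^bsub>G\<^esub> z \<otimes>\<^bsub>G\<^esub> x \<in> pos_part \<and> inv\<^bsub>G\<^esub> z \<otimes>\<^bsub>G\<^esub> y \<in> pos_part \<and>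
     (\<forall>t\<in>pos_part. inv\<^bsub>G\<^esub> t \<otimes>\<^bsub>G\<^esub> x \<in> pos_part \<and> inv\<^bsub>G\<^esub> t \<otimes>\<^bsub>G\<^esub> y \<in> pos_part \<longrightarrow> inv\<^bsub>G\<^esub> t \<otimes>\<^bsub>G\<^esub> z \<in> pos_part)"
  proof (intro bexI [of _ "emb m"] conjI ballI impI)
    fix t assume "t \<in> pos_part"
    then obtain c where "c \<in> lists A" "t = emb c" by (auto simp: pos_part_def)
    moreover assume "inv\<^bsub>G\<^esub> t \<otimes>\<^bsub>G\<^esub> x \<in> pos_part \<and> inv\<^bsub>G\<^esub> t \<otimes>\<^bsub>G\<^esub> y \<in> pos_part"
    ultimately show "inv\<^bsub>G\<^esub> t \<otimes>\<^bsub>G\<^esub> emb m \<in> pos_part" using u v m by (simp add: inv_emb_mult is_gcd_def)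
  qed (use u v m in \<open>simp_all add: inv_emb_mult is_gcd_def, simp add: pos_part_def\<close>)
  obtain r where r: "r \<in> lists A" "is_lcm rdvd r u v"
    using L(2) u v by (auto simp: has_lcms_gcds_opp)
  show "\<exists>z\<in>pos_part. z \<otimes>\<^bsub>G\<^esub> inv\<^bsub>G\<^esub> x \<in> pos_part \<and> z \<otimes>\<^bsub>G\<^esub> inv\<^bsub>G\<^esub> y \<in> pos_part \<and>
     (\<forall>t\<in>pos_part. t \<otimes>\<^bsub>G\<^esub> inv\<^bsub>G\<^esub> x \<in> pos_part \<and> t \<otimes>\<^bsub>G\<^esub> inv\<^bsub>G\<^esub> y \<in> pos_part \<longrightarrow> t \<otimes>\<^bsub>G\<^esub> inv\<^bsub>G\<^esub> z \<in> pos_part)"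
  proof (intro bexI [of _ "emb r"] conjI ballI impI)
    fix t assume "t \<in> pos_part"
    then obtain c where "c \<in> lists A" "t = emb c" by (auto simp: pos_part_def)
    moreover assume "t \<otimes>\<^bsub>G\<^esub> inv\<^bsub>G\<^esub> x \<in> pos_part \<and> t \<otimes>\<^bsub>G\<^esub> inv\<^bsub>G\<^esub> y \<in> pos_part"
    ultimately show "t \<otimes>\<^bsub>G\<^esub> inv\<^bsub>G\<^esub> (emb r) \<in> pos_part" using u v r by (simp add: emb_mult_inv is_lcm_def)
  qed (use u v r in \<open>simp_all add: emb_mult_inv is_lcm_def, simp add: pos_part_def\<close>)
qed

lemma garside_generators_eq: "garside_generators A R \<Delta> = garside.S"
proof -
  have "cls u \<in> left_divisors M \<Delta> \<longleftrightarrow> ldvd u dw" "cls u = \<one>\<^bsub>M\<^esub> \<longleftrightarrow> emb u = \<one>\<^bsub>G\<^esub>"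
    if "u \<in> lists A" for u
    using that divides_M [of u dw] dw by (simp_all add: left_divisors_def emb_Nil one_M emb_eq_iff cls_eq_iff)
  then have key: "u \<in> lists A \<and> cls u \<in> left_divisors M \<Delta> - {\<one>\<^bsub>M\<^esub>} \<longleftrightarrow>
      u \<in> lists A \<and> emb u \<noteq> \<one>\<^bsub>G\<^esub> \<and> inv\<^bsub>G\<^esub> (emb u) \<otimes>\<^bsub>G\<^esub> emb dw \<in> pos_part" for u
    using dw(1) inv_emb_mult [of u dw] by blast
  have "garside_generators A R \<Delta> =
      {emb u |u. u \<in> lists A \<and> emb u \<noteq> \<one>\<^bsub>G\<^esub> \<and> inv\<^bsub>G\<^esub> (emb u) \<otimes>\<^bsub>G\<^esub> emb dw \<in> pos_part}"
    unfolding garside_generators_def key emb_def ..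
  also have "\<dots> = garside.S"
  proof -
    have "emb u \<in> pos_part" if "u \<in> lists A" for u using that by (simp add: pos_part_def)
    moreover have "\<exists>u. u \<in> lists A \<and> s = emb u" if "s \<in> pos_part" for s
      using that by (auto simp: pos_part_def)
    ultimately show ?thesis unfolding garside.S_def by (auto 4 3)
  qed
  finally show ?thesis .
qed

lemma garside_alphabet_eq: "garside_alphabet A R \<Delta> = garside.X"
  by (simp add: garside_alphabet_def garside.X_def garside_generators_eq)

theorem regular_conjugacy_languages:
  "regular_language (garside_alphabet A R \<Delta>) (ConjGeo (pres_group A R) (garside_alphabet A R \<Delta>))"
  "\<exists>r. linear_order_on (garside_alphabet A R \<Delta>) r \<and>
     regular_language (garside_alphabet A R \<Delta>) (ConjMinLenSL (pres_group A R) (garside_alphabet A R \<Delta>) r)"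
  unfolding garside_alphabet_eq using garside.regular_ConjGeo garside.regular_ConjMinLenSL by blast+

end

lemma regular_conjugacy_languages_garside:
  assumes "homogeneous_garside_presentation A R" "garside_element (pres_monoid A R) \<Delta>"
  shows "regular_language (garside_alphabet A R \<Delta>) (ConjGeo (pres_group A R) (garside_alphabet A R \<Delta>))"
  "\<exists>r. linear_order_on (garside_alphabet A R \<Delta>) r \<and>
     regular_language (garside_alphabet A R \<Delta>) (ConjMinLenSL (pres_group A R) (garside_alphabet A R \<Delta>) r)"
proof -
  interpret garside_presentation A R \<Delta>
    using assms by unfold_locales (auto simp: homogeneous_garside_presentation_def)
  show "regular_language (garside_alphabet A R \<Delta>) (ConjGeo (pres_group A R) (garside_alphabet A R \<Delta>))"
    "\<exists>r. linear_order_on (garside_alphabet A R \<Delta>) r \<and>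
     regular_language (garside_alphabet A R \<Delta>) (ConjMinLenSL (pres_group A R) (garside_alphabet A R \<Delta>) r)"
    by (rule regular_conjugacy_languages)+
qed

section \<open>Coxeter groups\<close>

lemma alternating_lists: "s \<in> A \<Longrightarrow> t \<in> A \<Longrightarrow> alternating s t k \<in> lists A"
  by (induction k arbitrary: s t) auto

lemma length_alternating [simp]: "length (alternating s t k) = k"
  by (induction k arbitrary: s t) auto

lemma alternating_double: "alternating s t (2 * k) = concat (replicate k [s, t])"
  by (induction k) auto

lemma alternating_add:
  "alternating s t (k + l) = alternating s t k @ (if even k then alternating s t l else alternating t s l)"
  by (induction k arbitrary: s t) auto

lemma rev_alternating:
  "rev (alternating s t k) = (if even k then alternating t s k else alternating s t k)"
proof (induction k arbitrary: s t)
  case (Suc k)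
  have "alternating x y (Suc k) = alternating x y k @ (if even k then [x] else [y])" for x y :: 'a
    using alternating_add [of x y k 1] by simp
  from this [of s t] this [of t s] Suc show ?case by auto
qed simp

locale coxeter = presentation A "coxeter_rels A m" for A :: "'a set" and m +
  assumes cm: "coxeter_matrix A m"
begin

notation eqv (infix "\<approx>" 50)

lemma m_self: "s \<in> A \<Longrightarrow> m s s = 1"
  and m_sym: "s \<in> A \<Longrightarrow> t \<in> A \<Longrightarrow> m s t = m t s"
  and m_ne_1: "s \<in> A \<Longrightarrow> t \<in> A \<Longrightarrow> s \<noteq> t \<Longrightarrow> m s t \<noteq> 1"
  using cm by (auto simp: coxeter_matrix_def)

lemma relI: "s \<in> A \<Longrightarrow> t \<in> A \<Longrightarrow> m s t \<noteq> 0 \<Longrightarrow> concat (replicate (m s t) [s, t]) \<approx> []"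
  by (rule eqv_rel)
    (auto simp: coxeter_rels_def alternating_lists simp flip: alternating_double)

lemma square_eqv: "s \<in> A \<Longrightarrow> [s, s] \<approx> []"
  using relI [of s s] by (simp add: m_self)

subsection \<open>Words as permutations\<close>

text \<open>Left multiplication by \<open>s\<close> on the classes, extended by the identity to a
  total function. Words then act faithfully by permutations, and equations in \<open>W\<close>
  become equations of functions under composition.\<close>

definition sg :: "'a \<Rightarrow> 'a list set \<Rightarrow> 'a list set" where
  "sg s c = (if c \<in> cls ` lists A then (\<Union>u\<in>c. cls (s # u)) else c)"

definition wd :: "'a list \<Rightarrow> 'a list set \<Rightarrow> 'a list set" where
  "wd u = foldr (\<lambda>s f. sg s \<circ> f) u id"

lemma wd_simps [simp]: "wd [] = id" "wd (s # u) = sg s \<circ> wd u"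
  by (simp_all add: wd_def)

lemma wd_append [simp]: "wd (u @ v) = wd u \<circ> wd v"
  by (induction u) (simp_all add: comp_assoc)

lemma sg_cls: "s \<in> A \<Longrightarrow> u \<in> lists A \<Longrightarrow> sg s (cls u) = cls (s # u)"
proof -
  assume s: "s \<in> A" and u: "u \<in> lists A"
  have "cls (s # v) = cls (s # u)" if "v \<in> cls u" for v
    using that s u eqv_lists [of u v] by (subst cls_eq_iff) (auto intro: eqv_Cons eqv_sym)
  then have "(\<Union>v\<in>cls u. cls (s # v)) = (\<Union>v\<in>cls u. cls (s # u))" by (intro SUP_cong refl) simp_all
  moreover have "cls u \<noteq> {}" using u eqv_refl mem_cls by blast
  ultimately show ?thesis using u by (simp add: sg_def)
qed

lemma wd_cls: "u \<in> lists A \<Longrightarrow> v \<in> lists A \<Longrightarrow> wd u (cls v) = cls (u @ v)"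
  by (induction u) (auto simp: sg_cls)

lemma wd_outside: "u \<in> lists A \<Longrightarrow> c \<notin> cls ` lists A \<Longrightarrow> wd u c = c"
  by (induction u) (auto simp: sg_def)

lemma wd_eq_iff:
  assumes "u \<in> lists A" "v \<in> lists A"
  shows "wd u = wd v \<longleftrightarrow> u \<approx> v"
proof
  assume "wd u = wd v"
  then have "wd u (cls []) = wd v (cls [])" by simp
  then show "u \<approx> v" using assms by (simp add: wd_cls cls_eq_iff)
next
  assume eq: "u \<approx> v"
  show "wd u = wd v"
  proof
    fix c show "wd u c = wd v c"
    proof (cases "c \<in> cls ` lists A")
      case True
      then obtain x where "x \<in> lists A" "c = cls x" by auto
      then show ?thesis using assms eq by (simp add: wd_cls cls_eq_iff eqv_append_right)
    qed (simp add: wd_outside assms)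
  qed
qed

lemma sg_sg [simp]: "s \<in> A \<Longrightarrow> sg s \<circ> sg s = id"
  using wd_eq_iff [of "[s, s]" "[]"] square_eqv [of s] by simp

lemma sg_sg_l [simp]: "s \<in> A \<Longrightarrow> sg s \<circ> (sg s \<circ> f) = f"
  by (simp add: comp_assoc [symmetric])

lemma wd_rev [simp]: "u \<in> lists A \<Longrightarrow> wd (rev u) \<circ> wd u = id"
  by (induction u) (auto simp: comp_assoc)

lemma rev_in_lists [simp]: "rev u \<in> lists B \<longleftrightarrow> u \<in> lists B"
  by (simp add: in_lists_conv_set)

lemma wd_rev' [simp]: "u \<in> lists A \<Longrightarrow> wd u \<circ> wd (rev u) = id"
  using wd_rev [of "rev u"] by simp

lemma wd_rev_l [simp]: "u \<in> lists A \<Longrightarrow> wd (rev u) \<circ> (wd u \<circ> f) = f"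
  "u \<in> lists A \<Longrightarrow> wd u \<circ> (wd (rev u) \<circ> f) = f"
  by (simp_all add: comp_assoc [symmetric])

lemma wd_rev_cong:
  assumes "u \<in> lists A" "v \<in> lists A" "wd u = wd v"
  shows "wd (rev u) = wd (rev v)"
proof -
  have "wd (rev u) = wd (rev u) \<circ> (wd v \<circ> wd (rev v))" using assms by simp
  also have "\<dots> = wd (rev v)" using assms by (simp flip: assms(3))
  finally show ?thesis .
qed

lemma wd_alternating:
  assumes "s \<in> A" "t \<in> A" "m s t \<noteq> 0"
  shows "wd (alternating s t (m s t)) = wd (alternating t s (m s t))"
proof -
  let ?k = "m s t"
  have "alternating s t (?k + ?k) = alternating s t ?k @ rev (alternating t s ?k)"
    by (subst alternating_add) (simp add: rev_alternating)
  then have "wd (alternating s t ?k) \<circ> wd (rev (alternating t s ?k)) = wd (alternating s t (2 * ?k))"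
    by (metis mult_2 wd_append)
  also have "\<dots> = id"
    using relI [OF assms] assms wd_eq_iff [of "alternating s t (2 * ?k)" "[]"]
    by (simp add: alternating_double [symmetric] alternating_lists)
  finally have "wd (alternating s t ?k) \<circ> wd (rev (alternating t s ?k)) \<circ> wd (alternating t s ?k)
      = wd (alternating t s ?k)" by simp
  then show ?thesis using assms alternating_lists [of t A s ?k] by (simp add: comp_assoc)
qed

subsection \<open>Reflections and the exchange condition\<close>

text \<open>\<open>inN (s\<^sub>1 \<dots> s\<^sub>k) r\<close> says that the reflection \<open>r\<close> occurs an odd number of times among the
  palindromes \<open>s\<^sub>1 \<dots> s\<^sub>i \<dots> s\<^sub>1\<close> with \<open>i \<le> k\<close>; this depends only on the element represented.\<close>

primrec inN :: "'a list \<Rightarrow> ('a list set \<Rightarrow> 'a list set) \<Rightarrow> bool" where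
  "inN [] r \<longleftrightarrow> False"
| "inN (s # u) r \<longleftrightarrow> (r = sg s) \<noteq> inN u (sg s \<circ> r \<circ> sg s)"

lemma inN_append: "inN (p @ u) r \<longleftrightarrow> inN p r \<noteq> inN u (wd (rev p) \<circ> r \<circ> wd p)"
  by (induction p arbitrary: r) (auto simp: comp_assoc)

lemma conj_eq_iff:
  assumes "s \<in> A"
  shows "sg s \<circ> r \<circ> sg s = x \<longleftrightarrow> r = sg s \<circ> x \<circ> sg s"
  using assms by (auto simp: comp_assoc)

text \<open>The palindrome number \<open>i\<close> of \<open>s t s ...\<close>, counted from
  \<open>0\<close>, is \<open>(s t)^i s\<close>.\<close>

lemma inN_alternating:
  assumes "s \<in> A" "t \<in> A"
  shows "inN (alternating s t k) r \<longleftrightarrow> odd (\<Sum>i<k. of_bool (r = ((sg s \<circ> sg t) ^^ i) \<circ> sg s) :: nat)"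
  using assms
proof (induction k arbitrary: s t r)
  case (Suc k)
  have shift: "sg s \<circ> (((sg t \<circ> sg s) ^^ i) \<circ> sg t) = ((sg s \<circ> sg t) ^^ Suc i)" for i
  proof (induction i)
    case (Suc i)
    then show ?case by (simp only: funpow.simps(2) comp_assoc)
  qed simp
  have "sg s \<circ> r \<circ> sg s = ((sg t \<circ> sg s) ^^ i) \<circ> sg t \<longleftrightarrow> r = ((sg s \<circ> sg t) ^^ Suc i) \<circ> sg s" for i
    using conj_eq_iff [OF Suc.prems(1), of r "((sg t \<circ> sg s) ^^ i) \<circ> sg t"] shift [of i] by (simp add: comp_assoc del: funpow.simps)
  then have "inN (alternating s t (Suc k)) r \<longleftrightarrow>
      (r = sg s) \<noteq> odd (\<Sum>i<k. of_bool (r = ((sg s \<circ> sg t) ^^ Suc i) \<circ> sg s) :: nat)"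
    by (simp only: alternating.simps inN.simps Suc.IH [OF Suc.prems(2,1)])
  also have "\<dots> \<longleftrightarrow> odd (of_bool (r = sg s) + (\<Sum>i<k. of_bool (r = ((sg s \<circ> sg t) ^^ Suc i) \<circ> sg s) :: nat))"
    by (cases "r = sg s") (simp_all only: of_bool_eq even_add odd_one, simp_all)
  also have "\<dots> \<longleftrightarrow> odd (\<Sum>i<Suc k. of_bool (r = ((sg s \<circ> sg t) ^^ i) \<circ> sg s) :: nat)"
    by (subst sum.lessThan_Suc_shift) (simp only: funpow.simps(1) id_comp)
  finally show ?case .
qed simp

lemma funpow_period:
  assumes "s \<in> A" "t \<in> A" "m s t \<noteq> 0"
  shows "(sg s \<circ> sg t) ^^ m s t = id"
proof -
  have "wd (concat (replicate k [s, t])) = (sg s \<circ> sg t) ^^ k" for k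
    by (induction k) (simp_all add: comp_assoc)
  then show ?thesis using relI [OF assms] wd_eq_iff [of "concat (replicate (m s t) [s, t])" "[]"] assms
    by (simp add: alternating_double [symmetric] alternating_lists)
qed

text \<open>Since \<open>(s t)^k = 1\<close> with \<open>k = m s t\<close>, the reflection
  \<open>(t s)^i t\<close> equals \<open>(s t)^(k-1-i) s\<close>: both sides of a braid relation run
  through the same reflections, in opposite orders.\<close>

lemma inN_braid:
  assumes "s \<in> A" "t \<in> A" "m s t \<noteq> 0"
  shows "inN (alternating s t (m s t)) = inN (alternating t s (m s t))"
proof
  fix r
  let ?k = "m s t" and ?\<rho> = "sg s \<circ> sg t" and ?\<rho>' = "sg t \<circ> sg s"
  have inv: "(?\<rho>' ^^ i) \<circ> (?\<rho> ^^ i) = id" for i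
  proof (induction i)
    case (Suc i)
    have "(?\<rho>' ^^ Suc i) \<circ> (?\<rho> ^^ Suc i) = (?\<rho>' ^^ i) \<circ> (?\<rho>' \<circ> ?\<rho>) \<circ> (?\<rho> ^^ i)"
      by (simp only: funpow_Suc_right [of i ?\<rho>'] funpow.simps(2) [of i ?\<rho>] comp_assoc)
    also have "?\<rho>' \<circ> ?\<rho> = id" using assms by (simp add: comp_assoc)
    finally show ?case using Suc by simp
  qed simp
  have "(?\<rho>' ^^ i) \<circ> sg t = (?\<rho> ^^ (?k - Suc i)) \<circ> sg s" if "i < ?k" for i
  proof -
    have "?\<rho> ^^ ?k = (?\<rho> ^^ i) \<circ> ?\<rho> \<circ> (?\<rho> ^^ (?k - Suc i))"
    proof -
      have "?k = Suc i + (?k - Suc i)" using that by simp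
      then have "?\<rho> ^^ ?k = (?\<rho> ^^ Suc i) \<circ> (?\<rho> ^^ (?k - Suc i))" by (metis funpow_add)
      then show ?thesis by (simp only: funpow_Suc_right)
    qed
    then have "(?\<rho>' ^^ i) \<circ> id = (?\<rho>' ^^ i) \<circ> ((?\<rho> ^^ i) \<circ> ?\<rho> \<circ> (?\<rho> ^^ (?k - Suc i)))"
      using funpow_period [OF assms] by simp
    also have "\<dots> = ?\<rho> \<circ> (?\<rho> ^^ (?k - Suc i))"
      by (simp only: comp_assoc [symmetric] inv [of i] id_comp)
    also have "\<dots> = (?\<rho> ^^ (?k - Suc i)) \<circ> ?\<rho>" by (simp only: funpow.simps(2) [symmetric] funpow_Suc_right)
    finally show ?thesis using assms by (simp add: comp_assoc)
  qed
  then have "(\<Sum>i<?k. of_bool (r = (?\<rho>' ^^ i) \<circ> sg t) :: nat) =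
      (\<Sum>i<?k. of_bool (r = (?\<rho> ^^ (?k - Suc i)) \<circ> sg s))"
    by (intro sum.cong) auto
  also have "\<dots> = (\<Sum>i<?k. of_bool (r = (?\<rho> ^^ i) \<circ> sg s))"
    by (rule sum.nat_diff_reindex [of "\<lambda>i. of_bool (r = (?\<rho> ^^ i) \<circ> sg s)"])
  finally show "inN (alternating s t ?k) r = inN (alternating t s ?k) r"
    using assms by (simp add: inN_alternating)
qed

lemma inN_cancel: "u \<in> lists A \<Longrightarrow> inN (u @ rev u) r = False"
proof (induction u arbitrary: r)
  case (Cons s u)
  then have s: "s \<in> A" and u: "u \<in> lists A" by auto
  have "inN ((u @ rev u) @ [s]) (sg s \<circ> r \<circ> sg s) \<longleftrightarrow> sg s \<circ> r \<circ> sg s = sg s"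
    unfolding inN_append [of "u @ rev u" "[s]"] using Cons u by (simp add: comp_assoc)
  also have "\<dots> \<longleftrightarrow> r = sg s" using s conj_eq_iff [OF s, of r "sg s"] by (simp only: sg_sg id_comp)
  finally show ?case by simp
qed simp

text \<open>The relator \<open>(s t)^k\<close> with \<open>k = m s t\<close> is one side of the
  braid relation followed by the reverse of the other side. By \<open>inN_braid\<close> the first
  can be replaced by the second, and a word followed by its reverse meets every reflection an even
  number of times.\<close>

lemma inN_cong: "u \<approx> v \<Longrightarrow> inN u = inN v"
proof (induction rule: pres_cong.induct)
  case (rel u v p q)
  obtain s t where st: "u = concat (replicate (m s t) [s, t])" "v = []" "s \<in> A" "t \<in> A" "m s t \<noteq> 0"
    using rel(1) by (auto simp: coxeter_rels_def)
  let ?k = "m s t"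
  let ?a = "alternating s t ?k" and ?b = "alternating t s ?k"
  have u: "u = ?a @ rev ?b"
  proof -
    have "u = alternating s t (?k + ?k)" using st(1) by (simp add: alternating_double flip: mult_2)
    then show ?thesis by (subst (asm) alternating_add) (simp add: rev_alternating)
  qed
  have ab: "?a \<in> lists A" "?b \<in> lists A" using st by (simp_all add: alternating_lists)
  have wab: "wd ?a = wd ?b" using wd_alternating st by simp
  have "inN u r = False" for r
  proof -
    have "inN u r \<longleftrightarrow> inN (?b @ rev ?b) r"
      unfolding u inN_append using inN_braid [of s t] st wab wd_rev_cong [OF ab wab] by simp
    then show ?thesis using inN_cancel [OF ab(2)] by simp
  qed
  moreover have "wd u = id" using rel st wd_eq_iff [of u v] eqv_rel [of u v] by auto
  moreover have "wd (rev u) = id" using \<open>wd u = id\<close> wd_rev_cong [of u "[]"] rel by simp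
  ultimately have "inN (p @ u @ q) r = inN (p @ v @ q) r" for r
    using st(2) by (simp add: inN_append)
  then show ?case by blast
qed auto

definition N :: "'a list \<Rightarrow> ('a list set \<Rightarrow> 'a list set) set" where "N u = {r. inN u r}"

lemma N_cong: "u \<in> lists A \<Longrightarrow> v \<in> lists A \<Longrightarrow> wd u = wd v \<Longrightarrow> N u = N v"
  by (simp add: N_def inN_cong wd_eq_iff)

lemma N_Nil [simp]: "N [] = {}" by (simp add: N_def)

lemma N_Cons_subset: "s \<in> A \<Longrightarrow> N (s # u) \<subseteq> insert (sg s) ((\<lambda>r. sg s \<circ> r \<circ> sg s) ` N u)"
proof
  fix r assume s: "s \<in> A" and r: "r \<in> N (s # u)"
  show "r \<in> insert (sg s) ((\<lambda>r. sg s \<circ> r \<circ> sg s) ` N u)"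
  proof (cases "r = sg s")
    case False
    then have "sg s \<circ> r \<circ> sg s \<in> N u" using r by (simp add: N_def)
    moreover have "r = sg s \<circ> (sg s \<circ> r \<circ> sg s) \<circ> sg s" using s by (simp add: comp_assoc)
    ultimately show ?thesis by blast
  qed simp
qed

lemma finite_N [simp]: "u \<in> lists A \<Longrightarrow> finite (N u)"
proof (induction u)
  case (Cons s u)
  then show ?case using N_Cons_subset [of s u] finite_subset by auto
qed simp

lemma card_N_le: "u \<in> lists A \<Longrightarrow> card (N u) \<le> length u"
proof (induction u)
  case (Cons s u)
  then have "card (N (s # u)) \<le> card (insert (sg s) ((\<lambda>r. sg s \<circ> r \<circ> sg s) ` N u))"
    by (intro card_mono N_Cons_subset) auto
  also have "\<dots> \<le> Suc (card ((\<lambda>r. sg s \<circ> r \<circ> sg s) ` N u))"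
    by (rule card_insert_le_m1) auto
  also have "\<dots> \<le> Suc (card (N u))" using Cons by (simp add: card_image_le)
  finally show ?case using Cons by simp
qed simp

text \<open>The reflection belonging to a letter of \<open>u\<close> deletes that letter when
  multiplied from the left; a member of \<open>N u\<close> belongs to at least one letter.\<close>

lemma exchange:
  assumes "u \<in> lists A" "r \<in> N u"
  shows "\<exists>p x q. u = p @ [x] @ q \<and> r \<circ> wd u = wd (p @ q)"
  using assms
proof (induction u arbitrary: r)
  case (Cons s u)
  then have s: "s \<in> A" by auto
  show ?case
  proof (cases "r = sg s")
    case True
    then have "s # u = [] @ [s] @ u \<and> r \<circ> wd (s # u) = wd ([] @ u)" using s by simp
    then show ?thesis by blast
  next
    case False
    then have "sg s \<circ> r \<circ> sg s \<in> N u" using Cons by (simp add: N_def)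
    then obtain p x q where 1: "u = p @ [x] @ q" "sg s \<circ> r \<circ> sg s \<circ> wd u = wd (p @ q)"
      using Cons.IH by blast
    then have "sg s \<circ> (sg s \<circ> r \<circ> sg s \<circ> wd u) = sg s \<circ> wd (p @ q)" by simp
    then have "r \<circ> wd (s # u) = wd ((s # p) @ q)" using s by (simp add: comp_assoc)
    moreover have "s # u = (s # p) @ [x] @ q" using 1 by simp
    ultimately show ?thesis by blast
  qed
qed simp

text \<open>Counting inversions gives the same notion as minimal length: \<open>card_N_le\<close>
  bounds the length of every word from below, and \<open>ex_reduced\<close> shows that the bound is
  attained.\<close>

definition reduced :: "'a list \<Rightarrow> bool" where
  "reduced u \<longleftrightarrow> u \<in> lists A \<and> length u = card (N u)"

lemma reduced_lists [dest]: "reduced u \<Longrightarrow> u \<in> lists A"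
  by (simp add: reduced_def)

text \<open>If \<open>s # u\<close> has minimal length, then \<open>sg s\<close> is not in
  \<open>N u\<close>, since otherwise by \<open>exchange\<close> the word \<open>u\<close> with a
  letter removed would represent the same element as \<open>s # u\<close>. So
  \<open>N (s # u)\<close> has exactly one reflection more than \<open>N u\<close>.\<close>

lemma ex_reduced: "u \<in> lists A \<Longrightarrow> \<exists>v. reduced v \<and> wd v = wd u"
proof (induction "length u" arbitrary: u rule: less_induct)
  case less
  show ?case
  proof (cases "\<exists>v\<in>lists A. wd v = wd u \<and> length v < length u")
    case True
    then show ?thesis using less by metis
  next
    case False
    have "length u = card (N u)"
      using less.prems False
    proof (induction u rule: list.induct)
      case (Cons s u)
      then have s: "s \<in> A" and u: "u \<in> lists A" by auto
      have "\<not> (\<exists>v\<in>lists A. wd v = wd u \<and> length v < length u)"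
      proof
        assume "\<exists>v\<in>lists A. wd v = wd u \<and> length v < length u"
        then obtain v where "v \<in> lists A" "wd v = wd u" "length v < length u" by blast
        then show False using Cons.prems(2) s by (metis (no_types) Cons_in_lists_iff length_Cons not_less_eq wd_simps(2))
      qed
      then have len: "length u = card (N u)" using Cons u by blast
      have no: "sg s \<notin> N u"
      proof
        assume "sg s \<in> N u"
        then obtain p x q where "u = p @ [x] @ q" "sg s \<circ> wd u = wd (p @ q)"
          using exchange [OF u] by blast
        then have "p @ q \<in> lists A" "wd (p @ q) = wd (s # u)" "length (p @ q) < length (s # u)"
          using u by auto
        then show False using Cons.prems(2) by blast
      qed
      have "N (s # u) = insert (sg s) ((\<lambda>r. sg s \<circ> r \<circ> sg s) ` N u)"
      proof (rule antisym [OF N_Cons_subset [OF s]])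
        show "insert (sg s) ((\<lambda>r. sg s \<circ> r \<circ> sg s) ` N u) \<subseteq> N (s # u)"
          using no s conj_eq_iff [OF s] by (auto simp: N_def comp_assoc)
      qed
      moreover have "sg s \<notin> (\<lambda>r. sg s \<circ> r \<circ> sg s) ` N u"
        using no s by (auto simp: comp_assoc) (metis comp_assoc conj_eq_iff comp_id sg_sg)
      moreover have "inj_on (\<lambda>r. sg s \<circ> r \<circ> sg s) (N u)"
        using s by (intro inj_onI) (metis conj_eq_iff)
      ultimately show ?case using len u by (simp add: card_image)
    qed simp
    then show ?thesis using less.prems by (auto simp: reduced_def)
  qed
qed

subsection \<open>A linear representation\<close>

text \<open>The dual of the geometric representation. The product of two generators \<open>s\<close>, \<open>t\<close> has the
  eigenvalues \<open>\<eta>\<^sup>2\<close> and \<open>\<eta>\<^sup>-\<^sup>2\<close> with \<open>\<eta> = eta (m s t)\<close>, so its order is exactly \<open>m s t\<close>. The value \<open>2\<close>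
  for \<open>m s t = 0\<close> is any number that is not a root of unity.\<close>

definition eta :: "nat \<Rightarrow> complex" where
  "eta k = (if k = 0 then 2 else cis (pi / real k))"

text \<open>For \<open>m s t > 0\<close> this is \<open>- 2 cos (pi / m s t)\<close>, the entry of
  the Cartan matrix; the form with \<open>eta\<close> makes the eigenvalues visible.\<close>

definition ca :: "'a \<Rightarrow> 'a \<Rightarrow> complex" where
  "ca s t = - (eta (m s t) + inverse (eta (m s t)))"

definition rep1 :: "'a \<Rightarrow> ('a \<Rightarrow> complex) \<Rightarrow> 'a \<Rightarrow> complex" where
  "rep1 s \<phi> = (\<lambda>t. \<phi> t - ca s t * \<phi> s)"

definition rep :: "'a list \<Rightarrow> ('a \<Rightarrow> complex) \<Rightarrow> 'a \<Rightarrow> complex" where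
  "rep u = foldr (\<lambda>s f. rep1 s \<circ> f) u id"

lemma rep_simps [simp]: "rep [] = id" "rep (s # u) = rep1 s \<circ> rep u"
  by (simp_all add: rep_def)

lemma rep_append [simp]: "rep (u @ v) = rep u \<circ> rep v"
  by (induction u) (simp_all add: comp_assoc)

lemma eta_nonzero [simp]: "eta k \<noteq> 0"
  by (simp add: eta_def)

lemma eta_power: "k > 0 \<Longrightarrow> ((eta k)\<^sup>2) ^ j = cis (2 * pi * real j / real k)"
  by (simp add: eta_def DeMoivre power_mult [symmetric] mult_ac)

lemma eta_period: "k > 0 \<Longrightarrow> ((eta k)\<^sup>2) ^ k = 1"
  by (simp add: eta_power)

lemma cis_eq_1: "cis x = 1 \<longleftrightarrow> (\<exists>n::int. x = of_int n * 2 * pi)"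
  using cos_one_2pi_int [of x] by (auto simp: complex_eq_iff sin_zero_iff_int2)
    (metis mult.assoc mult_numeral_1 of_int_mult of_int_numeral sin_int_2pin mult.commute)+

lemma eta_power_eq_1:
  assumes "((eta k)\<^sup>2) ^ j = 1" "j > 0" "k \<noteq> 1"
  shows "k > 0 \<and> k \<le> j"
proof (cases "k = 0")
  case True
  then have "(4::complex) ^ j = 1" using assms(1) by (simp add: eta_def)
  then have "norm ((4::complex) ^ j) = 1" by simp
  then have "(4::real) ^ j = 1" by (simp add: norm_power)
  then show ?thesis using assms(2) one_less_power [of "4::real" j] by simp
next
  case False
  then have "cis (2 * pi * real j / real k) = 1" using assms(1) eta_power [of k j] by simp
  then obtain n :: int where "2 * pi * real j / real k = of_int n * 2 * pi" using cis_eq_1 by blast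
  then have "real j = of_int n * real k" using False by (simp add: field_simps)
  then have *: "int j = n * int k" by (metis of_int_eq_iff of_int_mult of_int_of_nat_eq)
  then have "n > 0" using assms(2) by (metis mult_nonpos_nonneg not_less of_nat_0_le_iff of_nat_0_less_iff)
  then have "int k \<le> n * int k" using mult_right_mono [of 1 n "int k"] by linarith
  then show ?thesis using * False by linarith
qed

lemma rep1_rep1: "s \<in> A \<Longrightarrow> rep1 s \<circ> rep1 s = id"
proof -
  assume s: "s \<in> A"
  have "ca s s = 2" using s by (simp add: ca_def eta_def m_self)
  then show ?thesis by (simp add: rep1_def fun_eq_iff)
qed

definition dstep :: "'a \<Rightarrow> 'a \<Rightarrow> ('a \<Rightarrow> complex) \<Rightarrow> 'a \<Rightarrow> complex" where
  "dstep s t = rep1 s \<circ> rep1 t"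

lemma rep_replicate: "rep (concat (replicate k [s, t])) = dstep s t ^^ k"
  by (induction k) (simp_all add: comp_assoc dstep_def)

context
  fixes s t
  assumes s: "s \<in> A" and t: "t \<in> A" and ne: "s \<noteq> t"
begin

abbreviation (input) h where "h \<equiv> eta (m s t)"
abbreviation (input) step where "step \<equiv> dstep s t"

lemma diag: "ca s s = 2" "ca t t = 2" "ca s t = - (h + inverse h)" "ca t s = - (h + inverse h)"
  using s t m_sym [OF s t] by (simp_all add: ca_def eta_def m_self)

lemma step_coord: "step \<phi> x = \<phi> x - ca t x * \<phi> t - ca s x * (\<phi> s + (h + inverse h) * \<phi> t)"
  unfolding dstep_def rep1_def o_apply diag(4) by (simp add: algebra_simps)

text \<open>The forms \<open>\<phi> s + h \<phi> t\<close> and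
  \<open>\<phi> s + h^-1 \<phi> t\<close>, independent if \<open>h^2 \<noteq> 1\<close>, diagonalise
  the product of \<open>s\<close> and \<open>t\<close> on the two coordinates that govern
  it.\<close>

lemma step_eigen1: "step \<phi> s + h * step \<phi> t = h\<^sup>2 * (\<phi> s + h * \<phi> t)"
  by (simp only: step_coord diag) (simp add: field_simps power2_eq_square)

lemma step_eigen2: "step \<phi> s + inverse h * step \<phi> t = inverse (h\<^sup>2) * (\<phi> s + inverse h * \<phi> t)"
  by (simp only: step_coord diag) (simp add: field_simps power2_eq_square)

lemma power_eigen1: "(step ^^ k) \<phi> s + h * (step ^^ k) \<phi> t = (h\<^sup>2) ^ k * (\<phi> s + h * \<phi> t)"
proof (induction k)
  case (Suc k)
  have "(step ^^ Suc k) \<phi> = step ((step ^^ k) \<phi>)" by simp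
  then show ?case using step_eigen1 [of "(step ^^ k) \<phi>"] Suc by (simp only:) (simp add: mult.assoc)
qed simp

lemma power_eigen2:
  "(step ^^ k) \<phi> s + inverse h * (step ^^ k) \<phi> t = (inverse (h\<^sup>2)) ^ k * (\<phi> s + inverse h * \<phi> t)"
proof (induction k)
  case (Suc k)
  have "(step ^^ Suc k) \<phi> = step ((step ^^ k) \<phi>)" by simp
  then show ?case using step_eigen2 [of "(step ^^ k) \<phi>"] Suc by (simp only:) (simp add: mult.assoc)
qed simp

lemma power_coord: "(step ^^ k) \<phi> x = \<phi> x - ca t x * (\<Sum>j<k. (step ^^ j) \<phi> t)
   - ca s x * ((\<Sum>j<k. (step ^^ j) \<phi> s) + (h + inverse h) * (\<Sum>j<k. (step ^^ j) \<phi> t))"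
proof (induction k)
  case (Suc k)
  have "(step ^^ Suc k) \<phi> x = step ((step ^^ k) \<phi>) x" by simp
  also note step_coord [of "(step ^^ k) \<phi>" x]
  also note Suc
  finally show ?case by (simp only: sum.lessThan_Suc) (simp add: algebra_simps)
qed simp

text \<open>The orbit sums of both eigenforms are geometric series over a root of unity other than
  \<open>1\<close> whose order divides \<open>m s t\<close>, and vanish. As
  \<open>h \<noteq> h^-1\<close>, the orbit sums of the coordinates \<open>s\<close> and
  \<open>t\<close> vanish too, and by \<open>power_coord\<close> every coordinate changes only
  through these sums.\<close>

lemma step_period:
  assumes m: "m s t \<noteq> 0"
  shows "step ^^ m s t = id"
proof -
  let ?k = "m s t"
  have h2: "h\<^sup>2 \<noteq> 1" using eta_power_eq_1 [of ?k 1] m_ne_1 [OF s t ne] m by auto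
  have h2k: "(h\<^sup>2) ^ ?k = 1" using eta_period m by simp
  have sum0: "(\<Sum>j<?k. z ^ j) = 0" if "z \<noteq> 1" "z ^ ?k = 1" for z :: complex
    using geometric_sum [OF that(1), of ?k] that(2) by simp
  have "id \<phi> x = (step ^^ ?k) \<phi> x" for \<phi> x
  proof -
    let ?p = "\<Sum>j<?k. (step ^^ j) \<phi> s" and ?q = "\<Sum>j<?k. (step ^^ j) \<phi> t"
    have "?p + h * ?q = (\<Sum>j<?k. (h\<^sup>2) ^ j * (\<phi> s + h * \<phi> t))"
      by (simp only: sum_distrib_left sum.distrib [symmetric] power_eigen1)
    also have "\<dots> = 0" using sum0 [OF h2 h2k] by (simp flip: sum_distrib_right)
    finally have 1: "?p + h * ?q = 0" .
    have "?p + inverse h * ?q = (\<Sum>j<?k. (inverse (h\<^sup>2)) ^ j * (\<phi> s + inverse h * \<phi> t))"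
      by (simp only: sum_distrib_left sum.distrib [symmetric] power_eigen2)
    also have "\<dots> = 0" using sum0 [of "inverse (h\<^sup>2)"] h2 h2k
      by (simp flip: sum_distrib_right add: power_inverse)
    finally have 2: "?p + inverse h * ?q = 0" .
    have "(h - inverse h) * ?q = (?p + h * ?q) - (?p + inverse h * ?q)" by (simp add: algebra_simps)
    then have "(h - inverse h) * ?q = 0" by (simp only: 1 2 diff_self)
    moreover have "h - inverse h \<noteq> 0" using h2 by (auto simp: field_simps power2_eq_square)
    ultimately have "?q = 0" by simp
    then show ?thesis using 1 power_coord [of ?k \<phi> x] by simp
  qed
  then show ?thesis by (simp add: fun_eq_iff)
qed

lemma step_exact:
  assumes "step ^^ k = id" "k > 0"
  shows "m s t > 0 \<and> m s t \<le> k"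
proof -
  have "(h\<^sup>2) ^ k = 1"
    \<comment> \<open>On the indicator function of \<open>s\<close> the first eigenform has value
      \<open>1\<close>, so the eigenvalue can be read off directly.\<close>
    using power_eigen1 [of k "\<lambda>x. if x = s then 1 else 0"] ne by (simp add: assms(1))
  then show ?thesis using eta_power_eq_1 [of "m s t" k] assms(2) m_ne_1 [OF s t ne] by simp
qed

end

lemma rep_cong: "u \<approx> v \<Longrightarrow> rep u = rep v"
proof (induction rule: pres_cong.induct)
  case (rel u v p q)
  obtain s t where st: "u = concat (replicate (m s t) [s, t])" "v = []" "s \<in> A" "t \<in> A" "m s t \<noteq> 0"
    using rel(1) by (auto simp: coxeter_rels_def)
  have "rep u = id"
  proof (cases "s = t")
    case True
    then show ?thesis using st rep1_rep1 [of s] by (simp add: m_self)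
  next
    case False
    then show ?thesis using step_period [of s t] st by (simp add: rep_replicate)
  qed
  then show ?case using st by simp
qed auto

text \<open>What the representation is for: it detects the exact order of \<open>s t\<close>, so
  that a trivial power bounds \<open>m s t\<close>. Later arguments use only this
  consequence.\<close>

lemma order_exact:
  assumes "s \<in> A" "t \<in> A" "s \<noteq> t" "(sg s \<circ> sg t) ^^ k = id" "k > 0"
  shows "m s t > 0 \<and> m s t \<le> k"
proof -
  have "wd (concat (replicate k [s, t])) = (sg s \<circ> sg t) ^^ k"
    by (induction k) (simp_all add: comp_assoc)
  then have "concat (replicate k [s, t]) \<approx> []"
    using wd_eq_iff [of "concat (replicate k [s, t])" "[]"] assms
    by (simp add: alternating_double [symmetric] alternating_lists)
  then have "rep (concat (replicate k [s, t])) = id" using rep_cong by fastforce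
  then show ?thesis using step_exact [OF assms(1-3), of k] assms(5) by (simp add: rep_replicate)
qed

end

locale finite_coxeter = coxeter +
  assumes fin_classes: "finite (cls ` lists A)"
begin

notation eqv (infix "\<approx>" 50)

lemma finite_wd: "finite (wd ` lists A)"
proof -
  have "inj_on (\<lambda>f. f (cls [])) (wd ` lists A)"
    by (auto simp: inj_on_def wd_cls cls_eq_iff wd_eq_iff)
  moreover have "(\<lambda>f. f (cls [])) ` wd ` lists A \<subseteq> cls ` lists A" by (auto simp: wd_cls)
  ultimately show ?thesis using fin_classes inj_on_finite by blast
qed

text \<open>In a finite group two different powers of \<open>s t\<close> coincide, so
  \<open>s t\<close> has finite order; by \<open>order_exact\<close> the label is then not
  \<open>0\<close>.\<close>

lemma m_pos:
  assumes "s \<in> A" "t \<in> A"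
  shows "m s t > 0"
proof (cases "s = t")
  case True
  then show ?thesis using assms by (simp add: m_self)
next
  case False
  let ?\<rho> = "sg s \<circ> sg t"
  have wd\<rho>: "wd (concat (replicate k [s, t])) = ?\<rho> ^^ k" for k
    by (induction k) (simp_all add: comp_assoc)
  have "?\<rho> ^^ k \<in> wd ` lists A" for k
    using wd\<rho> [of k] assms by (metis alternating_double alternating_lists imageI)
  then have "finite (range (\<lambda>k. ?\<rho> ^^ k))" using finite_wd by (meson finite_subset image_subsetI)
  then have "\<not> inj (\<lambda>k::nat. ?\<rho> ^^ k)" using finite_imageD infinite_UNIV_nat by blast
  then obtain i j :: nat where "?\<rho> ^^ i = ?\<rho> ^^ j" "i \<noteq> j" unfolding inj_def by blast
  then obtain i j :: nat where ij: "?\<rho> ^^ i = ?\<rho> ^^ j" "i < j" by (metis linorder_neqE_nat)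
  have "concat (replicate i [s, t]) \<in> lists A" for i
    using assms by (simp add: alternating_lists flip: alternating_double)
  note l = this
  have "?\<rho> ^^ j = (?\<rho> ^^ i) \<circ> (?\<rho> ^^ (j - i))" using ij(2) by (simp flip: funpow_add)
  then have "wd (rev (concat (replicate i [s, t]))) \<circ> (?\<rho> ^^ i) =
      wd (rev (concat (replicate i [s, t]))) \<circ> ((?\<rho> ^^ i) \<circ> (?\<rho> ^^ (j - i)))"
    using ij(1) by simp
  then have "?\<rho> ^^ (j - i) = id"
    unfolding wd\<rho> [symmetric] using l by simp
  then show ?thesis using order_exact [OF assms False] ij(2) by simp
qed

subsection \<open>The weak order\<close>

definition cj :: "'a list \<Rightarrow> ('a list set \<Rightarrow> 'a list set) \<Rightarrow> 'a list set \<Rightarrow> 'a list set" where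
  "cj p r = wd p \<circ> r \<circ> wd (rev p)"

lemma cj_inj: "p \<in> lists A \<Longrightarrow> cj p r = cj p r' \<longleftrightarrow> r = r'"
proof
  assume p: "p \<in> lists A" and eq: "cj p r = cj p r'"
  have "wd (rev p) \<circ> cj p r \<circ> wd p = r" for r using p by (simp add: cj_def comp_assoc)
  then show "r = r'" using eq by metis
qed simp

lemma mem_cj: "p \<in> lists A \<Longrightarrow> r \<in> cj p ` B \<longleftrightarrow> wd (rev p) \<circ> r \<circ> wd p \<in> B"
proof
  assume p: "p \<in> lists A"
  show "r \<in> cj p ` B \<Longrightarrow> wd (rev p) \<circ> r \<circ> wd p \<in> B" using p by (auto simp: cj_def comp_assoc)
  assume "wd (rev p) \<circ> r \<circ> wd p \<in> B"
  moreover have "r = cj p (wd (rev p) \<circ> r \<circ> wd p)" using p by (simp add: cj_def comp_assoc)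
  ultimately show "r \<in> cj p ` B" by blast
qed

lemma N_append: "p \<in> lists A \<Longrightarrow> N (p @ u) = (N p - cj p ` N u) \<union> (cj p ` N u - N p)"
  using mem_cj [of p _ "N u"] by (auto simp: N_def inN_append)

lemma card_cj: "p \<in> lists A \<Longrightarrow> card (cj p ` B) = card B"
  by (intro card_image inj_onI) (simp add: cj_inj)

lemma N_append_disjoint:
  assumes "p \<in> lists A" "N p \<subseteq> N (p @ u)"
  shows "N p \<inter> cj p ` N u = {}" "N (p @ u) = N p \<union> cj p ` N u"
  using assms N_append [of p u] by blast+

text \<open>\<open>N (p @ u)\<close> is the symmetric difference of \<open>N p\<close> and a
  conjugate of \<open>N u\<close>; \<open>N p\<close> survives iff the two are disjoint, that is,
  iff the lengths add up. Thus inclusion of inversion sets is the weak order.\<close>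

lemma le_append_iff:
  assumes [simp]: "p \<in> lists A" "u \<in> lists A"
  shows "N p \<subseteq> N (p @ u) \<longleftrightarrow> card (N (p @ u)) = card (N p) + card (N u)"
proof -
  let ?B = "cj p ` N u"
  have fin: "finite (N p)" "finite ?B" by simp_all
  have "card (N (p @ u)) = card (N p - ?B) + card (?B - N p)"
    unfolding N_append [OF assms(1)] using fin by (intro card_Un_disjoint) auto
  also have "card (N p - ?B) = card (N p) - card (N p \<inter> ?B)" using fin by (simp add: card_Diff_subset_Int)
  also have "card (?B - N p) = card ?B - card (N p \<inter> ?B)"
    using fin by (simp add: card_Diff_subset_Int Int_commute)
  finally have c: "card (N (p @ u)) = (card (N p) - card (N p \<inter> ?B)) + (card (N u) - card (N p \<inter> ?B))"
    by (simp add: card_cj)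
  have le: "card (N p \<inter> ?B) \<le> card (N p)" using fin by (simp add: card_mono)
  have "N p \<subseteq> N (p @ u) \<longleftrightarrow> N p \<inter> ?B = {}" using N_append [OF assms(1), of u] by blast
  also have "\<dots> \<longleftrightarrow> card (N p \<inter> ?B) = 0" using fin by simp
  also have "\<dots> \<longleftrightarrow> card (N (p @ u)) = card (N p) + card (N u)" using c le by linarith
  finally show ?thesis .
qed

lemma card_append_le: "p \<in> lists A \<Longrightarrow> u \<in> lists A \<Longrightarrow> card (N (p @ u)) \<le> card (N p) + card (N u)"
proof -
  assume p: "p \<in> lists A" "u \<in> lists A"
  have "card (N (p @ u)) \<le> card (N p \<union> cj p ` N u)"
    using p N_append [OF p(1), of u] by (intro card_mono) auto
  also have "\<dots> \<le> card (N p) + card (cj p ` N u)" by (rule card_Un_le)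
  finally show ?thesis using p by (simp add: card_cj)
qed

lemma reduced_append:
  assumes "reduced (u @ v)"
  shows "reduced u" "reduced v" "N u \<subseteq> N (u @ v)"
proof -
  have l: "u \<in> lists A" "v \<in> lists A" using assms by (auto simp: reduced_def)
  have "length u + length v = card (N (u @ v))" using assms by (simp add: reduced_def)
  then show "reduced u" "reduced v" "N u \<subseteq> N (u @ v)"
    using card_append_le [OF l] card_N_le [OF l(1)] card_N_le [OF l(2)] l
    by (auto simp: reduced_def le_append_iff)
qed

lemma reduced_appendI:
  "reduced u \<Longrightarrow> reduced v \<Longrightarrow> N u \<subseteq> N (u @ v) \<Longrightarrow> reduced (u @ v)"
  using le_append_iff [of u v] by (auto simp: reduced_def)

lemma wd_cancel_left:
  assumes "u \<in> lists A"
  shows "wd u \<circ> f = wd u \<circ> g \<longleftrightarrow> f = g"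
proof
  assume "wd u \<circ> f = wd u \<circ> g"
  then have "wd (rev u) \<circ> (wd u \<circ> f) = wd (rev u) \<circ> (wd u \<circ> g)" by simp
  then show "f = g" using assms by simp
qed simp

lemma factor:
  assumes "u \<in> lists A" "v \<in> lists A" "N u \<subseteq> N v"
  shows "\<exists>x. reduced x \<and> wd (u @ x) = wd v \<and> card (N v) = card (N u) + length x"
proof -
  obtain x where x: "reduced x" "wd x = wd (rev u @ v)"
    using ex_reduced [of "rev u @ v"] assms by auto
  have w: "wd (u @ x) = wd v" using x assms by simp
  then have "N (u @ x) = N v" using N_cong [of "u @ x" v] assms x by auto
  then show ?thesis using x w assms le_append_iff [of u x] by (intro exI [of _ x]) (auto simp: reduced_def)
qed

lemma N_eq_iff: "u \<in> lists A \<Longrightarrow> v \<in> lists A \<Longrightarrow> N u = N v \<longleftrightarrow> wd u = wd v"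
  using factor [of u v] N_cong [of u v] by fastforce

lemma N_append_mono:
  assumes "u \<in> lists A" "N u \<subseteq> N (u @ x)" "N u \<subseteq> N (u @ y)"
  shows "N (u @ x) \<subseteq> N (u @ y) \<longleftrightarrow> N x \<subseteq> N y"
proof -
  note x = N_append_disjoint [OF assms(1,2)] and y = N_append_disjoint [OF assms(1,3)]
  have "N (u @ x) \<subseteq> N (u @ y) \<longleftrightarrow> cj u ` N x \<subseteq> cj u ` N y"
    unfolding x(2) y(2) using x(1) y(1) by blast
  also have "\<dots> \<longleftrightarrow> N x \<subseteq> N y" using cj_inj [OF assms(1)] by (auto simp: inj_image_subset_iff inj_def)
  finally show ?thesis .
qed

lemma N_append_down:
  assumes "u \<in> lists A" "N u \<subseteq> N (u @ y)" "N x \<subseteq> N y"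
  shows "N u \<subseteq> N (u @ x)"
  using N_append_disjoint [OF assms(1,2)] assms(3) unfolding N_append [OF assms(1), of x] by blast

lemma N_single: "s \<in> A \<Longrightarrow> N [s] = {sg s}"
  by (auto simp: N_def)

subsection \<open>Rank two\<close>

lemma two_letter_word:
  assumes "d \<in> lists {s, t}"
  shows "(\<exists>x y. {x, y} = {s, t} \<and> d = alternating x y (length d)) \<or> (\<exists>p x q. d = p @ [x, x] @ q)"
  using assms
proof (induction d rule: list.induct)
  case (Cons a d)
  then have a: "a \<in> {s, t}" and d: "d \<in> lists {s, t}" by auto
  from Cons.IH [OF d] show ?case
  proof
    assume "\<exists>p x q. d = p @ [x, x] @ q"
    then obtain p x q where "d = p @ [x, x] @ q" by blast
    then have "a # d = (a # p) @ [x, x] @ q" by simp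
    then show ?thesis by blast
  next
    assume "\<exists>x y. {x, y} = {s, t} \<and> d = alternating x y (length d)"
    then obtain x y where xy: "{x, y} = {s, t}" "d = alternating x y (length d)" by blast
    show ?thesis
    proof (cases d)
      case Nil
      obtain b where "{a, b} = {s, t}" using a by auto
      then show ?thesis using Nil by force
    next
      case (Cons c e)
      then have dx: "d = x # alternating y x (length e)" using xy(2) by simp
      show ?thesis
      proof (cases "a = x")
        case True
        then have "a # d = [] @ [x, x] @ alternating y x (length e)" using dx by simp
        then show ?thesis by blast
      next
        case False
        then have "a = y" using a xy(1) by auto
        then have "{a, x} = {s, t} \<and> a # d = alternating a x (length (a # d))" using xy by auto
        then show ?thesis by blast
      qed
    qed
  qed
qed (auto intro: exI [of _ s] exI [of _ t])

lemma N_alternating_mem: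
  assumes "s \<in> A" "t \<in> A" "r \<in> N (alternating s t k)"
  shows "\<exists>i<k. r = ((sg s \<circ> sg t) ^^ i) \<circ> sg s"
proof (rule ccontr)
  assume "\<not> ?thesis"
  then have "(\<Sum>i<k. of_bool (r = ((sg s \<circ> sg t) ^^ i) \<circ> sg s) :: nat) = 0" by simp
  then show False using assms inN_alternating [of s t k r] unfolding N_def mem_Collect_eq by presburger
qed

text \<open>Write \<open>w = d b\<close> with \<open>d\<close> in the dihedral subgroup of
  \<open>s\<close> and \<open>t\<close> and \<open>b\<close> of least length, and then
  \<open>d\<close> of least length. The inversions of \<open>w\<close> in the subgroup are those of
  \<open>d\<close>, and both \<open>s\<close> and \<open>t\<close> are among them. This forces
  \<open>d\<close> to be the longest dihedral element.\<close>

lemma dihedral_le: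
  assumes s: "s \<in> A" and t: "t \<in> A" and ne: "s \<noteq> t" and w: "w \<in> lists A"
    and st: "sg s \<in> N w" "sg t \<in> N w"
  shows "N (alternating s t (m s t)) \<subseteq> N w"
proof -
  have sub: "lists {s, t} \<subseteq> lists A" using s t by (intro lists_mono) auto
  define Q where "Q b \<longleftrightarrow> b \<in> lists A \<and> (\<exists>d\<in>lists {s, t}. wd (d @ b) = wd w)" for b
  have "Q w" unfolding Q_def using w by (auto intro: bexI [of _ "[]"])
  then obtain b where b: "Q b" and min: "\<And>b'. Q b' \<Longrightarrow> length b \<le> length b'"
    using ex_has_least_nat [of Q w length] by blast
  then have bl: "b \<in> lists A" by (simp add: Q_def)
  define Q' where "Q' d \<longleftrightarrow> d \<in> lists {s, t} \<and> wd (d @ b) = wd w" for d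
  obtain d0 where "Q' d0" using b by (auto simp: Q_def Q'_def)
  then obtain d where d: "Q' d" and dmin: "\<And>d'. Q' d' \<Longrightarrow> length d \<le> length d'"
    using ex_has_least_nat [of Q' d0 length] by blast
  then have dl: "d \<in> lists {s, t}" "d \<in> lists A" and wdb: "wd (d @ b) = wd w"
    using sub by (auto simp: Q'_def)
  have Nw: "N w = N (d @ b)" using wdb w dl bl by (intro N_cong) auto
  \<comment> \<open>A dihedral reflection contributed by \<open>b\<close> would delete a letter from
    \<open>b\<close> by \<open>exchange\<close>, with the remaining factor still dihedral; this
    contradicts the choice of \<open>b\<close>.\<close>
  have bad: "r \<notin> cj d ` N b" if e: "e \<in> lists {s, t}" "r = wd e" for r e
  proof
    assume "r \<in> cj d ` N b"
    then have r': "wd (rev d @ e @ d) \<in> N b" using mem_cj [OF dl(2)] e by (simp add: comp_assoc)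
    let ?f = "rev d @ e @ d"
    have f: "?f \<in> lists {s, t}" "?f \<in> lists A" using dl e sub by auto
    obtain p x q where pq: "b = p @ [x] @ q" "wd ?f \<circ> wd b = wd (p @ q)"
      using exchange [OF bl r'] by blast
    have "wd (d @ rev ?f) \<circ> wd (p @ q) = wd d \<circ> (wd (rev ?f) \<circ> (wd ?f \<circ> wd b))"
      using pq(2) by (simp add: comp_assoc)
    also have "\<dots> = wd w" using wd_rev_l(1) [OF f(2), of "wd b"] wdb by simp
    finally have "wd ((d @ rev ?f) @ (p @ q)) = wd w" by (simp add: comp_assoc)
    moreover have "d @ rev ?f \<in> lists {s, t}" "p @ q \<in> lists A" using dl f bl pq(1) by auto
    ultimately have "Q (p @ q)" unfolding Q_def by blast
    then show False using min [of "p @ q"] pq(1) by simp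
  qed
  have D: "r \<in> N w \<longleftrightarrow> r \<in> N d" if "e \<in> lists {s, t}" "r = wd e" for r e
    using bad [OF that] unfolding Nw N_append [OF dl(2)] by blast
  have "sg s \<in> N d" "sg t \<in> N d"
    using D [of "[s]" "sg s"] D [of "[t]" "sg t"] st by auto
  have no2: "\<not> (\<exists>p x q. d = p @ [x, x] @ q)"
  proof
    assume "\<exists>p x q. d = p @ [x, x] @ q"
    then obtain p x q where pxq: "d = p @ [x, x] @ q" by blast
    then have "x \<in> A" using dl(2) by simp
    then have "wd (p @ q) = wd d" using pxq by (simp add: comp_assoc)
    then have "wd ((p @ q) @ b) = wd (d @ b)" by (simp only: wd_append [of _ b])
    then have "Q' (p @ q)" using wdb dl(1) pxq by (simp add: Q'_def)
    then show False using dmin [of "p @ q"] pxq by simp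
  qed
  then obtain x y where xy: "{x, y} = {s, t}" and alt: "d = alternating x y (length d)"
    using two_letter_word [OF dl(1)] by blast
  have xA: "x \<in> A" "y \<in> A" and xney: "x \<noteq> y" using xy s t ne by (auto simp: doubleton_eq_iff)
  let ?m = "m x y"
  have mpos: "?m > 0" using m_pos xA by blast
  \<comment> \<open>Past length \<open>m x y\<close>, a braid move on the letters after the first
    produces \<open>x x\<close>, which cancels.\<close>
  have len: "length d \<le> ?m"
  proof (rule ccontr)
    assume "\<not> ?thesis"
    then obtain l where l: "length d = Suc (?m + l)" by (metis add_Suc_right less_imp_Suc_add not_le)
    define z where "z = (if even ?m then alternating y x l else alternating x y l)"
    obtain k where k: "?m = Suc k" using mpos gr0_conv_Suc by blast
    have "d = x # alternating y x ?m @ z"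
      using alt l alternating_add [of y x ?m l] by (simp add: z_def)
    moreover have "wd (alternating y x ?m) = sg x \<circ> wd (alternating y x k)"
      using wd_alternating [OF xA] mpos k by simp
    ultimately have "wd d = wd (alternating y x k @ z)" using xA by (simp add: comp_assoc)
    then have "wd ((alternating y x k @ z) @ b) = wd (d @ b)" by (simp only: wd_append [of _ b])
    moreover have "alternating y x k @ z \<in> lists {s, t}"
      using xy alternating_lists [of x "{s, t}" y] alternating_lists [of y "{s, t}" x] by (auto simp: z_def)
    ultimately have "Q' (alternating y x k @ z)" using wdb by (simp add: Q'_def)
    then have "length d \<le> length (alternating y x k @ z)" by (rule dmin)
    then show False using l k by (simp add: z_def split: if_splits)
  qed
  have "sg y \<in> N d" using xy \<open>sg s \<in> N d\<close> \<open>sg t \<in> N d\<close> by (auto simp: doubleton_eq_iff)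
  then obtain i where i: "i < length d" "sg y = ((sg x \<circ> sg y) ^^ i) \<circ> sg x"
    using N_alternating_mem [of x y "sg y" "length d"] xA alt by metis
  \<comment> \<open>\<open>y\<close> is the palindrome number \<open>i\<close> of a word starting
    with \<open>x\<close>, which makes \<open>(x y)^(i+1)\<close> trivial; the exact order then
    gives \<open>m x y \<le> i + 1 \<le> length d\<close>.\<close>
  have "(sg x \<circ> sg y) ^^ Suc i = id"
  proof -
    have "(sg x \<circ> sg y) ^^ Suc i = ((sg x \<circ> sg y) ^^ i) \<circ> sg x \<circ> sg y"
      by (simp only: funpow_Suc_right comp_assoc)
    also have "\<dots> = sg y \<circ> sg y" by (simp only: i(2) [symmetric])
    finally show ?thesis using xA by simp
  qed
  then have "?m \<le> Suc i" using order_exact [OF xA xney] by blast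
  then have "length d = ?m" using len i(1) by simp
  then have dm: "d = alternating x y ?m" using alt by simp
  have "wd d = wd (alternating s t (m s t))"
    using dm xy wd_alternating [OF s t] m_pos [OF s t] m_sym [OF s t] by (auto simp: doubleton_eq_iff)
  then have "N (alternating s t (m s t)) = N d"
    using N_cong dl alternating_lists s t by metis
  moreover have "N d \<subseteq> N w"
  proof
    fix r assume r: "r \<in> N d"
    then obtain i where "r = ((sg x \<circ> sg y) ^^ i) \<circ> sg x"
      using N_alternating_mem [of x y r ?m] xA dm by metis
    moreover have "wd (concat (replicate i [x, y])) = (sg x \<circ> sg y) ^^ i"
      by (induction i) (simp_all add: comp_assoc)
    then have "wd (concat (replicate i [x, y]) @ [x]) = ((sg x \<circ> sg y) ^^ i) \<circ> sg x"
      by (simp only: wd_append wd_simps comp_id)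
    moreover have "concat (replicate i [x, y]) @ [x] \<in> lists {s, t}"
      using xy alternating_lists [of x "{s, t}" y "2 * i"] by (simp add: alternating_double) blast
    ultimately show "r \<in> N w" using D r by metis
  qed
  ultimately show ?thesis by simp
qed

text \<open>The \<open>m s t\<close> reflections \<open>(s t)^i s\<close> are distinct, because
  \<open>s t\<close> has order exactly \<open>m s t\<close>; each then occurs once, hence an odd
  number of times.\<close>

lemma reduced_alternating:
  assumes s: "s \<in> A" and t: "t \<in> A" and ne: "s \<noteq> t"
  shows "reduced (alternating s t (m s t))"
proof -
  let ?m = "m s t" and ?\<rho> = "sg s \<circ> sg t"
  have l: "alternating s t k \<in> lists A" for k using s t by (simp add: alternating_lists)
  have wd\<rho>: "wd (concat (replicate k [s, t])) = ?\<rho> ^^ k" for k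
    by (induction k) (simp_all add: comp_assoc)
  have inj: "i = j" if "i < ?m" "j < ?m" "(?\<rho> ^^ i) \<circ> sg s = (?\<rho> ^^ j) \<circ> sg s" for i j
  proof -
    have *: "j \<le> i" if "i < ?m" "j < ?m" "(?\<rho> ^^ i) \<circ> sg s = (?\<rho> ^^ j) \<circ> sg s" for i j
    proof (rule ccontr)
      assume "\<not> j \<le> i"
      then have ij: "i < j" by simp
      have "?\<rho> ^^ i \<circ> sg s \<circ> sg s = ?\<rho> ^^ j \<circ> sg s \<circ> sg s" using that(3) by simp
      then have "?\<rho> ^^ i = ?\<rho> ^^ j" using s by (simp add: comp_assoc)
      moreover have "?\<rho> ^^ j = (?\<rho> ^^ i) \<circ> (?\<rho> ^^ (j - i))" using ij by (simp flip: funpow_add)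
      ultimately have "(?\<rho> ^^ i) \<circ> id = (?\<rho> ^^ i) \<circ> (?\<rho> ^^ (j - i))" by simp
      moreover have "concat (replicate i [s, t]) \<in> lists A" using l [of "2 * i"] by (simp add: alternating_double)
      ultimately have "?\<rho> ^^ (j - i) = id"
        using wd_cancel_left [of "concat (replicate i [s, t])" id "?\<rho> ^^ (j - i)"] wd\<rho> [of i] by simp
      then show False using order_exact [OF s t ne, of "j - i"] ij that(2) by linarith
    qed
    show ?thesis using *[of i j] *[of j i] that by simp
  qed
  have "(\<lambda>i. (?\<rho> ^^ i) \<circ> sg s) ` {..<?m} \<subseteq> N (alternating s t ?m)"
  proof clarify
    fix i assume i: "i < ?m"
    have "(\<Sum>j<?m. of_bool ((?\<rho> ^^ i) \<circ> sg s = (?\<rho> ^^ j) \<circ> sg s) :: nat) = (\<Sum>j<?m. if j = i then 1 else 0)"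
      using inj i by (intro sum.cong) auto
    also have "\<dots> = 1" using i by simp
    finally show "(?\<rho> ^^ i) \<circ> sg s \<in> N (alternating s t ?m)"
      unfolding N_def mem_Collect_eq inN_alternating [OF s t] by simp
  qed
  then have "card ((\<lambda>i. (?\<rho> ^^ i) \<circ> sg s) ` {..<?m}) \<le> card (N (alternating s t ?m))"
    using l by (intro card_mono) auto
  also have "card ((\<lambda>i. (?\<rho> ^^ i) \<circ> sg s) ` {..<?m}) = ?m"
    using inj by (subst card_image) (auto simp: inj_on_def)
  finally show ?thesis using card_N_le [OF l [of ?m]] l by (simp add: reduced_def)
qed

subsection \<open>Joins in the weak order\<close>

text \<open>An element with the most inversions has all of them: if \<open>r\<close> were missing
  from \<open>N w\<close>, then \<open>r\<close> would be an inversion of \<open>r w\<close>,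
  \<open>exchange\<close> would make \<open>w\<close> shorter than \<open>r w\<close>, and
  \<open>r w\<close> would have more inversions than \<open>w\<close>.\<close>

lemma ex_top: "\<exists>w\<in>lists A. \<forall>u\<in>lists A. N u \<subseteq> N w"
proof -
  have "finite ((\<lambda>w. card (N w)) ` lists A)"
  proof -
    have "(\<lambda>w. card (N w)) ` lists A \<subseteq> (\<lambda>f. card (N (SOME u. u \<in> lists A \<and> wd u = f))) ` wd ` lists A"
    proof clarify
      fix w assume w: "w \<in> lists A"
      then have "\<exists>u. u \<in> lists A \<and> wd u = wd w" by blast
      from someI_ex [OF this] have "N (SOME u. u \<in> lists A \<and> wd u = wd w) = N w" using N_cong w by blast
      then show "card (N w) \<in> (\<lambda>f. card (N (SOME u. u \<in> lists A \<and> wd u = f))) ` wd ` lists A"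
        using w by (intro image_eqI [of _ _ "wd w"]) auto
    qed
    then show ?thesis using finite_wd by (meson finite_imageI finite_subset)
  qed
  moreover have "(\<lambda>w. card (N w)) ` lists A \<noteq> {}" using lists.Nil by blast
  ultimately obtain w where w: "w \<in> lists A" and max: "\<And>u. u \<in> lists A \<Longrightarrow> card (N u) \<le> card (N w)"
    using Max_in [of "(\<lambda>w. card (N w)) ` lists A"] Max_ge [of "(\<lambda>w. card (N w)) ` lists A"] by (smt (verit) imageE imageI)
  have "r \<in> N w" if u: "u \<in> lists A" "r \<in> N u" for u r
  proof (rule ccontr)
    assume no: "r \<notin> N w"
    have "\<exists>p x. p \<in> lists A \<and> x \<in> A \<and> r = wd (p @ [x] @ rev p)"
      using u
    proof (induction u arbitrary: r rule: list.induct)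
      case (Cons a u)
      then have a: "a \<in> A" and ul: "u \<in> lists A" by auto
      show ?case
      proof (cases "r = sg a")
        case True
        then show ?thesis using a by (intro exI [of _ "[]"] exI [of _ a]) simp
      next
        case False
        then have "sg a \<circ> r \<circ> sg a \<in> N u" using Cons.prems by (simp add: N_def)
        then obtain p x where px: "p \<in> lists A" "x \<in> A" "sg a \<circ> r \<circ> sg a = wd (p @ [x] @ rev p)"
          using Cons.IH [OF ul] by blast
        have "r = sg a \<circ> (sg a \<circ> r \<circ> sg a) \<circ> sg a" using a by (simp add: comp_assoc)
        also have "\<dots> = wd ((a # p) @ [x] @ rev (a # p))" unfolding px(3) by (simp add: comp_assoc)
        finally have "r = wd ((a # p) @ [x] @ rev (a # p))" .
        moreover have "a # p \<in> lists A" using a px(1) by simp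
        ultimately show ?thesis using px(2) by blast
      qed
    qed simp
    then obtain p x where px: "p \<in> lists A" "x \<in> A" "r = wd (p @ [x] @ rev p)" by blast
    let ?t = "p @ [x] @ rev p"
    have t: "?t \<in> lists A" "rev ?t = ?t" using px by auto
    have rr: "wd ?t \<circ> wd ?t = id" using wd_rev [OF t(1)] t(2) by simp
    have "inN ?t r"
    proof -
      have "inN (p @ rev p) r = False" using inN_cancel [OF px(1)] .
      moreover have "wd (rev p) \<circ> r \<circ> wd p = sg x" unfolding px(3) using px(1) by (simp add: comp_assoc)
      ultimately show ?thesis
        using px(2) unfolding inN_append by (simp add: comp_assoc)
    qed
    moreover have "wd (rev ?t) \<circ> r \<circ> wd ?t = r"
      by (simp only: t(2) px(3) rr id_comp)
    ultimately have "inN (?t @ w) r" using no unfolding inN_append [of ?t w] by (simp add: N_def)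
    then have "r \<in> N (?t @ w)" by (simp add: N_def)
    obtain v where v: "reduced v" "wd v = wd (?t @ w)" using ex_reduced [of "?t @ w"] t w by auto
    have vl: "v \<in> lists A" and tw: "?t @ w \<in> lists A" using v(1) t w by auto
    have Nv: "N v = N (?t @ w)" by (rule N_cong [OF vl tw v(2)])
    then obtain a y q where ayq: "v = a @ [y] @ q" "r \<circ> wd v = wd (a @ q)"
      using exchange [OF vl, of r] \<open>r \<in> N (?t @ w)\<close> Nv by blast
    have "r \<circ> wd v = wd w" unfolding v(2) px(3) wd_append [of ?t w] using rr by (simp only: comp_assoc [symmetric]) simp
    then have "wd w = wd (a @ q)" using ayq by simp
    moreover have aq: "a @ q \<in> lists A" using v(1) ayq(1) by (auto simp: reduced_def)
    ultimately have "card (N w) \<le> length (a @ q)" using N_cong [OF w aq] card_N_le [OF aq] by simp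
    also have "\<dots> < length v" using ayq by simp
    also have "\<dots> = card (N (?t @ w))" using v Nv by (simp add: reduced_def)
    also have "\<dots> \<le> card (N w)" using max [of "?t @ w"] t w by simp
    finally show False by simp
  qed
  then show ?thesis using w by blast
qed

definition is_join :: "'a list \<Rightarrow> 'a list \<Rightarrow> 'a list \<Rightarrow> bool" where
  "is_join u v j \<longleftrightarrow> j \<in> lists A \<and> N u \<subseteq> N j \<and> N v \<subseteq> N j \<and>
     (\<forall>z\<in>lists A. N u \<subseteq> N z \<and> N v \<subseteq> N z \<longrightarrow> N j \<subseteq> N z)"

lemma is_join_cong: "N u = N u' \<Longrightarrow> N v = N v' \<Longrightarrow> is_join u v j \<longleftrightarrow> is_join u' v' j"
  by (simp add: is_join_def)

lemma cover:
  assumes "x \<in> lists A" "u \<in> lists A" "N x \<subset> N u"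
  obtains s where "s \<in> A" "N x \<subseteq> N (x @ [s])" "N (x @ [s]) \<subseteq> N u" "card (N (x @ [s])) = Suc (card (N x))"
proof -
  obtain z where z: "reduced z" "wd (x @ z) = wd u" "card (N u) = card (N x) + length z"
    using factor [of x u] assms by blast
  have zl: "z \<in> lists A" using z by auto
  have Nu: "N (x @ z) = N u" using N_cong [of "x @ z" u] z assms zl by auto
  have "card (N x) < card (N u)" using assms by (intro psubset_card_mono) auto
  then obtain s z' where sz: "z = s # z'" using z(3) by (cases z) auto
  then have s: "s \<in> A" and z': "z' \<in> lists A" using zl by auto
  have "reduced ([s] @ z')" using z(1) sz by simp
  then have "N [s] \<subseteq> N z" using reduced_append(3) [of "[s]" z'] sz by simp
  then have 1: "N x \<subseteq> N (x @ [s])" using N_append_down [of x z "[s]"] Nu assms by blast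
  moreover have "N (x @ [s]) \<subseteq> N u"
    using N_append_mono [of x "[s]" z] \<open>N [s] \<subseteq> N z\<close> 1 Nu assms by auto
  moreover have "card (N (x @ [s])) = Suc (card (N x))"
    using 1 le_append_iff [of x "[s]"] s assms by (simp add: N_single)
  ultimately show thesis using that s by blast
qed

text \<open>The argument of Bjorner, Edelman and Ziegler: a finite poset with a top element is a lattice
  once any two covers of an element have a join.\<close>

lemma ex_join_above:
  assumes "x \<in> lists A" "u \<in> lists A" "v \<in> lists A" "N x \<subseteq> N u" "N x \<subseteq> N v"
  shows "\<exists>j. is_join u v j"
proof -
  obtain w0 where w0: "w0 \<in> lists A" "\<And>u. u \<in> lists A \<Longrightarrow> N u \<subseteq> N w0" using ex_top by blast
  show ?thesis using assms
  proof (induction "card (N w0) - card (N x)" arbitrary: x u v rule: less_induct)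
    case less
    note x = less.prems(1) and u = less.prems(2) and v = less.prems(3)
    have IH: "\<exists>j. is_join u' v' j" if "x' \<in> lists A" "u' \<in> lists A" "v' \<in> lists A" "N x' \<subseteq> N u'" "N x' \<subseteq> N v'"
      "card (N x') = Suc (card (N x))" for x' u' v'
    proof -
      have "card (N x') \<le> card (N w0)" using w0 that by (intro card_mono) auto
      then have "card (N w0) - card (N x') < card (N w0) - card (N x)" using that(6) by linarith
      then show ?thesis using less.hyps [of x' u' v'] that(1-5) by blast
    qed
    show ?case
    proof (cases "N x = N u \<or> N x = N v")
      case True
      then show ?thesis
      proof
        assume "N x = N u"
        then have "is_join u v v" using less.prems by (auto simp: is_join_def)
        then show ?thesis by blast
      next
        assume "N x = N v"
        then have "is_join u v u" using less.prems by (auto simp: is_join_def)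
        then show ?thesis by blast
      qed
    next
      case False
      then have ps: "N x \<subset> N u" "N x \<subset> N v" using less.prems by auto
      obtain s where s: "s \<in> A" "N x \<subseteq> N (x @ [s])" "N (x @ [s]) \<subseteq> N u" "card (N (x @ [s])) = Suc (card (N x))"
        using cover [OF x u ps(1)] .
      obtain t where t: "t \<in> A" "N x \<subseteq> N (x @ [t])" "N (x @ [t]) \<subseteq> N v" "card (N (x @ [t])) = Suc (card (N x))"
        using cover [OF x v ps(2)] .
      have xs: "x @ [s] \<in> lists A" and xt: "x @ [t] \<in> lists A" using x s t by auto
      show ?thesis
      proof (cases "s = t")
        case True
        then show ?thesis using IH [OF xs u v s(3)] t(3) s(4) by blast
      next
        case ne: False
        \<comment> \<open>\<open>x\<close> times the longest dihedral element is the join of the two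
          covers; \<open>dihedral_le\<close> shows that it lies below every upper bound.\<close>
        let ?a = "alternating s t (m s t)"
        let ?j = "x @ ?a"
        have al: "?a \<in> lists A" using s t by (simp add: alternating_lists)
        have jl: "?j \<in> lists A" using x al by simp
        have ub: "N x \<subseteq> N ?j \<and> N ?j \<subseteq> N z"
          if z: "z \<in> lists A" "N (x @ [s]) \<subseteq> N z" "N (x @ [t]) \<subseteq> N z" for z
        proof -
          have "N x \<subseteq> N z" using s z by blast
          then obtain y where y: "reduced y" "wd (x @ y) = wd z" using factor [OF x z(1)] by blast
          then have yl: "y \<in> lists A" by auto
          have Nz: "N (x @ y) = N z" using N_cong [of "x @ y" z] y yl x z by auto
          have "N [s] \<subseteq> N y" "N [t] \<subseteq> N y"
            using N_append_mono [OF x, of "[s]" y] N_append_mono [OF x, of "[t]" y] s t z Nz \<open>N x \<subseteq> N z\<close> by auto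
          then have "N ?a \<subseteq> N y" using dihedral_le [OF s(1) t(1) ne yl] s(1) t(1) by (simp add: N_single)
          moreover have "N x \<subseteq> N ?j" using N_append_down [OF x, of y ?a] calculation Nz \<open>N x \<subseteq> N z\<close> by blast
          ultimately show ?thesis using N_append_mono [OF x, of ?a y] Nz \<open>N x \<subseteq> N z\<close> by auto
        qed
        have xj: "N x \<subseteq> N ?j" using ub [OF w0(1)] w0(2) xs xt by blast
        have red: "reduced ?a" "reduced (alternating t s (m s t))"
          using reduced_alternating [OF s(1) t(1) ne] reduced_alternating [OF t(1) s(1)] ne m_sym [OF s(1) t(1)] by auto
        have Nalt: "N (alternating t s (m s t)) = N ?a"
          using wd_alternating [OF s(1) t(1)] m_pos [OF s(1) t(1)] s t by (intro N_cong) (auto simp: alternating_lists)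
        obtain k where k: "m s t = Suc k" using m_pos [OF s(1) t(1)] gr0_conv_Suc by blast
        have "N [s] \<subseteq> N ?a" using reduced_append(3) [of "[s]" "alternating t s k"] red(1) k by simp
        moreover have "N [t] \<subseteq> N ?a"
          using reduced_append(3) [of "[t]" "alternating s t k"] red(2) k Nalt by simp
        ultimately have sj: "N (x @ [s]) \<subseteq> N ?j" and tj: "N (x @ [t]) \<subseteq> N ?j"
          using N_append_mono [OF x, of "[s]" ?a] N_append_mono [OF x, of "[t]" ?a] s t xj by auto
        \<comment> \<open>All three joins are taken above \<open>x s\<close> or \<open>x t\<close>,
          which lie one level higher than \<open>x\<close>, so the induction hypothesis applies:
          \<open>u\<close> and \<open>v\<close> are each joined with the join of the covers, and
          then the two results are joined.\<close>
        obtain j1 where j1: "is_join u ?j j1" using IH [OF xs u jl s(3) sj s(4)] by blast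
        obtain j2 where j2: "is_join v ?j j2" using IH [OF xt v jl t(3) tj t(4)] by blast
        have l: "j1 \<in> lists A" "j2 \<in> lists A" using j1 j2 by (auto simp: is_join_def)
        have "N (x @ [s]) \<subseteq> N j1" "N (x @ [s]) \<subseteq> N j2" using j1 j2 sj by (auto simp: is_join_def)
        then obtain j3 where j3: "is_join j1 j2 j3" using IH [OF xs l] s(4) by blast
        have "is_join u v j3"
          unfolding is_join_def
        proof (intro conjI ballI impI)
          show "j3 \<in> lists A" "N u \<subseteq> N j3" "N v \<subseteq> N j3" using j1 j2 j3 by (auto simp: is_join_def)
          fix z assume z: "z \<in> lists A" and uv: "N u \<subseteq> N z \<and> N v \<subseteq> N z"
          then have "N ?j \<subseteq> N z" using ub [OF z] s(3) t(3) by blast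
          then have "N j1 \<subseteq> N z" "N j2 \<subseteq> N z" using j1 j2 z uv by (auto simp: is_join_def)
          then show "N j3 \<subseteq> N z" using j3 z by (auto simp: is_join_def)
        qed
        then show ?thesis by blast
      qed
    qed
  qed
qed

section \<open>Complements with respect to the join\<close>

definition jn :: "'a list \<Rightarrow> 'a list \<Rightarrow> 'a list" where
  "jn u v = (SOME j. is_join u v j)"

lemma jn: "u \<in> lists A \<Longrightarrow> v \<in> lists A \<Longrightarrow> is_join u v (jn u v)"
  unfolding jn_def by (rule someI_ex, rule ex_join_above [of "[]"]) auto

lemma jn_lists: "u \<in> lists A \<Longrightarrow> v \<in> lists A \<Longrightarrow> jn u v \<in> lists A"
  using jn by (simp add: is_join_def)

lemma N_jn_eqI: "u \<in> lists A \<Longrightarrow> v \<in> lists A \<Longrightarrow> is_join u v j \<Longrightarrow> N (jn u v) = N j"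
  using jn [of u v] unfolding is_join_def by blast

text \<open>The complement of \<open>u\<close> in its join with \<open>v\<close>. A fixed reduced
  word is chosen for each element of \<open>W\<close>, so that \<open>res_cong\<close> is an
  equality of words.\<close>

definition res :: "'a list \<Rightarrow> 'a list \<Rightarrow> 'a list" where
  "res u v = (SOME z. reduced z \<and> wd z = wd (rev u @ jn u v))"

lemma res:
  assumes "u \<in> lists A" "v \<in> lists A"
  shows "reduced (res u v)" "wd (u @ res u v) = wd (jn u v)" "N u \<subseteq> N (u @ res u v)"
    "N (u @ res u v) = N (jn u v)"
proof -
  have "\<exists>z. reduced z \<and> wd z = wd (rev u @ jn u v)"
    using ex_reduced [of "rev u @ jn u v"] assms jn_lists by auto
  from someI_ex [OF this] have 1: "reduced (res u v)" "wd (res u v) = wd (rev u @ jn u v)"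
    unfolding res_def by blast+
  then show "reduced (res u v)" "wd (u @ res u v) = wd (jn u v)" using assms by simp_all
  then show 2: "N (u @ res u v) = N (jn u v)"
    using assms jn_lists by (intro N_cong) auto
  show "N u \<subseteq> N (u @ res u v)" unfolding 2 using jn [OF assms] by (simp add: is_join_def)
qed

lemma res_lists: "u \<in> lists A \<Longrightarrow> v \<in> lists A \<Longrightarrow> res u v \<in> lists A"
  using res(1) by auto

lemma res_cong:
  assumes "u \<in> lists A" "u' \<in> lists A" "v \<in> lists A" "v' \<in> lists A" "wd u = wd u'" "wd v = wd v'"
  shows "res u v = res u' v'"
proof -
  have "N u = N u'" "N v = N v'" using assms N_cong by blast+
  then have "is_join u v = is_join u' v'" by (intro ext is_join_cong)
  then have "jn u v = jn u' v'" by (simp add: jn_def)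
  then show ?thesis using wd_rev_cong [OF assms(1,2,5)] by (simp add: res_def)
qed

text \<open>Every upper bound of \<open>v a\<close> and \<open>v b\<close> lies above
  \<open>v\<close>, hence is of the form \<open>v y\<close>, and \<open>y\<close> is an upper bound
  of \<open>a\<close> and \<open>b\<close>.\<close>

lemma is_join_translate:
  assumes l: "v \<in> lists A" "a \<in> lists A" "b \<in> lists A" and va: "N v \<subseteq> N (v @ a)" and vb: "N v \<subseteq> N (v @ b)"
  shows "is_join (v @ a) (v @ b) (v @ jn a b)" "N v \<subseteq> N (v @ jn a b)"
proof -
  have ub: "N v \<subseteq> N (v @ jn a b) \<and> N (v @ jn a b) \<subseteq> N z"
    if z: "z \<in> lists A" "N (v @ a) \<subseteq> N z" "N (v @ b) \<subseteq> N z" for z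
  proof -
    have "N v \<subseteq> N z" using va z by blast
    then obtain y where y: "reduced y" "wd (v @ y) = wd z" using factor [OF l(1) z(1)] by blast
    then have yl: "y \<in> lists A" by auto
    have Nz: "N (v @ y) = N z" using N_cong [of "v @ y" z] y yl l z by auto
    have "N a \<subseteq> N y" "N b \<subseteq> N y"
      using N_append_mono [OF l(1) va, of y] N_append_mono [OF l(1) vb, of y] z Nz \<open>N v \<subseteq> N z\<close> by auto
    then have "N (jn a b) \<subseteq> N y" using jn [OF l(2,3)] yl by (auto simp: is_join_def)
    moreover have "N v \<subseteq> N (v @ jn a b)" using N_append_down [OF l(1), of y "jn a b"] calculation Nz \<open>N v \<subseteq> N z\<close> by blast
    ultimately show ?thesis using N_append_mono [OF l(1), of "jn a b" y] Nz \<open>N v \<subseteq> N z\<close> by auto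
  qed
  obtain w0 where "w0 \<in> lists A" "\<And>u. u \<in> lists A \<Longrightarrow> N u \<subseteq> N w0" using ex_top by blast
  then show vj: "N v \<subseteq> N (v @ jn a b)" using ub l by (meson append_in_lists_conv)
  have "N a \<subseteq> N (jn a b)" "N b \<subseteq> N (jn a b)" using jn [OF l(2,3)] by (auto simp: is_join_def)
  then show "is_join (v @ a) (v @ b) (v @ jn a b)"
    using N_append_mono [OF l(1) va vj] N_append_mono [OF l(1) vb vj] ub l jn_lists [OF l(2,3)]
    by (auto simp: is_join_def)
qed

text \<open>The computation behind both laws for complements of products: joining \<open>v w\<close>
  with \<open>u\<close> is the same as joining it with \<open>v (res v u)\<close>, the join of
  \<open>v\<close> and \<open>u\<close>, and then \<open>v\<close> can be factored out.\<close>

lemma res_append_aux: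
  assumes l: "v \<in> lists A" "w \<in> lists A" "u \<in> lists A" and vw: "N v \<subseteq> N (v @ w)"
  shows "N (jn (v @ w) u) = N (v @ jn w (res v u))" "is_join u (v @ w) (jn (v @ w) u)"
    "N v \<subseteq> N (v @ jn w (res v u))"
proof -
  note r = res [OF l(1,3)] and rl = res_lists [OF l(1,3)]
  note t = is_join_translate [OF l(1,2) rl vw r(3)]
  show "N v \<subseteq> N (v @ jn w (res v u))" by (rule t(2))
  have "N (v @ w) \<subseteq> N z \<and> N u \<subseteq> N z \<longleftrightarrow> N (v @ w) \<subseteq> N z \<and> N (v @ res v u) \<subseteq> N z"
    if "z \<in> lists A" for z
    unfolding r(4) using jn [OF l(1,3)] vw that unfolding is_join_def by blast
  then have "is_join (v @ w) u z \<longleftrightarrow> is_join (v @ w) (v @ res v u) z" for z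
    unfolding is_join_def conj_assoc [symmetric] by (metis (no_types, lifting) conj_assoc)
  then have "is_join (v @ w) u (v @ jn w (res v u))" using t(1) by blast
  then show "N (jn (v @ w) u) = N (v @ jn w (res v u))" using l by (intro N_jn_eqI) auto
  show "is_join u (v @ w) (jn (v @ w) u)" using jn [of "v @ w" u] l unfolding is_join_def by auto
qed

lemma res_append_left:
  assumes l: "v \<in> lists A" "w \<in> lists A" "u \<in> lists A" and vw: "N v \<subseteq> N (v @ w)"
  shows "wd (res (v @ w) u) = wd (res w (res v u))"
proof -
  note a = res_append_aux [OF assms] and rl = res_lists [OF l(1,3)]
  have "wd (jn (v @ w) u) = wd (v @ jn w (res v u))"
    using a(1) N_eq_iff l rl jn_lists by simp
  then have "wd (v @ w) \<circ> wd (res (v @ w) u) = wd v \<circ> wd (w @ res w (res v u))"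
    using res(2) [of "v @ w" u] res(2) [OF l(2) rl] l by (simp add: comp_assoc)
  then have "wd (v @ w) \<circ> wd (res (v @ w) u) = wd (v @ w) \<circ> wd (res w (res v u))"
    by (simp add: comp_assoc)
  moreover have "v @ w \<in> lists A" using l by simp
  ultimately show ?thesis by (simp only: wd_cancel_left [of "v @ w"])
qed

text \<open>Equality in \<open>W\<close> is not enough for the Artin monoid; the concatenation has
  to be reduced for \<open>matsumoto\<close> to apply. This follows by comparing lengths along the
  two ways of reaching the join.\<close>

lemma res_append_right:
  assumes l: "v \<in> lists A" "w \<in> lists A" "u \<in> lists A" and vw: "N v \<subseteq> N (v @ w)"
  shows "wd (res u (v @ w)) = wd (res u v @ res (res v u) w)" "reduced (res u v @ res (res v u) w)"
proof -
  note a = res_append_aux [OF assms] and rl = res_lists [OF l(1,3)] and rl' = res_lists [OF l(3,1)]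
  have vwl: "v @ w \<in> lists A" using l by simp
  have j: "N (jn u (v @ w)) = N (v @ jn w (res v u))"
    using N_jn_eqI [OF l(3) vwl a(2)] a(1) by simp
  have "is_join w (res v u) = is_join (res v u) w" by (auto simp: is_join_def fun_eq_iff)
  then have jc: "jn w (res v u) = jn (res v u) w" by (simp add: jn_def)
  have "is_join v u = is_join u v" by (auto simp: is_join_def fun_eq_iff)
  then have jc': "jn v u = jn u v" by (simp add: jn_def)
  let ?y = "res (res v u) w"
  have yl: "?y \<in> lists A" using res_lists [OF rl l(2)] .
  have wj: "wd (jn u (v @ w)) = wd (v @ jn (res v u) w)"
    using j N_eq_iff l rl jn_lists by (simp add: jc)
  have "wd u \<circ> wd (res u (v @ w)) = wd (jn u (v @ w))" using res(2) [OF l(3) vwl] by simp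
  also have "\<dots> = wd v \<circ> wd (res v u @ ?y)" unfolding wj using res(2) [OF rl l(2)] by simp
  also have "\<dots> = wd (v @ res v u) \<circ> wd ?y" by (simp add: comp_assoc)
  also have "\<dots> = wd (u @ res u v) \<circ> wd ?y" using res(2) [OF l(1,3)] res(2) [OF l(3,1)] jc' by simp
  also have "\<dots> = wd u \<circ> wd (res u v @ ?y)" by (simp add: comp_assoc)
  finally show eq: "wd (res u (v @ w)) = wd (res u v @ ?y)" using wd_cancel_left [OF l(3)] by blast
  have card_res: "card (N (jn x z)) = card (N x) + length (res x z)" if "x \<in> lists A" "z \<in> lists A" for x z
    using res [OF that] le_append_iff [of x "res x z"] that res_lists [OF that] by (simp add: reduced_def)
  have "card (N u) + length (res u (v @ w)) = card (N (v @ jn (res v u) w))"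
    using card_res [OF l(3) vwl] j jc by simp
  also have "\<dots> = card (N v) + card (N (jn (res v u) w))"
    using le_append_iff [of v "jn (res v u) w"] a(3) jc l rl jn_lists by simp
  also have "\<dots> = card (N v) + (card (N (res v u)) + length ?y)" using card_res [OF rl l(2)] by simp
  also have "\<dots> = card (N (jn v u)) + length ?y"
    using card_res [OF l(1,3)] res(1) [OF l(1,3)] by (simp add: reduced_def)
  also have "\<dots> = card (N u) + length (res u v) + length ?y" using card_res [OF l(3,1)] jc' by simp
  finally have "length (res u (v @ w)) = length (res u v @ ?y)" by simp
  moreover have "N (res u (v @ w)) = N (res u v @ ?y)"
    using eq res_lists [OF l(3) vwl] rl' yl by (intro N_cong) auto
  ultimately show "reduced (res u v @ ?y)"
    using res(1) [OF l(3) vwl] rl' yl by (simp add: reduced_def)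
qed

interpretation artin: homogeneous_presentation A "artin_rels A m"
  by unfold_locales (auto simp: artin_rels_def)

abbreviation artin_eqv :: "'a list \<Rightarrow> 'a list \<Rightarrow> bool" (infix "\<simeq>" 50) where
  "u \<simeq> v \<equiv> (u, v) \<in> pres_cong A (artin_rels A m)"

lemma wd_cancelD: "wd u \<circ> f = wd u \<circ> g \<Longrightarrow> u \<in> lists A \<Longrightarrow> f = g"
  by (simp only: wd_cancel_left)

lemma braid: "s \<in> A \<Longrightarrow> t \<in> A \<Longrightarrow> alternating s t (m s t) \<simeq> alternating t s (m s t)"
proof -
  assume st: "s \<in> A" "t \<in> A"
  show ?thesis
  proof (cases "s = t")
    case True
    then show ?thesis using st by (simp add: alternating_lists)
  next
    case False
    then show ?thesis using st m_pos [OF st] by (intro artin.eqv_rel) (auto simp: artin_rels_def alternating_lists)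
  qed
qed

lemma artin_wd: "u \<simeq> v \<Longrightarrow> wd u = wd v"
proof (induction rule: pres_cong.induct)
  case (rel u v p q)
  then have "wd u = wd v" using wd_alternating by (auto simp: artin_rels_def)
  then show ?case by simp
qed auto

subsection \<open>Matsumoto's theorem\<close>

lemma reduced_tl:
  assumes "reduced (s # u)"
  shows "s \<in> A" "reduced u" "sg s \<in> N (s # u)"
proof -
  show s: "s \<in> A" using assms by (auto simp: reduced_def)
  show "reduced u" "sg s \<in> N (s # u)"
    using reduced_append [of "[s]" u] assms s by (auto simp: N_single)
qed

text \<open>If the first letters \<open>s\<close> and \<open>t\<close> differ, both are inversions
  of the element, so by \<open>dihedral_le\<close> it also has reduced words beginning with either
  alternating word. These two words differ by one braid relation, and each shares its first letter
  with \<open>u\<close> or \<open>v\<close>, so the induction hypothesis connects them.\<close>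

theorem matsumoto:
  assumes "reduced u" "reduced v" "wd u = wd v"
  shows "u \<simeq> v"
  using assms
proof (induction "length u" arbitrary: u v rule: less_induct)
  case less
  have ul: "u \<in> lists A" and vl: "v \<in> lists A" using less.prems by auto
  have Nuv: "N u = N v" using N_cong ul vl less.prems by blast
  then have len: "length u = length v" using less.prems by (simp add: reduced_def)
  show ?case
  proof (cases u)
    case Nil
    then show ?thesis using len by simp
  next
    case (Cons s u')
    then obtain t v' where v: "v = t # v'" using len by (cases v) auto
    note u = Cons
    have s: "s \<in> A" "reduced u'" "sg s \<in> N u" and t: "t \<in> A" "reduced v'" "sg t \<in> N v"
      using reduced_tl less.prems u v by auto
    have ul': "u' \<in> lists A" and vl': "v' \<in> lists A" using ul vl u v by auto
    have IH: "x \<simeq> y" if "length x < length u" "reduced x" "reduced y" "wd x = wd y" for x y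
      using less.hyps that by blast
    show ?thesis
    proof (cases "s = t")
      case True
      have "wd [s] \<circ> wd u' = wd [s] \<circ> wd v'" using less.prems(3) u v True by simp
      then have "wd u' = wd v'" by (rule wd_cancelD) (simp add: s)
      then have "u' \<simeq> v'" using IH s t u by simp
      then show ?thesis using u v True artin.eqv_Cons s by simp
    next
      case False
      let ?a = "alternating s t (m s t)" and ?b = "alternating t s (m s t)"
      have al: "?a \<in> lists A" "?b \<in> lists A" using s t by (simp_all add: alternating_lists)
      have "N ?a \<subseteq> N u" using dihedral_le [OF s(1) t(1) False ul] s(3) t(3) Nuv by simp
      then obtain z where z: "reduced z" "wd (?a @ z) = wd u" "card (N u) = card (N ?a) + length z"
        using factor [OF al(1) ul] by blast
      have zl: "z \<in> lists A" using z by auto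
      have ra: "reduced ?a" and rb: "reduced ?b"
        using reduced_alternating [OF s(1) t(1) False] reduced_alternating [OF t(1) s(1)] False m_sym [OF s(1) t(1)] by auto
      have wab: "wd ?a = wd ?b" using wd_alternating s t m_pos by simp
      have "N (?a @ z) = N u" using z zl al ul by (intro N_cong) auto
      then have raz: "reduced (?a @ z)" using z(3) ra al zl by (simp add: reduced_def)
      have "N (?b @ z) = N u" using z zl al ul wab by (intro N_cong) auto
      then have rbz: "reduced (?b @ z)" using z(3) ra al zl by (simp add: reduced_def)
      obtain k where k: "m s t = Suc k" using m_pos [OF s(1) t(1)] gr0_conv_Suc by blast
      have a: "?a @ z = s # (alternating t s k @ z)" and b: "?b @ z = t # (alternating s t k @ z)"
        using k by simp_all
      have ra': "reduced (alternating t s k @ z)" and rb': "reduced (alternating s t k @ z)"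
        using reduced_tl(2) [of s "alternating t s k @ z"] reduced_tl(2) [of t "alternating s t k @ z"]
          raz rbz unfolding a b by blast+
      have "wd [s] \<circ> wd u' = wd [s] \<circ> wd (alternating t s k @ z)"
        using z(2) u unfolding a by simp
      then have "wd u' = wd (alternating t s k @ z)" by (rule wd_cancelD) (simp add: s)
      then have "u' \<simeq> alternating t s k @ z" using IH s ra' u by simp
      then have 1: "u \<simeq> ?a @ z" unfolding a u using artin.eqv_Cons s by simp
      have "wd (?b @ z) = wd v" using z(2) wab less.prems(3) by simp
      then have "wd [t] \<circ> wd v' = wd [t] \<circ> wd (alternating s t k @ z)"
        using v unfolding b by simp
      then have "wd v' = wd (alternating s t k @ z)" by (rule wd_cancelD) (simp add: t)
      then have "v' \<simeq> alternating s t k @ z" using IH [of v'] t rb' v len by simp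
      then have 2: "v \<simeq> ?b @ z" unfolding b v using artin.eqv_Cons t by simp
      have "?a @ z \<simeq> ?b @ z" using braid [OF s(1) t(1)] zl by (rule artin.eqv_append_right)
      then show ?thesis using 1 2 artin.eqv_trans artin.eqv_sym by meson
    qed
  qed
qed

subsection \<open>The complement action\<close>

text \<open>\<open>act u b\<close> and \<open>coc u b\<close> are the complements of the simple element \<open>u\<close> and of the word \<open>b\<close> in
  their least common multiple. Being well defined on the monoid, they yield cancellativity
  (\<open>coc u (u b) = b\<close>) and common multiples.\<close>

primrec act :: "'a list \<Rightarrow> 'a list \<Rightarrow> 'a list" where
  "act u [] = u"
| "act u (s # b) = act (res [s] u) b"

primrec coc :: "'a list \<Rightarrow> 'a list \<Rightarrow> 'a list" where
  "coc u [] = []"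
| "coc u (s # b) = res u [s] @ coc (res [s] u) b"

lemma act_lists: "u \<in> lists A \<Longrightarrow> b \<in> lists A \<Longrightarrow> act u b \<in> lists A"
proof (induction b arbitrary: u rule: list.induct)
  case (Cons s b)
  then show ?case using res_lists [of "[s]" u] by simp
qed simp

lemma coc_lists: "u \<in> lists A \<Longrightarrow> b \<in> lists A \<Longrightarrow> coc u b \<in> lists A"
proof (induction b arbitrary: u rule: list.induct)
  case (Cons s b)
  then show ?case using res_lists [of "[s]" u] res_lists [of u "[s]"] by simp
qed simp

lemma act_append: "act u (p @ q) = act (act u p) q"
  by (induction p arbitrary: u) simp_all

lemma coc_append: "coc u (p @ q) = coc u p @ coc (act u p) q"
  by (induction p arbitrary: u) simp_all

lemma act_reduced: "reduced u \<Longrightarrow> b \<in> lists A \<Longrightarrow> reduced (act u b)"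
proof (induction b arbitrary: u rule: list.induct)
  case (Cons s b)
  then have "reduced (res [s] u)" using res(1) [of "[s]" u] by auto
  then show ?case using Cons by simp
qed simp

lemma act_coc_cong:
  assumes "u \<in> lists A" "u' \<in> lists A" "b \<in> lists A" "wd u = wd u'"
  shows "wd (act u b) = wd (act u' b)" "coc u b = coc u' b"
proof (atomize (full), cases b)
  case (Cons s b')
  then have "res [s] u = res [s] u'" "res u [s] = res u' [s]"
    using assms by (auto intro!: res_cong)
  then show "wd (act u b) = wd (act u' b) \<and> coc u b = coc u' b" using Cons by simp
qed (use assms in simp)

lemma res_id:
  assumes "u \<in> lists A" "v \<in> lists A" "N v \<subseteq> N u"
  shows "res u v = []"
proof -
  note r = res [OF assms(1,2)]
  have "is_join u v u" using assms by (auto simp: is_join_def)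
  then have "N (u @ res u v) = N u" using N_jn_eqI [OF assms(1,2)] r(4) by simp
  then have "card (N (res u v)) = 0"
    using le_append_iff [of u "res u v"] r(3) assms res_lists [OF assms(1,2)] by simp
  then show ?thesis using r(1) by (simp add: reduced_def)
qed

lemma res_Nil:
  assumes "u \<in> lists A"
  shows "wd (res [] u) = wd u" "res u [] = []"
proof -
  have "is_join [] u u" using assms by (simp add: is_join_def)
  then have "N (jn [] u) = N u" using N_jn_eqI assms by simp
  then have "wd (jn [] u) = wd u" using N_eq_iff jn_lists assms by simp
  then show "wd (res [] u) = wd u" using res(2) [of "[]" u] assms by simp
  show "res u [] = []" using assms by (intro res_id) auto
qed

text \<open>On a reduced word the letterwise complements agree with those in \<open>W\<close>, so up
  to equivalence they depend only on the element of \<open>W\<close>. This is what is applied to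
  both sides of a braid relation.\<close>

lemma act_coc_reduced:
  assumes "reduced b" "u \<in> lists A"
  shows "wd (act u b) = wd (res b u) \<and> coc u b \<simeq> res u b"
  using assms
proof (induction b arbitrary: u rule: list.induct)
  case Nil
  then show ?case using res_Nil by simp
next
  case (Cons s b)
  have s: "s \<in> A" and b: "reduced b" "b \<in> lists A" using reduced_tl [OF Cons.prems(1)] by auto
  have sb: "N [s] \<subseteq> N ([s] @ b)" using reduced_append(3) [of "[s]" b] Cons.prems(1) by simp
  have sl: "[s] \<in> lists A" using s by simp
  let ?u = "res [s] u"
  have ul: "?u \<in> lists A" using res_lists [OF sl Cons.prems(2)] .
  have IH: "wd (act ?u b) = wd (res b ?u)" "coc ?u b \<simeq> res ?u b" using Cons.IH [OF b(1) ul] by auto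
  have 1: "wd (act u (s # b)) = wd (res (s # b) u)"
    using IH(1) res_append_left [OF sl b(2) Cons.prems(2) sb] by simp
  note r = res_append_right [OF sl b(2) Cons.prems(2) sb]
  have us: "res u [s] \<in> lists A" using res_lists [OF Cons.prems(2) sl] .
  have "coc u (s # b) \<simeq> res u [s] @ res ?u b" using artin.eqv_append_left [OF IH(2) us] by simp
  moreover have "res u [s] @ res ?u b \<simeq> res u (s # b)"
    using matsumoto [OF r(2) res(1) [OF Cons.prems(2), of "s # b"]] r(1) s b by simp
  ultimately show ?case using 1 artin.eqv_trans by blast
qed

lemma act_coc_eqv:
  assumes "b \<simeq> b'" "u \<in> lists A"
  shows "wd (act u b) = wd (act u b') \<and> coc u b \<simeq> coc u b'"
  using assms
proof (induction arbitrary: u rule: pres_cong.induct)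
  case (refl b)
  then show ?case using coc_lists by simp
next
  case (rel b b' p q)
  obtain s t where st: "b = alternating s t (m s t)" "b' = alternating t s (m s t)" "s \<in> A" "t \<in> A" "s \<noteq> t"
    using rel(1) by (auto simp: artin_rels_def)
  let ?u = "act u p"
  have ul: "?u \<in> lists A" using act_lists rel by blast
  have red: "reduced b" "reduced b'"
    using st reduced_alternating [of s t] reduced_alternating [of t s] m_sym [of s t] by auto
  have "wd b = wd b'" using artin_wd [of b b'] braid st by simp
  then have "res b ?u = res b' ?u" "res ?u b = res ?u b'" using rel ul by (auto intro!: res_cong)
  then have 1: "wd (act ?u b) = wd (act ?u b')" "coc ?u b \<simeq> coc ?u b'"
    using act_coc_reduced [OF red(1) ul] act_coc_reduced [OF red(2) ul]
    by (auto intro: artin.eqv_trans artin.eqv_sym)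
  have l: "act ?u b \<in> lists A" "act ?u b' \<in> lists A" using act_lists ul rel by auto
  \<comment> \<open>The suffix \<open>q\<close> starts from two words for the same element of
    \<open>W\<close>; as \<open>res\<close> picks fixed words, its complements are even equal as
    words.\<close>
  note c = act_coc_cong [OF l \<open>q \<in> lists A\<close> 1(1)]
  have "coc ?u b @ coc (act ?u b) q \<simeq> coc ?u b' @ coc (act ?u b') q"
    unfolding c(2) using 1(2) coc_lists [OF l(2) \<open>q \<in> lists A\<close>] by (rule artin.eqv_append_right)
  then have "coc u p @ coc ?u b @ coc (act ?u b) q \<simeq> coc u p @ coc ?u b' @ coc (act ?u b') q"
    using coc_lists rel by (intro artin.eqv_append_left) auto
  then show ?case using c(1) by (simp add: act_append coc_append)
next
  case (sym b b')
  then show ?case by (auto intro: artin.eqv_sym)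
next
  case (trans b b' b'')
  then show ?case by (auto intro: artin.eqv_trans)
qed

text \<open>The squares \<open>u (res u [s]) = s (res [s] u)\<close> for single letters are pasted
  along \<open>b\<close>. Each lifts from \<open>W\<close> to the Artin monoid by
  \<open>matsumoto\<close>, because both sides are reduced.\<close>

lemma act_coc_lcm:
  assumes "reduced u" "b \<in> lists A"
  shows "u @ coc u b \<simeq> b @ act u b"
  using assms
proof (induction b arbitrary: u rule: list.induct)
  case Nil
  then show ?case by auto
next
  case (Cons s b)
  have s: "[s] \<in> lists A" and b: "b \<in> lists A" and u: "u \<in> lists A" using Cons.prems by auto
  let ?u = "res [s] u" and ?v = "res u [s]"
  note r = res [OF s u] and r' = res [OF u s]
  have rs: "reduced [s]" using s by (simp add: reduced_def N_single)
  have "is_join u [s] = is_join [s] u" by (auto simp: is_join_def fun_eq_iff)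
  then have "jn u [s] = jn [s] u" by (simp add: jn_def)
  then have "wd (u @ ?v) = wd ([s] @ ?u)" using r(2) r'(2) by simp
  moreover have "reduced (u @ ?v)" "reduced ([s] @ ?u)"
    using reduced_appendI [OF Cons.prems(1) r'(1,3)] reduced_appendI [OF rs r(1,3)] by auto
  ultimately have "u @ ?v \<simeq> [s] @ ?u" using matsumoto by blast
  then have "(u @ ?v) @ coc ?u b \<simeq> ([s] @ ?u) @ coc ?u b"
    using coc_lists res_lists s u b by (intro artin.eqv_append_right) auto
  moreover have "[s] @ (?u @ coc ?u b) \<simeq> [s] @ (b @ act ?u b)"
    using Cons.IH [OF r(1) b] s by (rule artin.eqv_append_left)
  ultimately have "(u @ ?v) @ coc ?u b \<simeq> [s] @ (b @ act ?u b)"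
    using artin.eqv_trans by fastforce
  then show ?case by simp
qed

section \<open>Cancellation, common multiples and common divisors in the Artin monoid\<close>

lemma reduced_letter: "s \<in> A \<Longrightarrow> reduced [s]"
  by (simp add: reduced_def N_single)

lemma act_Nil: "b \<in> lists A \<Longrightarrow> act [] b = []"
  by (induction b) (simp_all add: res_Nil)

lemma coc_Nil: "b \<in> lists A \<Longrightarrow> coc [] b \<simeq> b"
  using act_coc_lcm [of "[]" b] by (simp add: act_Nil reduced_def)

lemma coc_self:
  assumes "s \<in> A" "b \<in> lists A"
  shows "coc [s] (s # b) \<simeq> b" "act [s] (s # b) = []"
proof -
  have "res [s] [s] = []" using assms by (intro res_id) auto
  then show "coc [s] (s # b) \<simeq> b" "act [s] (s # b) = []" using coc_Nil act_Nil assms by simp_all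
qed

lemma artin_cancel_left: "p @ b \<simeq> p @ b' \<Longrightarrow> b \<simeq> b'"
proof (induction p)
  case (Cons s p)
  have l: "s \<in> A" "p @ b \<in> lists A" "p @ b' \<in> lists A"
    using artin.eqv_lists [OF Cons.prems] by auto
  have "coc [s] (s # p @ b) \<simeq> coc [s] (s # p @ b')"
    using act_coc_eqv [OF Cons.prems, of "[s]"] l by simp
  then have "p @ b \<simeq> p @ b'"
    using coc_self [OF l(1,2)] coc_self [OF l(1,3)] artin.eqv_trans artin.eqv_sym by meson
  then show ?case by (rule Cons.IH)
qed simp

text \<open>Let \<open>y = s z = b d\<close>. The action of \<open>y\<close> on \<open>s\<close> is
  trivial, as \<open>s\<close> divides \<open>y\<close>; since it passes through \<open>b\<close>
  and then \<open>d\<close>, the element \<open>act [s] b\<close> is exhausted by \<open>d\<close>,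
  hence divides \<open>d\<close>. So \<open>b (act [s] b)\<close>, which equals
  \<open>s (coc [s] b)\<close>, divides \<open>y\<close>.\<close>

lemma letter_lcm_least:
  assumes s: "s \<in> A" and b: "b \<in> lists A" and y: "artin.ldvd [s] y" "artin.ldvd b y"
  shows "artin.ldvd (s # coc [s] b) y"
proof -
  obtain z where z: "z \<in> lists A" "y \<simeq> [s] @ z" using y by (auto simp: artin.ldvd_def)
  obtain d where d: "d \<in> lists A" "y \<simeq> b @ d" using y by (auto simp: artin.ldvd_def)
  have sl: "[s] \<in> lists A" and sr: "reduced [s]" using s reduced_letter by auto
  let ?u = "act [s] b"
  have ur: "reduced ?u" using act_reduced [OF sr b] .
  have ud: "reduced (act ?u d)" using act_reduced [OF ur d(1)] .
  have "[s] @ z \<simeq> b @ d" using z(2) d(2) artin.eqv_trans artin.eqv_sym by meson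
  then have "wd (act [s] (b @ d)) = wd []"
    using act_coc_eqv [of "[s] @ z" "b @ d" "[s]"] coc_self(2) [OF s z(1)] sl by simp
  then have "N (act ?u d) = {}" using N_cong [of "act ?u d" "[]"] ud by (auto simp: act_append)
  then have "act ?u d = []" using ud by (simp add: reduced_def)
  then have "?u @ coc ?u d \<simeq> d" using act_coc_lcm [OF ur d(1)] by simp
  then have "b @ ?u @ coc ?u d \<simeq> b @ d" using b by (rule artin.eqv_append_left)
  moreover have "(s # coc [s] b) @ coc ?u d \<simeq> (b @ ?u) @ coc ?u d"
    using artin.eqv_append_right [OF act_coc_lcm [OF sr b] coc_lists [OF reduced_lists [OF ur] d(1)]] by simp
  ultimately have "(s # coc [s] b) @ coc ?u d \<simeq> y"
    using d(2) artin.eqv_trans artin.eqv_sym by (metis append_assoc)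
  then show ?thesis
    unfolding artin.ldvd_def using coc_lists [OF reduced_lists [OF ur] d(1)] artin.eqv_sym by blast
qed

lemma ldvd_Cons: "s \<in> A \<Longrightarrow> artin.ldvd u v \<Longrightarrow> artin.ldvd (s # u) (s # v)"
  unfolding artin.ldvd_def using artin.eqv_Cons by fastforce

lemma ldvd_trans: "artin.ldvd u v \<Longrightarrow> artin.ldvd v w \<Longrightarrow> u \<in> lists A \<Longrightarrow> artin.ldvd u w"
proof -
  assume "artin.ldvd u v" "artin.ldvd v w"
  then obtain x y where "x \<in> lists A" "v \<simeq> u @ x" "y \<in> lists A" "w \<simeq> v @ y"
    by (auto simp: artin.ldvd_def)
  then have "w \<simeq> u @ (x @ y)" "x @ y \<in> lists A"
    using artin.eqv_append_right [of v "u @ x" y] artin.eqv_trans by fastforce+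
  then show "artin.ldvd u w" unfolding artin.ldvd_def by blast
qed

lemma ldvd_eqv: "v \<simeq> v' \<Longrightarrow> artin.ldvd u v \<longleftrightarrow> artin.ldvd u v'"
  unfolding artin.ldvd_def using artin.eqv_trans artin.eqv_sym by meson

lemma ldvd_Cons_cancel:
  assumes "artin.ldvd (s # u) (s # v)"
  shows "artin.ldvd u v"
proof -
  obtain x where x: "x \<in> lists A" "s # v \<simeq> (s # u) @ x" using assms by (auto simp: artin.ldvd_def)
  then have "v \<simeq> u @ x" using artin_cancel_left [of "[s]" v "u @ x"] by simp
  then show ?thesis using x by (auto simp: artin.ldvd_def)
qed

text \<open>Recursion on the first argument: with \<open>c = coc [s] b\<close>, the least common
  multiple of \<open>s a\<close> and \<open>b\<close> is \<open>s\<close> times that of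
  \<open>a\<close> and \<open>c\<close>, as every common multiple is divisible by
  \<open>s c\<close>.\<close>

lemma ex_lcm: "a \<in> lists A \<Longrightarrow> b \<in> lists A \<Longrightarrow> \<exists>z\<in>lists A. artin.is_lcm artin.ldvd z a b"
proof (induction a arbitrary: b rule: list.induct)
  case Nil
  then have "artin.ldvd [] b" "artin.ldvd b b"
    unfolding artin.ldvd_def by (auto intro: bexI [of _ b] bexI [of _ "[]"])
  then show ?case using Nil by (intro bexI [of _ b]) (auto simp: artin.is_lcm_def)
next
  case (Cons s a)
  then have s: "s \<in> A" and a: "a \<in> lists A" and sl: "[s] \<in> lists A" by auto
  have c: "coc [s] b \<in> lists A" using coc_lists [OF sl Cons.prems(2)] .
  obtain z where z: "z \<in> lists A" "artin.is_lcm artin.ldvd z a (coc [s] b)"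
    using Cons.IH [OF a c] by blast
  have "artin.is_lcm artin.ldvd (s # z) (s # a) b"
    unfolding artin.is_lcm_def
  proof (intro conjI ballI impI)
    show "artin.ldvd (s # a) (s # z)" using z s by (intro ldvd_Cons) (auto simp: artin.is_lcm_def)
    have "s # coc [s] b \<simeq> b @ act [s] b" using act_coc_lcm [OF reduced_letter [OF s] Cons.prems(2)] by simp
    then have "artin.ldvd b (s # coc [s] b)"
      unfolding artin.ldvd_def using act_lists [OF sl Cons.prems(2)] by blast
    moreover have "artin.ldvd (s # coc [s] b) (s # z)" using z s by (intro ldvd_Cons) (auto simp: artin.is_lcm_def)
    ultimately show "artin.ldvd b (s # z)" using ldvd_trans Cons.prems by blast
  next
    fix y assume y: "y \<in> lists A" and d: "artin.ldvd (s # a) y \<and> artin.ldvd b y"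
    then obtain x where x: "x \<in> lists A" "y \<simeq> s # (a @ x)" by (auto simp: artin.ldvd_def)
    let ?y = "a @ x"
    have yl: "?y \<in> lists A" using a x by simp
    have "artin.ldvd [s] y" unfolding artin.ldvd_def using x yl by (intro bexI [of _ ?y]) auto
    then have "artin.ldvd (s # coc [s] b) y" using letter_lcm_least s Cons.prems d by blast
    then have "artin.ldvd (coc [s] b) ?y" using ldvd_eqv [OF x(2)] ldvd_Cons_cancel by blast
    moreover have "artin.ldvd a ?y" unfolding artin.ldvd_def using x yl by (intro bexI [of _ x]) auto
    ultimately have "artin.ldvd z ?y" using z yl by (auto simp: artin.is_lcm_def)
    then show "artin.ldvd (s # z) y" using ldvd_Cons [OF s] ldvd_eqv [OF x(2)] by blast
  qed
  then show ?case using s z by (intro bexI [of _ "s # z"]) auto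
qed

text \<open>Common divisors have bounded length; one of greatest length absorbs every other, since
  the least common multiple of two common divisors is a common divisor.\<close>

lemma ex_gcd:
  assumes "a \<in> lists A" "b \<in> lists A"
  shows "\<exists>z\<in>lists A. artin.is_gcd artin.ldvd z a b"
proof -
  define Q where "Q d \<longleftrightarrow> d \<in> lists A \<and> artin.ldvd d a \<and> artin.ldvd d b" for d
  have "Q []" using assms by (auto simp: Q_def artin.ldvd_def intro: bexI [of _ a] bexI [of _ b])
  moreover have "\<forall>d. Q d \<longrightarrow> length d < Suc (length a)"
    using artin.eqv_length by (fastforce simp: Q_def artin.ldvd_def)
  ultimately obtain d where d: "Q d" and max: "\<And>d'. Q d' \<Longrightarrow> length d' \<le> length d"
    using ex_has_greatest_nat [of Q "[]" length "Suc (length a)"] by metis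
  have "artin.is_gcd artin.ldvd d a b"
    unfolding artin.is_gcd_def
  proof (intro conjI ballI impI)
    show "artin.ldvd d a" "artin.ldvd d b" using d by (auto simp: Q_def)
    fix e assume e: "e \<in> lists A" "artin.ldvd e a \<and> artin.ldvd e b"
    obtain l where l: "l \<in> lists A" "artin.is_lcm artin.ldvd l d e"
      using ex_lcm [of d e] d e by (auto simp: Q_def)
    then have "Q l" using assms d e by (auto simp: Q_def artin.is_lcm_def)
    then have len: "length l \<le> length d" by (rule max)
    obtain x where x: "x \<in> lists A" "l \<simeq> d @ x" using l by (auto simp: artin.is_lcm_def artin.ldvd_def)
    then have "x = []" using artin.eqv_length [OF x(2)] len by simp
    then have "l \<simeq> d" using x by simp
    then show "artin.ldvd e d" using ldvd_eqv l by (auto simp: artin.is_lcm_def)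
  qed
  then show ?thesis using d by (auto simp: Q_def)
qed

subsection \<open>Reversal\<close>

text \<open>The reverse of a braid relation is a braid relation, so reversal is an anti-automorphism
  of the Artin monoid. It carries statements on left divisors over to right divisors.\<close>

lemma rev_eqv: "u \<simeq> v \<Longrightarrow> rev u \<simeq> rev v"
proof (induction rule: pres_cong.induct)
  case (rel u v p q)
  obtain s t where st: "u = alternating s t (m s t)" "v = alternating t s (m s t)" "s \<in> A" "t \<in> A"
    using rel(1) by (auto simp: artin_rels_def)
  have "rev u \<simeq> rev v"
    using st braid [of s t] braid [of t s] m_sym [of s t] by (auto simp: rev_alternating)
  then have "rev q @ rev u @ rev p \<simeq> rev q @ rev v @ rev p"
    using rel by (intro artin.eqv_append_left artin.eqv_append_right) auto
  then show ?case by simp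
qed (auto intro: artin.eqv_sym artin.eqv_trans)

lemma rdvd_iff: "artin.rdvd u v \<longleftrightarrow> artin.ldvd (rev u) (rev v)"
proof
  assume "artin.rdvd u v"
  then obtain z where "z \<in> lists A" "v \<simeq> z @ u" by (auto simp: artin.rdvd_def)
  then show "artin.ldvd (rev u) (rev v)"
    unfolding artin.ldvd_def using rev_eqv [of v "z @ u"] by (intro bexI [of _ "rev z"]) auto
next
  assume "artin.ldvd (rev u) (rev v)"
  then obtain z where "z \<in> lists A" "rev v \<simeq> rev u @ z" by (auto simp: artin.ldvd_def)
  then show "artin.rdvd u v"
    unfolding artin.rdvd_def using rev_eqv [of "rev v" "rev u @ z"] by (intro bexI [of _ "rev z"]) auto
qed

lemma artin_cancel_right: "b @ p \<simeq> b' @ p \<Longrightarrow> b \<simeq> b'"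
  using rev_eqv [of "b @ p" "b' @ p"] artin_cancel_left [of "rev p" "rev b" "rev b'"] rev_eqv [of "rev b" "rev b'"]
  by simp

lemma ball_lists_rev: "(\<forall>u\<in>lists A. Q (rev u)) \<longleftrightarrow> (\<forall>u\<in>lists A. Q u)"
  by (metis rev_in_lists rev_rev_ident)

lemma is_lcm_rev: "artin.is_lcm artin.rdvd (rev z) (rev a) (rev b) \<longleftrightarrow> artin.is_lcm artin.ldvd z a b"
  unfolding artin.is_lcm_def rdvd_iff rev_rev_ident
  using ball_lists_rev [of "\<lambda>u. artin.ldvd a u \<and> artin.ldvd b u \<longrightarrow> artin.ldvd z u"] by simp

lemma is_gcd_rev: "artin.is_gcd artin.rdvd (rev z) (rev a) (rev b) \<longleftrightarrow> artin.is_gcd artin.ldvd z a b"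
  unfolding artin.is_gcd_def rdvd_iff rev_rev_ident
  using ball_lists_rev [of "\<lambda>u. artin.ldvd u a \<and> artin.ldvd u b \<longrightarrow> artin.ldvd u z"] by simp

lemma artin_lcms_gcds: "has_lcms_gcds artin.M" "has_lcms_gcds (opp_monoid artin.M)"
proof -
  show "has_lcms_gcds artin.M" unfolding artin.has_lcms_gcds_M using ex_lcm ex_gcd by blast
  have "\<exists>z\<in>lists A. artin.is_lcm artin.rdvd z a b" "\<exists>z\<in>lists A. artin.is_gcd artin.rdvd z a b"
    if ab: "a \<in> lists A" "b \<in> lists A" for a b
  proof -
    obtain z z' where z: "z \<in> lists A" "z' \<in> lists A" "artin.is_lcm artin.ldvd z (rev a) (rev b)"
        "artin.is_gcd artin.ldvd z' (rev a) (rev b)"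
      using ex_lcm [of "rev a" "rev b"] ex_gcd [of "rev a" "rev b"] ab by auto
    then have "artin.is_lcm artin.rdvd (rev z) a b" "artin.is_gcd artin.rdvd (rev z') a b"
      using is_lcm_rev [of z "rev a" "rev b"] is_gcd_rev [of z' "rev a" "rev b"] by simp_all
    then show "\<exists>z\<in>lists A. artin.is_lcm artin.rdvd z a b" "\<exists>z\<in>lists A. artin.is_gcd artin.rdvd z a b"
      using z(1,2) by (metis rev_in_lists)+
  qed
  then show "has_lcms_gcds (opp_monoid artin.M)" unfolding artin.has_lcms_gcds_opp by blast
qed

subsection \<open>The Garside element\<close>

lemma reduced_cong: "u \<simeq> v \<Longrightarrow> reduced v \<Longrightarrow> reduced u"
  using artin_wd [of u v] artin.eqv_length [of u v] artin.eqv_lists [of u v] N_cong [of u v]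
  by (simp add: reduced_def)

lemma card_N_rev: "u \<in> lists A \<Longrightarrow> card (N (rev u)) = card (N u)"
proof -
  have le: "card (N (rev u)) \<le> card (N u)" if u: "u \<in> lists A" for u
  proof -
    obtain v where v: "reduced v" "wd v = wd u" using ex_reduced [OF u] by blast
    then have vl: "v \<in> lists A" by auto
    have "N (rev u) = N (rev v)" using wd_rev_cong [OF vl u v(2)] u vl by (intro N_cong) auto
    then have "card (N (rev u)) \<le> length v" using card_N_le [of "rev v"] vl by simp
    also have "\<dots> = card (N u)" using v N_cong [OF vl u v(2)] by (simp add: reduced_def)
    finally show ?thesis .
  qed
  assume u: "u \<in> lists A"
  then show ?thesis using le [OF u] le [of "rev u"] by simp
qed

lemma reduced_rev: "reduced u \<Longrightarrow> reduced (rev u)"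
  using card_N_rev [of u] by (auto simp: reduced_def)

text \<open>A reduced word \<open>w\<close> of the top element is divisible by every reduced word,
  by \<open>factor\<close> and \<open>matsumoto\<close>. Its reverse has the same, full inversion
  set, so \<open>rev w\<close> and \<open>w\<close> agree in the Artin monoid, and right divisors
  reduce to left ones.\<close>

lemma ex_longest:
  obtains w where "reduced w" "\<And>u. u \<in> lists A \<Longrightarrow> artin.ldvd u w \<longleftrightarrow> reduced u"
    "\<And>u. u \<in> lists A \<Longrightarrow> artin.rdvd u w \<longleftrightarrow> reduced u"
proof -
  obtain w0 where w0: "w0 \<in> lists A" "\<And>u. u \<in> lists A \<Longrightarrow> N u \<subseteq> N w0" using ex_top by blast
  obtain w where w: "reduced w" "wd w = wd w0" using ex_reduced [OF w0(1)] by blast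
  have wl: "w \<in> lists A" using w by auto
  have top: "N u \<subseteq> N w" if "u \<in> lists A" for u using w0 that N_cong [OF wl w0(1) w(2)] by simp
  have div: "artin.ldvd u w" if u: "reduced u" for u
  proof -
    have ul: "u \<in> lists A" using u by auto
    obtain x where x: "reduced x" "wd (u @ x) = wd w" "card (N w) = card (N u) + length x"
      using factor [OF ul wl top [OF ul]] by blast
    have xl: "x \<in> lists A" using x by auto
    have "N (u @ x) = N w" using x xl ul wl by (intro N_cong) auto
    then have "reduced (u @ x)" using x u ul xl by (simp add: reduced_def)
    then have "w \<simeq> u @ x" using matsumoto w x by simp
    then show ?thesis using xl by (auto simp: artin.ldvd_def)
  qed
  have ld: "artin.ldvd u w \<longleftrightarrow> reduced u" if "u \<in> lists A" for u
  proof
    assume "artin.ldvd u w"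
    then obtain z where "w \<simeq> u @ z" by (auto simp: artin.ldvd_def)
    then have "reduced (u @ z)" using reduced_cong w artin.eqv_sym by blast
    then show "reduced u" by (rule reduced_append)
  qed (rule div)
  have "N (rev w) = N w"
    using top [of "rev w"] card_N_rev [OF wl] wl by (intro card_subset_eq) auto
  then have "wd (rev w) = wd w" using N_eq_iff [of "rev w" w] wl by simp
  then have rw: "rev w \<simeq> w" using matsumoto reduced_rev w by simp
  have "artin.rdvd u w \<longleftrightarrow> reduced u" if u: "u \<in> lists A" for u
  proof -
    have "artin.rdvd u w \<longleftrightarrow> artin.ldvd (rev u) w" using rdvd_iff [of u w] ldvd_eqv [OF rw] by simp
    also have "\<dots> \<longleftrightarrow> reduced (rev u)" using ld [of "rev u"] u by simp
    also have "\<dots> \<longleftrightarrow> reduced u" using reduced_rev [of u] reduced_rev [of "rev u"] by auto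
    finally show ?thesis .
  qed
  then show thesis using that w ld by blast
qed

lemma finite_reduced_classes: "finite {artin.cls u |u. reduced u}"
proof -
  let ?f = "\<lambda>g. artin.cls (SOME u. reduced u \<and> wd u = g)"
  have "{artin.cls u |u. reduced u} \<subseteq> ?f ` wd ` lists A"
  proof clarify
    fix u assume u: "reduced u"
    then have "\<exists>v. reduced v \<and> wd v = wd u" by blast
    from someI_ex [OF this] have v: "reduced (SOME v. reduced v \<and> wd v = wd u)"
      "(SOME v. reduced v \<and> wd v = wd u) \<simeq> u" using matsumoto u by auto
    then have "artin.cls (SOME v. reduced v \<and> wd v = wd u) = artin.cls u"
      using artin.cls_eq_iff [OF reduced_lists [OF v(1)] reduced_lists [OF u]] by blast
    then show "artin.cls u \<in> ?f ` wd ` lists A" using u by (intro image_eqI [of _ _ "wd u"]) auto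
  qed
  then show ?thesis using finite_wd by (meson finite_imageI finite_subset)
qed

lemma ex_garside_element: "\<exists>\<Delta>. garside_element artin.M \<Delta>"
proof -
  obtain w where w: "reduced w" "\<And>u. u \<in> lists A \<Longrightarrow> artin.ldvd u w \<longleftrightarrow> reduced u"
    "\<And>u. u \<in> lists A \<Longrightarrow> artin.rdvd u w \<longleftrightarrow> reduced u" using ex_longest by blast
  have wl: "w \<in> lists A" using w by auto
  have L: "left_divisors artin.M (artin.cls w) = {artin.cls u |u. reduced u}"
  proof -
    have "left_divisors artin.M (artin.cls w) = {artin.cls u |u. u \<in> lists A \<and> artin.ldvd u w}"
      using wl by (auto simp: left_divisors_def artin.carrier_M artin.divides_M)
    moreover have "u \<in> lists A \<and> artin.ldvd u w \<longleftrightarrow> reduced u" for u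
      using w(2) [of u] reduced_lists [of u] by blast
    ultimately show ?thesis by (simp only:)
  qed
  have R: "right_divisors artin.M (artin.cls w) = {artin.cls u |u. reduced u}"
  proof -
    have "right_divisors artin.M (artin.cls w) = {artin.cls u |u. u \<in> lists A \<and> artin.rdvd u w}"
      using wl by (auto simp: right_divisors_def left_divisors_def artin.carrier_M artin.divides_opp)
    moreover have "u \<in> lists A \<and> artin.rdvd u w \<longleftrightarrow> reduced u" for u
      using w(3) [of u] reduced_lists [of u] by blast
    ultimately show ?thesis by (simp only:)
  qed
  have sub: "{artin.cls u |u. reduced u} \<subseteq> carrier artin.M" by auto
  have "x \<in> word_prod artin.M ` lists {artin.cls u |u. reduced u}" if "x \<in> carrier artin.M" for x
  proof -
    obtain u where u: "u \<in> lists A" "x = artin.cls u" using \<open>x \<in> carrier artin.M\<close> by (auto simp: artin.carrier_M)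
    let ?ws = "map (\<lambda>s. [s]) u"
    have ws: "?ws \<in> lists (lists A)" "concat ?ws = u" using u(1) by (induction u) auto
    have "map artin.cls ?ws \<in> lists {artin.cls u |u. reduced u}"
      using u(1) reduced_letter by (induction u) auto
    moreover have "x = word_prod artin.M (map artin.cls ?ws)"
      unfolding artin.word_prod_cls [OF ws(1)] ws(2) by (rule u(2))
    ultimately show ?thesis by (rule rev_image_eqI)
  qed
  moreover have "word_prod artin.M l \<in> carrier artin.M" if "l \<in> lists {artin.cls u |u. reduced u}" for l
  proof -
    interpret monoid artin.M by (rule artin.monoid_M)
    show ?thesis using that sub by (induction l) (auto simp: word_prod_def)
  qed
  ultimately have "generates_monoid artin.M {artin.cls u |u. reduced u}"
    unfolding generates_monoid_def using sub by blast
  then show ?thesis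
    unfolding garside_element_def using wl L R finite_reduced_classes by (intro exI [of _ "artin.cls w"]) simp
qed

lemma garside_monoid_artin: "garside_monoid artin.M"
  unfolding garside_monoid_def
proof (intro conjI ballI)
  show "monoid_cancel artin.M"
    unfolding artin.monoid_cancel_M_iff using artin_cancel_left artin_cancel_right by blast
  show "has_lcms_gcds artin.M" "has_lcms_gcds (opp_monoid artin.M)" by (rule artin_lcms_gcds)+
  show "\<exists>\<Delta>. garside_element artin.M \<Delta>" by (rule ex_garside_element)
  then show "\<exists>S. finite S \<and> generates_monoid artin.M S" unfolding garside_element_def by blast
  fix x assume "x \<in> carrier artin.M"
  then obtain u where u: "u \<in> lists A" "x = artin.cls u" by (auto simp: artin.carrier_M)
  have "length l \<le> length u"
    if l: "l \<in> lists (carrier artin.M - {\<one>\<^bsub>artin.M\<^esub>})" "word_prod artin.M l = x" for l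
  proof -
    have "\<exists>ws\<in>lists (lists A). l = map artin.cls ws \<and> length l \<le> length (concat ws)"
      using l(1)
    proof (induction l rule: list.induct)
      case (Cons c l)
      then have "c \<in> carrier artin.M" "c \<noteq> artin.cls []" "l \<in> lists (carrier artin.M - {\<one>\<^bsub>artin.M\<^esub>})"
        by (auto simp: artin.one_M)
      then obtain v ws where v: "v \<in> lists A" "c = artin.cls v"
        and ws: "ws \<in> lists (lists A)" "l = map artin.cls ws" "length l \<le> length (concat ws)"
        using Cons.IH unfolding artin.carrier_M by blast
      have "v \<noteq> []" using v \<open>c \<noteq> artin.cls []\<close> by blast
      then obtain a v' where "v = a # v'" by (cases v) auto
      then have "length (c # l) \<le> length (concat (v # ws))" using ws(3) by simp
      then show ?case using v ws by (intro bexI [of _ "v # ws"]) auto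
    qed simp
    then obtain ws where ws: "ws \<in> lists (lists A)" "l = map artin.cls ws" "length l \<le> length (concat ws)" by blast
    then have "artin.cls (concat ws) = artin.cls u" using l(2) u(2) artin.word_prod_cls [OF ws(1)] by simp
    then have "concat ws \<simeq> u" using artin.cls_eq_iff [OF concat_in_lists [OF ws(1)] u(1)] by simp
    then show ?thesis using artin.eqv_length ws(3) by fastforce
  qed
  then show "\<exists>n. \<forall>l\<in>lists (carrier artin.M - {\<one>\<^bsub>artin.M\<^esub>}). word_prod artin.M l = x \<longrightarrow> length l \<le> n" by blast
qed

end

text \<open>\<open>spherical_type\<close> speaks of the group presentation with formal inverses, the
  locale of the monoid presentation. Forgetting the exponents respects the relations, since
  generators are involutions, and maps the classes of the former onto those of the latter.\<close>

lemma spherical_finite_coxeter: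
  assumes "spherical_type A m"
  shows "finite_coxeter A m"
proof -
  interpret coxeter A m using assms by unfold_locales (simp add: spherical_type_def)
  interpret grp: presentation "group_letters A" "group_rels A (coxeter_rels A m)" .
  have forget: "map fst w \<in> lists A" if "w \<in> lists (group_letters A)" for w
    using that by (induction w) (auto simp: group_letters_def)
  have "(map fst w, map fst w') \<in> pres_cong A (coxeter_rels A m)" if "grp.eqv w w'" for w w'
    using that
  proof (induction rule: pres_cong.induct)
    case (refl u)
    then show ?case using forget by (intro eqv_refl)
  next
    case (rel u v p q)
    have "(map fst u, map fst v) \<in> pres_cong A (coxeter_rels A m)"
    proof -
      have fst_pos: "map fst (pos_word x) = x" for x :: "'a list" by (induction x) auto
      from rel(1) consider x y where "u = pos_word x" "v = pos_word y" "(x, y) \<in> coxeter_rels A m"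
        | a e where "u = [(a, e), (a, \<not> e)]" "v = []" "a \<in> A" by (auto simp: group_rels_def)
      then show ?thesis
      proof cases
        case 1
        then show ?thesis using rel(2,3) fst_pos by (auto intro: eqv_rel)
      next
        case 2
        then show ?thesis using square_eqv by simp
      qed
    qed
    then have "(map fst p @ map fst u @ map fst q, map fst p @ map fst v @ map fst q) \<in> pres_cong A (coxeter_rels A m)"
      using forget rel(4,5) by (intro eqv_append_left eqv_append_right) auto
    then show ?case by simp
  qed (auto intro: eqv_sym eqv_trans)
  note fst_eqv = this
  let ?f = "\<lambda>c. cls (map fst (SOME w. w \<in> lists (group_letters A) \<and> c = grp.cls w))"
  have "cls ` lists A \<subseteq> ?f ` carrier grp.M"
  proof
    fix c assume "c \<in> cls ` lists A"
    then obtain u where u: "u \<in> lists A" "c = cls u" by auto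
    let ?p = "pos_word u"
    have p: "?p \<in> lists (group_letters A)" "map fst ?p = u" using u(1) by (simp, induction u) auto
    then have "\<exists>w. w \<in> lists (group_letters A) \<and> grp.cls ?p = grp.cls w" by blast
    from someI_ex [OF this]
    have w: "(SOME w. w \<in> lists (group_letters A) \<and> grp.cls ?p = grp.cls w) \<in> lists (group_letters A)"
      "grp.eqv ?p (SOME w. w \<in> lists (group_letters A) \<and> grp.cls ?p = grp.cls w)"
      using p(1) grp.cls_eq_iff by auto
    have "c = ?f (grp.cls ?p)"
      using fst_eqv [OF w(2)] p(2) forget [OF w(1)] u cls_eq_iff by simp
    then show "c \<in> ?f ` carrier grp.M" using p(1) by blast
  qed
  moreover have "finite (carrier grp.M)" using assms by (simp add: spherical_type_def pres_group_def)
  ultimately have "finite (cls ` lists A)" by (meson finite_imageI finite_subset)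
  then show ?thesis by unfold_locales
qed

lemma artin_homogeneous_garside:
  assumes "spherical_type A m"
  shows "homogeneous_garside_presentation A (artin_rels A m)"
proof -
  interpret finite_coxeter A m by (rule spherical_finite_coxeter [OF assms])
  have fin: "finite A" using assms by (simp add: spherical_type_def)
  have "artin_rels A m \<subseteq> (\<lambda>(s, t). (alternating s t (m s t), alternating t s (m s t))) ` (A \<times> A)"
    by (auto simp: artin_rels_def)
  then have "finite (artin_rels A m)" using fin by (meson finite_SigmaI finite_imageI finite_subset)
  moreover have "artin_rels A m \<subseteq> lists A \<times> lists A"
    by (auto simp: artin_rels_def alternating_lists)
  moreover have "\<forall>(u, v)\<in>artin_rels A m. length u = length v" by (auto simp: artin_rels_def)
  ultimately show ?thesis
    using fin garside_monoid_artin by (simp add: homogeneous_garside_presentation_def)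
qed

theorem theorem3p15:
  shows
    "(\<forall>(A :: 'a set) R \<Delta>.
        homogeneous_garside_presentation A R \<and> garside_element (pres_monoid A R) \<Delta> \<longrightarrow>
          regular_language (garside_alphabet A R \<Delta>)
            (ConjGeo (pres_group A R) (garside_alphabet A R \<Delta>)) \<and>
          (\<exists>r. linear_order_on (garside_alphabet A R \<Delta>) r \<and>
             regular_language (garside_alphabet A R \<Delta>)
               (ConjMinLenSL (pres_group A R) (garside_alphabet A R \<Delta>) r)))
     \<and>
     (\<forall>(A :: 'a set) m R.
        spherical_type A m \<and> R = artin_rels A m \<longrightarrow>
          homogeneous_garside_presentation A R \<and>
          (\<forall>\<Delta>. garside_element (pres_monoid A R) \<Delta> \<longrightarrow>
             regular_language (garside_alphabet A R \<Delta>)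
               (ConjGeo (pres_group A R) (garside_alphabet A R \<Delta>)) \<and>
             (\<exists>r. linear_order_on (garside_alphabet A R \<Delta>) r \<and>
                regular_language (garside_alphabet A R \<Delta>)
                  (ConjMinLenSL (pres_group A R) (garside_alphabet A R \<Delta>) r))))"
proof (intro conjI allI impI; (elim conjE)?)
  fix A :: "'a set" and R \<Delta>
  assume "homogeneous_garside_presentation A R" "garside_element (pres_monoid A R) \<Delta>"
  then show "regular_language (garside_alphabet A R \<Delta>) (ConjGeo (pres_group A R) (garside_alphabet A R \<Delta>))"
    "\<exists>r. linear_order_on (garside_alphabet A R \<Delta>) r \<and>
      regular_language (garside_alphabet A R \<Delta>) (ConjMinLenSL (pres_group A R) (garside_alphabet A R \<Delta>) r)"
    by (rule regular_conjugacy_languages_garside)+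
next
  fix A :: "'a set" and m R
  assume R: "spherical_type A m" "R = artin_rels A m"
  then show hg: "homogeneous_garside_presentation A R"
    using artin_homogeneous_garside by blast
  fix \<Delta>
  assume "garside_element (pres_monoid A R) \<Delta>"
  with hg show "regular_language (garside_alphabet A R \<Delta>) (ConjGeo (pres_group A R) (garside_alphabet A R \<Delta>))"
    "\<exists>r. linear_order_on (garside_alphabet A R \<Delta>) r \<and>
      regular_language (garside_alphabet A R \<Delta>) (ConjMinLenSL (pres_group A R) (garside_alphabet A R \<Delta>) r)"
    by (rule regular_conjugacy_languages_garside)+
qed

end
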